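(* Let $\nu\neq0$ be a finite Borel measure on $[0,\infty]$ and let $(\mathcal{E},\mathcal{E}_+,\theta):=(L^2(\mathbb{R},\mathbb{C}),H^2(\mathbb{C}_+),\theta_{h_\nu})$. Then the Osterwalder--Schrader transform $\hat{\mathcal{E}}$ satisfies $$\hat{\mathcal{E}}\cong L^2(\mathbb{R}_+,\mathbb{C},\mathcal{T}\nu),$$ where the isometric isomorphism of Hilbert spaces is given by (the continuous extension to $\hat{\mathcal{E}}$ of) the map $f+\mathcal{N}_\theta\mapsto f^{\mathtt V}$ with $f^{\mathtt V}(\lambda):=f(i\lambda)$ for $\lambda\in\mathbb{R}_+$, $f\in H^2(\mathbb{C}_+)$.
   Context: $\mathbb{R}_+=(0,\infty)$, $\mathbb{C}_+=\{z\in\mathbb{C}:\operatorname{Im} z>0\}$; $[0,\infty]$ is the one-point compactification of $[0,\infty)$. $H^2(\mathbb{C}_+)$ is the Hardy space of holomorphic $f:\mathbb{C}_+\to\mathbb{C}$ with $\sup_{y>0}\int_{\mathbb{R}}|f(x+iy)|^2dx<\infty$, identified via boundary values with a closed subspace of $L^2(\mathbb{R},\mathbb{C})$. For $h\in L^\infty(\mathbb{R},\mathbb{C})$, $(\theta_hf)(x)=h(x)f(-x)$. For a finite Borel measure $\nu\ne0$ on $[0,\infty]$ put $\Psi_\nu(p)=\frac1\pi\int_{[0,\infty]}\frac{1+\lambda^2}{p^2+\lambda^2}\,d\nu(\lambda)$, $p\in\mathbb{R}\setminus\{0\}$ (integrand $1$ at $\lambda=\infty$), and $$F_\nu(z)=\exp\left(\frac1{\pi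 i}\int_{\mathbb{R}}\left[\frac1{p-z}-\frac p{1+p^2}\right]\log\sqrt{\Psi_\nu(p)}\,dp\right),\quad z\in\mathbb{C}_+.$$ The boundary values $F_\nu(x)=\lim_{\epsilon\downarrow0}F_\nu(x+i\epsilon)$ exist a.e. on $\mathbb{R}$, and $h_\nu(x)=F_\nu(x)/F_\nu(-x)$, which satisfies $|h_\nu|=1$ and $h_\nu(x)=\overline{h_\nu(-x)}$ a.e. The triple $(L^2(\mathbb{R},\mathbb{C}),H^2(\mathbb{C}_+),\theta_{h_\nu})$ is a reflection positive Hilbert space, i.e. $\theta_{h_\nu}$ is a unitary involution with $\langle f,\theta_{h_\nu}f\rangle\ge0$ for all $f\in H^2(\mathbb{C}_+)$. The Borel measure $\mathcal{T}\nu$ on $\mathbb{R}_+$ is defined by $d(\mathcal{T}\nu)(\lambda)=|F_\nu(i\lambda)|^{-2}\,\frac{1+\lambda^2}{\lambda}\,d\nu(\lambda)$, $\lambda\in\mathbb{R}_+$. For a reflection positive Hilbert space $(\mathcal{E},\mathcal{E}_+,\theta)$, let $\mathcal{N}_\theta=\{\eta\in\mathcal{E}_+:\langle\eta,\theta\eta\rangle=0\}$; its Osterwalder--Schrader transform $\hat{\mathcal{E}}$ is the Hilbert space completion of $\mathcal{E}_+/\mathcal{N}_\theta$ with respect to the scalar product $\langle\eta+\mathcal{N}_\theta,\xi+\mathcal{N}_\theta\rangle_{\hat{\mathcal{E}}}=\langle\eta,\theta\xi\rangle$. *)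

theory Defs
  imports "HOL-Analysis.Analysis"
begin

section \<open>Complex (semi-)inner product spaces with explicit carriers\<close>

text \<open>Scalar products are linear in the second argument.\<close>

record 'v ip_space =
  vcarrier :: "'v set"
  vadd :: "'v \<Rightarrow> 'v \<Rightarrow> 'v"
  vscale :: "complex \<Rightarrow> 'v \<Rightarrow> 'v"
  vinner :: "'v \<Rightarrow> 'v \<Rightarrow> complex"

definition vnorm :: "'v ip_space \<Rightarrow> 'v \<Rightarrow> real" where
  "vnorm V x = sqrt (Re (vinner V x x))"

definition vdiff :: "'v ip_space \<Rightarrow> 'v \<Rightarrow> 'v \<Rightarrow> 'v" where
  "vdiff V x y = vadd V x (vscale V (- 1) y)"

definition vcoset :: "'v ip_space \<Rightarrow> 'v set \<Rightarrow> 'v \<Rightarrow> 'v set" where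
  "vcoset V N x = {vadd V x n | n. n \<in> N}"

text \<open>The quotient by a subspace \<open>N\<close> contained in the radical of the semi-inner product:
  the unions below then range over equal cosets, and \<open>the_elem\<close> is applied to a singleton.\<close>

definition vquotient :: "'v ip_space \<Rightarrow> 'v set \<Rightarrow> 'v set ip_space" where
  "vquotient V N = \<lparr>
     vcarrier = vcoset V N ` vcarrier V,
     vadd = (\<lambda>A B. \<Union>a\<in>A. \<Union>b\<in>B. vcoset V N (vadd V a b)),
     vscale = (\<lambda>c A. \<Union>a\<in>A. vcoset V N (vscale V c a)),
     vinner = (\<lambda>A B. the_elem (\<Union>a\<in>A. \<Union>b\<in>B. {vinner V a b})) \<rparr>"

text \<open>The Hilbert space completion of a pre-Hilbert space: Cauchy sequences modulo null sequences.\<close>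

definition vCauchy :: "'v ip_space \<Rightarrow> (nat \<Rightarrow> 'v) \<Rightarrow> bool" where
  "vCauchy V s \<longleftrightarrow> (\<forall>n. s n \<in> vcarrier V) \<and>
     (\<forall>e>0. \<exists>M. \<forall>m\<ge>M. \<forall>n\<ge>M. vnorm V (vdiff V (s m) (s n)) < e)"

definition Cauchy_space :: "'v ip_space \<Rightarrow> (nat \<Rightarrow> 'v) ip_space" where
  "Cauchy_space V = \<lparr>
     vcarrier = {s. vCauchy V s},
     vadd = (\<lambda>s t n. vadd V (s n) (t n)),
     vscale = (\<lambda>c s n. vscale V c (s n)),
     vinner = (\<lambda>s t. lim (\<lambda>n. vinner V (s n) (t n))) \<rparr>"

definition null_sequences :: "'v ip_space \<Rightarrow> (nat \<Rightarrow> 'v) set" where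
  "null_sequences V = {s. vCauchy V s \<and> (\<lambda>n. vnorm V (s n)) \<longlonglongrightarrow> 0}"

definition completion :: "'v ip_space \<Rightarrow> (nat \<Rightarrow> 'v) set ip_space" where
  "completion V = vquotient (Cauchy_space V) (null_sequences V)"

definition completion_embed :: "'v ip_space \<Rightarrow> 'v \<Rightarrow> (nat \<Rightarrow> 'v) set" where
  "completion_embed V x = vcoset (Cauchy_space V) (null_sequences V) (\<lambda>n. x)"

definition isometric_isomorphism ::
    "'v ip_space \<Rightarrow> 'w ip_space \<Rightarrow> ('v \<Rightarrow> 'w) \<Rightarrow> bool" where
  "isometric_isomorphism V W U \<longleftrightarrow>
     bij_betw U (vcarrier V) (vcarrier W) \<and>
     (\<forall>x\<in>vcarrier V. \<forall>y\<in>vcarrier V. U (vadd V x y) = vadd W (U x) (U y)) \<and>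
     (\<forall>c. \<forall>x\<in>vcarrier V. U (vscale V c x) = vscale W c (U x)) \<and>
     (\<forall>x\<in>vcarrier V. \<forall>y\<in>vcarrier V. vinner W (U x) (U y) = vinner V x y)"

section \<open>The Osterwalder--Schrader transform of a triple \<open>(E, Ep, \<theta>)\<close>\<close>

definition os_null :: "'v ip_space \<Rightarrow> 'v set \<Rightarrow> ('v \<Rightarrow> 'v) \<Rightarrow> 'v set" where
  "os_null E Ep \<theta> = {\<eta> \<in> Ep. vinner E \<eta> (\<theta> \<eta>) = 0}"

definition os_form :: "'v ip_space \<Rightarrow> 'v set \<Rightarrow> ('v \<Rightarrow> 'v) \<Rightarrow> 'v ip_space" where
  "os_form E Ep \<theta> = E \<lparr> vcarrier := Ep, vinner := (\<lambda>\<eta> \<xi>. vinner E \<eta> (\<theta> \<xi>)) \<rparr>"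

definition os_quotient :: "'v ip_space \<Rightarrow> 'v set \<Rightarrow> ('v \<Rightarrow> 'v) \<Rightarrow> 'v set ip_space" where
  "os_quotient E Ep \<theta> = vquotient (os_form E Ep \<theta>) (os_null E Ep \<theta>)"

definition os_transform ::
    "'v ip_space \<Rightarrow> 'v set \<Rightarrow> ('v \<Rightarrow> 'v) \<Rightarrow> (nat \<Rightarrow> 'v set) set ip_space" where
  "os_transform E Ep \<theta> = completion (os_quotient E Ep \<theta>)"

text \<open>The coset of \<open>\<eta>\<close> modulo \<open>os_null\<close>, as an element of the completion.\<close>

definition os_class ::
    "'v ip_space \<Rightarrow> 'v set \<Rightarrow> ('v \<Rightarrow> 'v) \<Rightarrow> 'v \<Rightarrow> (nat \<Rightarrow> 'v set) set" where
  "os_class E Ep \<theta> \<eta> =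
     completion_embed (os_quotient E Ep \<theta>) (vcoset (os_form E Ep \<theta>) (os_null E Ep \<theta>) \<eta>)"

section \<open>Complex \<open>L\<^sup>2\<close> spaces and the Hardy space of the upper half-plane\<close>

definition sq_integrable_space :: "'a measure \<Rightarrow> ('a \<Rightarrow> complex) ip_space" where
  "sq_integrable_space M = \<lparr>
     vcarrier = {f \<in> borel_measurable M. integrable M (\<lambda>x. (cmod (f x))\<^sup>2)},
     vadd = (\<lambda>f g x. f x + g x),
     vscale = (\<lambda>c f x. c * f x),
     vinner = (\<lambda>f g. LINT x|M. cnj (f x) * g x) \<rparr>"

definition ae_zero :: "'a measure \<Rightarrow> ('a \<Rightarrow> complex) set" where
  "ae_zero M = {f \<in> vcarrier (sq_integrable_space M). AE x in M. f x = 0}"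

definition L2 :: "'a measure \<Rightarrow> ('a \<Rightarrow> complex) set ip_space" where
  "L2 M = vquotient (sq_integrable_space M) (ae_zero M)"

definition L2_class :: "'a measure \<Rightarrow> ('a \<Rightarrow> complex) \<Rightarrow> ('a \<Rightarrow> complex) set" where
  "L2_class M f = vcoset (sq_integrable_space M) (ae_zero M) f"

text \<open>Elements of the Hardy space matter only through their values on the upper half-plane;
  their values elsewhere are arbitrary.\<close>

definition hardy2 :: "(complex \<Rightarrow> complex) set" where
  "hardy2 = {f. f holomorphic_on {z. Im z > 0} \<and>
     (SUP y\<in>{0<..}. \<integral>\<^sup>+x. ennreal ((cmod (f (Complex x y)))\<^sup>2) \<partial>lborel) < \<infinity>}"

definition boundary_function :: "(complex \<Rightarrow> complex) \<Rightarrow> (real \<Rightarrow> complex) \<Rightarrow> bool" where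
  "boundary_function f g \<longleftrightarrow> g \<in> vcarrier (sq_integrable_space lborel) \<and>
     (AE x in lborel. ((\<lambda>\<epsilon>. f (Complex x \<epsilon>)) \<longlongrightarrow> g x) (at_right 0))"

text \<open>The Hardy space as a subspace of \<open>L\<^sup>2(\<real>)\<close>.\<close>

definition hardy2_L2 :: "(real \<Rightarrow> complex) set set" where
  "hardy2_L2 = {L2_class lborel g | f g. f \<in> hardy2 \<and> boundary_function f g}"

definition reflect :: "(real \<Rightarrow> complex) \<Rightarrow> (real \<Rightarrow> complex) set \<Rightarrow> (real \<Rightarrow> complex) set" where
  "reflect h A = (\<Union>f\<in>A. L2_class lborel (\<lambda>x. h x * f (- x)))"

section \<open>The data attached to a finite Borel measure on \<open>[0,\<infinity>]\<close>\<close>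

text \<open>The one-point compactification \<open>[0,\<infinity>]\<close> is the type \<^typ>\<open>ennreal\<close>.\<close>

definition Psi :: "ennreal measure \<Rightarrow> real \<Rightarrow> real" where
  "Psi \<nu> p = 1 / pi * (LINT l|\<nu>. (if l = \<infinity> then 1
      else (1 + (enn2real l)\<^sup>2) / (p\<^sup>2 + (enn2real l)\<^sup>2)))"

definition F_outer :: "ennreal measure \<Rightarrow> complex \<Rightarrow> complex" where
  "F_outer \<nu> z = exp (1 / (of_real pi * \<i>) *
     (LINT p|lborel. (1 / (of_real p - z) - of_real (p / (1 + p\<^sup>2)))
        * of_real (ln (sqrt (Psi \<nu> p)))))"

definition F_boundary :: "ennreal measure \<Rightarrow> real \<Rightarrow> complex" where
  "F_boundary \<nu> x = Lim (at_right 0) (\<lambda>\<epsilon>. F_outer \<nu> (Complex x \<epsilon>))"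

definition h_fun :: "ennreal measure \<Rightarrow> real \<Rightarrow> complex" where
  "h_fun \<nu> x = F_boundary \<nu> x / F_boundary \<nu> (- x)"

text \<open>The restriction of \<open>\<nu>\<close> to \<open>(0,\<infinity>)\<close> is transported to a Borel measure on the subspace
  \<open>{0<..}\<close> of the reals and then weighted.\<close>

definition T_measure :: "ennreal measure \<Rightarrow> real measure" where
  "T_measure \<nu> = density
     (distr (restrict_space \<nu> {0<..<\<infinity>}) (restrict_space borel {0<..}) enn2real)
     (\<lambda>l. ennreal (1 / (cmod (F_outer \<nu> (\<i> * of_real l)))\<^sup>2 * ((1 + l\<^sup>2) / l)))"

end

theory Submission
  imports Defs "HOL-Complex_Analysis.Complex_Analysis"
begin

text \<open>Write \<open>f\<^sub>1, f\<^sub>2\<close> for two functions in the Hardy space, with boundary values \<open>g\<^sub>1, g\<^sub>2\<close>. Since \<open>F\<close> is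
  outer with \<open>\<bar>F\<bar>\<^sup>2 = Psi \<nu>\<close> on the line and \<open>F (- cnj z) = cnj (F z)\<close>, one has \<open>h x = Psi \<nu> x / F (- x)\<^sup>2\<close>, so the
  reflected form is the integral of \<open>cnj (g\<^sub>1 (- x)) * g\<^sub>2 x * Psi \<nu> x / F x\<^sup>2\<close>. Inserting the definition of
  \<open>Psi \<nu>\<close> and exchanging the integrals leaves for each \<open>l\<close> the integral against \<open>(1 + l\<^sup>2) / (x\<^sup>2 + l\<^sup>2)\<close>, which
  Cauchy's formula evaluates by the residue at \<open>i l\<close>, because \<open>1 / (F\<^sup>2 (z + i l)\<^sup>2)\<close> is bounded on the upper
  half-plane. Atoms at \<open>0\<close> and \<open>\<infinity>\<close> contribute nothing. Hence the reflected form is the scalar product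
  of the restrictions to the imaginary axis in the weighted space. These restrictions are dense there, and the
  isometry extends to the completion.\<close>

section \<open>Semi-inner product spaces\<close>

text \<open>Boundary values are not constructed for a general Hardy function: the argument runs over
  pairs \<open>hardy_pair f g\<close>, and the Poisson formula shows that the class of
  \<open>g\<close> determines \<open>f\<close> on the half-plane, which makes evaluation on the
  imaginary axis a map on \<open>hardy2_L2\<close>. The residue step needs a bound inside the
  half-plane, and for a holomorphic function a bound on the line alone is not enough. It comes from
  a lower bound for \<open>ln (sqrt (Psi \<nu> p))\<close>, integrated against the Poisson kernel:
  for 0 < l < \<infinity> the total mass of \<open>\<nu>\<close> gives \<open>Psi\<close> at least c
  / (p^2 + l^2) with c > 0, while at the two end points the constant is the mass of the atom, and an
  end point without an atom is a null set. Symmetry and positivity of the reflected form are read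
  off from the weighted scalar product. \<open>T_measure \<nu>\<close> can have infinite mass, so
  density is proved with the weight 1 / (1 + l), itself the restriction of a Hardy function and
  therefore square-integrable.\<close>

locale semi_ip =
  fixes V :: "'v ip_space"
  assumes add_closed: "x \<in> vcarrier V \<Longrightarrow> y \<in> vcarrier V \<Longrightarrow> vadd V x y \<in> vcarrier V"
    and scale_closed: "x \<in> vcarrier V \<Longrightarrow> vscale V c x \<in> vcarrier V"
    and nonempty: "vcarrier V \<noteq> {}"
    and add_assoc: "x \<in> vcarrier V \<Longrightarrow> y \<in> vcarrier V \<Longrightarrow> z \<in> vcarrier V \<Longrightarrow>
      vadd V (vadd V x y) z = vadd V x (vadd V y z)"
    and add_comm: "x \<in> vcarrier V \<Longrightarrow> y \<in> vcarrier V \<Longrightarrow> vadd V x y = vadd V y x"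
    and scale_add_right: "x \<in> vcarrier V \<Longrightarrow> y \<in> vcarrier V \<Longrightarrow>
      vscale V c (vadd V x y) = vadd V (vscale V c x) (vscale V c y)"
    and scale_add_left: "x \<in> vcarrier V \<Longrightarrow>
      vscale V (c + d) x = vadd V (vscale V c x) (vscale V d x)"
    and scale_scale: "x \<in> vcarrier V \<Longrightarrow> vscale V c (vscale V d x) = vscale V (c * d) x"
    and scale_one: "x \<in> vcarrier V \<Longrightarrow> vscale V 1 x = x"
    and add_zero: "x \<in> vcarrier V \<Longrightarrow> y \<in> vcarrier V \<Longrightarrow> vadd V x (vscale V 0 y) = x"
    and inner_add: "x \<in> vcarrier V \<Longrightarrow> y \<in> vcarrier V \<Longrightarrow> z \<in> vcarrier V \<Longrightarrow>
      vinner V x (vadd V y z) = vinner V x y + vinner V x z"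
    and inner_scale: "x \<in> vcarrier V \<Longrightarrow> y \<in> vcarrier V \<Longrightarrow>
      vinner V x (vscale V c y) = c * vinner V x y"
    and inner_cnj: "x \<in> vcarrier V \<Longrightarrow> y \<in> vcarrier V \<Longrightarrow> vinner V y x = cnj (vinner V x y)"
    and inner_pos: "x \<in> vcarrier V \<Longrightarrow> Re (vinner V x x) \<ge> 0"
begin

lemma diff_closed: "x \<in> vcarrier V \<Longrightarrow> y \<in> vcarrier V \<Longrightarrow> vdiff V x y \<in> vcarrier V"
  by (simp add: vdiff_def add_closed scale_closed)

lemmas closed = add_closed scale_closed diff_closed

lemma inner_add_left:
  "x \<in> vcarrier V \<Longrightarrow> y \<in> vcarrier V \<Longrightarrow> z \<in> vcarrier V \<Longrightarrow>
    vinner V (vadd V y z) x = vinner V y x + vinner V z x"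
  using inner_cnj[of x "vadd V y z"] inner_cnj[of x y] inner_cnj[of x z]
  by (simp add: add_closed inner_add)

lemma inner_scale_left:
  "x \<in> vcarrier V \<Longrightarrow> y \<in> vcarrier V \<Longrightarrow> vinner V (vscale V c y) x = cnj c * vinner V y x"
  using inner_cnj[of x "vscale V c y"] inner_cnj[of x y] by (simp add: scale_closed inner_scale)

lemma inner_diff:
  "x \<in> vcarrier V \<Longrightarrow> y \<in> vcarrier V \<Longrightarrow> z \<in> vcarrier V \<Longrightarrow>
    vinner V x (vdiff V y z) = vinner V x y - vinner V x z"
  by (simp add: vdiff_def inner_add inner_scale closed)

lemma inner_diff_left:
  "x \<in> vcarrier V \<Longrightarrow> y \<in> vcarrier V \<Longrightarrow> z \<in> vcarrier V \<Longrightarrow>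
    vinner V (vdiff V y z) x = vinner V y x - vinner V z x"
  by (simp add: vdiff_def inner_add_left inner_scale_left closed)

lemmas inner_simps = inner_add inner_scale inner_diff inner_add_left inner_scale_left inner_diff_left

lemma inner_self: "x \<in> vcarrier V \<Longrightarrow> vinner V x x = complex_of_real ((vnorm V x)\<^sup>2)"
  using inner_pos[of x] inner_cnj[of x x] by (simp add: vnorm_def complex_eq_iff)

lemma norm_nonneg [simp]: "vnorm V x \<ge> 0" if "x \<in> vcarrier V"
  using inner_pos[OF that] by (simp add: vnorm_def)

text \<open>Equalities of norms below are proved by expanding both inner products and comparing
  scalars with \<open>algebra_simps\<close>, which avoids rearranging sums inside the abstract
  carrier.\<close>

lemma norm_eqI: "vinner V x x = vinner V y y \<Longrightarrow> vnorm V x = vnorm V y"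
  by (simp add: vnorm_def)

text \<open>The form may be degenerate, so \<open>b\<close> can vanish for a nonzero
  \<open>y\<close>. The inequality \<open>key\<close> is positivity at x - t cnj(s) y for real t; t
  = 1 / b gives the claim if b > 0. If b = 0 the expression is affine in t, and t = (a + 1) / |s|^2
  would make it negative, so s = 0.\<close>

lemma Cauchy_Schwarz:
  assumes x: "x \<in> vcarrier V" and y: "y \<in> vcarrier V"
  shows "cmod (vinner V x y) \<le> vnorm V x * vnorm V y"
proof -
  define s where "s = vinner V x y"
  define a where "a = (vnorm V x)\<^sup>2"
  define b where "b = (vnorm V y)\<^sup>2"
  have key: "a - 2 * t * (cmod s)\<^sup>2 + t\<^sup>2 * (cmod s)\<^sup>2 * b \<ge> 0" for t :: real
  proof -
    define c where "c = of_real t * cnj s"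
    have "vinner V (vdiff V x (vscale V c y)) (vdiff V x (vscale V c y)) =
      of_real a - c * s - cnj c * cnj s + c * cnj c * of_real b"
      using x y inner_self[OF x] inner_self[OF y] inner_cnj[OF x y]
      by (simp add: inner_simps closed a_def b_def s_def algebra_simps)
    also have "c * s = of_real (t * (cmod s)\<^sup>2)"
      using complex_norm_square[of s] by (simp add: c_def mult.commute mult.left_commute)
    also have "cnj c * cnj s = of_real (t * (cmod s)\<^sup>2)"
      using complex_norm_square[of s] by (simp add: c_def mult.commute mult.left_commute)
    also have "c * cnj c = of_real (t\<^sup>2 * (cmod s)\<^sup>2)"
      using complex_norm_square[of s]
      by (simp add: c_def power2_eq_square mult.commute mult.left_commute)
    finally have "Re (vinner V (vdiff V x (vscale V c y)) (vdiff V x (vscale V c y))) =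
      a - 2 * t * (cmod s)\<^sup>2 + t\<^sup>2 * (cmod s)\<^sup>2 * b"
      by simp
    with inner_pos[of "vdiff V x (vscale V c y)"] x y show ?thesis by (simp add: closed)
  qed
  have "(cmod s)\<^sup>2 \<le> a * b"
  proof (cases "b = 0")
    case True
    have "(cmod s)\<^sup>2 = 0"
    proof (rule ccontr)
      assume n: "(cmod s)\<^sup>2 \<noteq> 0"
      have "a - 2 * ((a + 1) / (cmod s)\<^sup>2) * (cmod s)\<^sup>2 \<ge> 0"
        using key[of "(a + 1) / (cmod s)\<^sup>2"] True by simp
      then have "a - 2 * (a + 1) \<ge> 0" using n by simp
      moreover have "a \<ge> 0" by (simp add: a_def)
      ultimately show False by (simp add: algebra_simps)
    qed
    then show ?thesis using True by simp
  next
    case False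
    then have b: "b > 0" by (simp add: b_def)
    have "a - (cmod s)\<^sup>2 / b \<ge> 0"
      using key[of "1 / b"] b by (simp add: power2_eq_square field_simps)
    then show ?thesis using b by (simp add: field_simps)
  qed
  then have "(cmod s)\<^sup>2 \<le> (vnorm V x * vnorm V y)\<^sup>2"
    by (simp add: a_def b_def power_mult_distrib)
  then have "cmod s \<le> vnorm V x * vnorm V y"
    by (rule power2_le_imp_le) (simp add: x y)
  then show ?thesis by (simp add: s_def)
qed

lemma norm_add_le:
  assumes x: "x \<in> vcarrier V" and y: "y \<in> vcarrier V"
  shows "vnorm V (vadd V x y) \<le> vnorm V x + vnorm V y"
proof -
  have "vinner V (vadd V x y) (vadd V x y) =
    of_real ((vnorm V x)\<^sup>2) + of_real ((vnorm V y)\<^sup>2) + vinner V x y + cnj (vinner V x y)"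
    using x y inner_cnj[OF x y] inner_self[OF x] inner_self[OF y]
    by (simp add: inner_simps closed)
  then have "(vnorm V (vadd V x y))\<^sup>2 = (vnorm V x)\<^sup>2 + (vnorm V y)\<^sup>2 + 2 * Re (vinner V x y)"
    using inner_pos[OF add_closed[OF x y]] by (simp add: vnorm_def[of V "vadd V x y"])
  also have "\<dots> \<le> (vnorm V x)\<^sup>2 + (vnorm V y)\<^sup>2 + 2 * (vnorm V x * vnorm V y)"
    using Cauchy_Schwarz[OF x y] complex_Re_le_cmod[of "vinner V x y"] by linarith
  also have "\<dots> = (vnorm V x + vnorm V y)\<^sup>2" by (simp add: power2_sum)
  finally show ?thesis by (rule power2_le_imp_le) (simp add: x y)
qed

lemma norm_scale: "x \<in> vcarrier V \<Longrightarrow> vnorm V (vscale V c x) = cmod c * vnorm V x"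
proof -
  assume x: "x \<in> vcarrier V"
  have "vinner V (vscale V c x) (vscale V c x) = of_real ((cmod c * vnorm V x)\<^sup>2)"
    using x inner_self[OF x] complex_norm_square[of c]
    by (simp add: inner_simps closed power_mult_distrib mult_ac)
  then have "vnorm V (vscale V c x) = sqrt ((cmod c * vnorm V x)\<^sup>2)"
    by (simp only: vnorm_def[of V "vscale V c x"] Re_complex_of_real)
  then show ?thesis using x by simp
qed

lemma norm_diff_triangle:
  assumes "x \<in> vcarrier V" "y \<in> vcarrier V" "z \<in> vcarrier V"
  shows "vnorm V (vdiff V x z) \<le> vnorm V (vdiff V x y) + vnorm V (vdiff V y z)"
proof -
  have "vnorm V (vdiff V x z) = vnorm V (vadd V (vdiff V x y) (vdiff V y z))"
    by (rule norm_eqI) (use assms in \<open>simp add: inner_simps closed algebra_simps\<close>)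
  then show ?thesis using assms by (simp add: norm_add_le closed)
qed

lemma norm_diff_commute:
  "x \<in> vcarrier V \<Longrightarrow> y \<in> vcarrier V \<Longrightarrow> vnorm V (vdiff V x y) = vnorm V (vdiff V y x)"
  by (rule norm_eqI) (simp add: inner_simps closed algebra_simps)

lemma norm_diff_self: "x \<in> vcarrier V \<Longrightarrow> vnorm V (vdiff V x x) = 0"
  by (simp add: vnorm_def inner_simps closed)

lemma norm_diff_add:
  assumes "x \<in> vcarrier V" "y \<in> vcarrier V" "x' \<in> vcarrier V" "y' \<in> vcarrier V"
  shows "vnorm V (vdiff V (vadd V x y) (vadd V x' y')) \<le> vnorm V (vdiff V x x') + vnorm V (vdiff V y y')"
proof -
  have "vnorm V (vdiff V (vadd V x y) (vadd V x' y')) = vnorm V (vadd V (vdiff V x x') (vdiff V y y'))"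
    by (rule norm_eqI) (use assms in \<open>simp add: inner_simps closed algebra_simps\<close>)
  then show ?thesis using assms by (simp add: norm_add_le closed)
qed

lemma norm_diff_scale:
  assumes "x \<in> vcarrier V" "x' \<in> vcarrier V"
  shows "vnorm V (vdiff V (vscale V c x) (vscale V c x')) = cmod c * vnorm V (vdiff V x x')"
proof -
  have "vnorm V (vdiff V (vscale V c x) (vscale V c x')) = vnorm V (vscale V c (vdiff V x x'))"
    by (rule norm_eqI) (use assms in \<open>simp add: inner_simps closed algebra_simps\<close>)
  then show ?thesis using assms by (simp add: norm_scale closed)
qed

lemma norm_le_diff:
  assumes "x \<in> vcarrier V" "y \<in> vcarrier V"
  shows "vnorm V x \<le> vnorm V y + vnorm V (vdiff V x y)"
proof -
  have "vnorm V x = vnorm V (vadd V y (vdiff V x y))"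
    by (rule norm_eqI) (use assms in \<open>simp add: inner_simps closed algebra_simps\<close>)
  then show ?thesis using assms norm_add_le[of y "vdiff V x y"] by (simp add: closed)
qed

lemma inner_diff_bound:
  assumes "x \<in> vcarrier V" "y \<in> vcarrier V" "x' \<in> vcarrier V" "y' \<in> vcarrier V"
  shows "cmod (vinner V x y - vinner V x' y') \<le>
    vnorm V (vdiff V x x') * vnorm V y + vnorm V x' * vnorm V (vdiff V y y')"
proof -
  have "vinner V x y - vinner V x' y' = vinner V (vdiff V x x') y + vinner V x' (vdiff V y y')"
    using assms by (simp add: inner_simps closed)
  then show ?thesis
    using assms Cauchy_Schwarz[of "vdiff V x x'" y] Cauchy_Schwarz[of x' "vdiff V y y'"]
      norm_triangle_ineq[of "vinner V (vdiff V x x') y" "vinner V x' (vdiff V y y')"]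
    by (simp add: closed)
qed

lemma inner_tendsto:
  assumes "\<And>n. u n \<in> vcarrier V" "\<And>n. v n \<in> vcarrier V" "x \<in> vcarrier V" "y \<in> vcarrier V"
    and "(\<lambda>n. vnorm V (vdiff V (u n) x)) \<longlonglongrightarrow> 0" and "(\<lambda>n. vnorm V (vdiff V (v n) y)) \<longlonglongrightarrow> 0"
  shows "(\<lambda>n. vinner V (u n) (v n)) \<longlonglongrightarrow> vinner V x y"
proof (rule LIM_zero_cancel, rule Lim_null_comparison)
  show "\<forall>\<^sub>F n in sequentially. cmod (vinner V (u n) (v n) - vinner V x y) \<le>
    vnorm V (vdiff V (u n) x) * (vnorm V y + vnorm V (vdiff V (v n) y)) + vnorm V x * vnorm V (vdiff V (v n) y)"
  proof (rule always_eventually, rule allI)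
    fix n
    have "vnorm V (vdiff V (u n) x) * vnorm V (v n) \<le>
      vnorm V (vdiff V (u n) x) * (vnorm V y + vnorm V (vdiff V (v n) y))"
      using assms by (intro mult_left_mono norm_le_diff) (simp_all add: closed)
    then show "cmod (vinner V (u n) (v n) - vinner V x y) \<le>
      vnorm V (vdiff V (u n) x) * (vnorm V y + vnorm V (vdiff V (v n) y)) + vnorm V x * vnorm V (vdiff V (v n) y)"
      using inner_diff_bound[of "u n" "v n" x y] assms by simp
  qed
  have "(\<lambda>n. vnorm V (vdiff V (u n) x) * (vnorm V y + vnorm V (vdiff V (v n) y)) + vnorm V x * vnorm V (vdiff V (v n) y))
    \<longlonglongrightarrow> 0 * (vnorm V y + 0) + vnorm V x * 0"
    by (intro tendsto_intros assms)
  then show "(\<lambda>n. vnorm V (vdiff V (u n) x) * (vnorm V y + vnorm V (vdiff V (v n) y)) + vnorm V x * vnorm V (vdiff V (v n) y))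
    \<longlonglongrightarrow> 0" by simp
qed

end

text \<open>\<open>ae_zero\<close>, \<open>null_sequences\<close> and \<open>os_null\<close> all
  turn out to be of this form, so a single theory of quotients covers L2, the completion and the
  reflected form.\<close>

definition vnull :: "'v ip_space \<Rightarrow> 'v set" where
  "vnull V = {x \<in> vcarrier V. vinner V x x = 0}"

definition vdefinite :: "'v ip_space \<Rightarrow> bool" where
  "vdefinite V \<longleftrightarrow> (\<forall>x\<in>vcarrier V. \<forall>y\<in>vcarrier V. vnorm V (vdiff V x y) = 0 \<longrightarrow> x = y)"

definition vcomplete :: "'v ip_space \<Rightarrow> bool" where
  "vcomplete V \<longleftrightarrow> (\<forall>s. vCauchy V s \<longrightarrow>
     (\<exists>u\<in>vcarrier V. (\<lambda>n. vnorm V (vdiff V (s n) u)) \<longlonglongrightarrow> 0))"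

definition linear_isometry :: "'v ip_space \<Rightarrow> 'w ip_space \<Rightarrow> ('v \<Rightarrow> 'w) \<Rightarrow> bool" where
  "linear_isometry V W J \<longleftrightarrow> (\<forall>x\<in>vcarrier V. J x \<in> vcarrier W) \<and>
     (\<forall>x\<in>vcarrier V. \<forall>y\<in>vcarrier V. J (vadd V x y) = vadd W (J x) (J y)) \<and>
     (\<forall>c. \<forall>x\<in>vcarrier V. J (vscale V c x) = vscale W c (J x)) \<and>
     (\<forall>x\<in>vcarrier V. \<forall>y\<in>vcarrier V. vinner W (J x) (J y) = vinner V x y)"

lemma isometric_isomorphism_iff:
  "isometric_isomorphism V W U \<longleftrightarrow>
    linear_isometry V W U \<and> inj_on U (vcarrier V) \<and> vcarrier W \<subseteq> U ` vcarrier V"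
  unfolding isometric_isomorphism_def linear_isometry_def bij_betw_def by blast

lemma linear_isometry_norm_diff:
  assumes "linear_isometry V W J" "semi_ip V" "x \<in> vcarrier V" "y \<in> vcarrier V"
  shows "vnorm W (vdiff W (J x) (J y)) = vnorm V (vdiff V x y)"
proof -
  interpret semi_ip V by fact
  have "vdiff W (J x) (J y) = J (vdiff V x y)"
    using assms by (simp add: linear_isometry_def vdiff_def closed)
  then show ?thesis
    using assms by (simp add: linear_isometry_def vnorm_def closed)
qed

section \<open>Quotients by the null space\<close>

lemma UN_UN_const:
  assumes "a \<in> A" "b \<in> B" "\<And>x y. x \<in> A \<Longrightarrow> y \<in> B \<Longrightarrow> f x y = C"
  shows "(\<Union>x\<in>A. \<Union>y\<in>B. f x y) = C"
  using assms by auto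

context semi_ip
begin

lemma vnull_iff: "x \<in> vcarrier V \<Longrightarrow> x \<in> vnull V \<longleftrightarrow> vnorm V x = 0"
  using inner_self[of x] by (simp add: vnull_def)

text \<open>Cosets of the null space are the classes of vectors at distance zero. This turns each
  well-definedness claim about the quotient into a norm estimate.\<close>

lemma coset_eq:
  assumes x: "x \<in> vcarrier V"
  shows "vcoset V (vnull V) x = {a \<in> vcarrier V. vnorm V (vdiff V a x) = 0}"
proof (intro set_eqI iffI)
  fix a assume "a \<in> vcoset V (vnull V) x"
  then obtain n where n: "a = vadd V x n" "n \<in> vnull V" by (auto simp: vcoset_def)
  then have nc: "n \<in> vcarrier V" by (simp add: vnull_def)
  have "vnorm V (vdiff V a x) = vnorm V n"
    by (rule norm_eqI) (use n nc x in \<open>simp add: inner_simps closed\<close>)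
  then show "a \<in> {a \<in> vcarrier V. vnorm V (vdiff V a x) = 0}"
    using n nc x vnull_iff[OF nc] by (simp add: closed)
next
  fix a assume a: "a \<in> {a \<in> vcarrier V. vnorm V (vdiff V a x) = 0}"
  have "vadd V x (vdiff V a x) = vadd V a (vadd V x (vscale V (-1) x))"
    using a x add_assoc[of x a "vscale V (-1) x"] add_assoc[of a x "vscale V (-1) x"] add_comm[of x a]
    by (simp add: vdiff_def closed)
  \<comment> \<open>The record has no zero vector; any \<open>vscale V 0 y\<close> takes its place,
    and \<open>add_zero\<close> is stated for this form.\<close>
  also have "vadd V x (vscale V (-1) x) = vscale V (1 + -1) x"
    using x by (simp only: scale_add_left scale_one)
  also have "vadd V a \<dots> = a" using a x by (simp add: add_zero)
  finally have "a = vadd V x (vdiff V a x)" by simp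
  moreover have "vdiff V a x \<in> vnull V" using a x by (simp add: vnull_iff closed)
  ultimately show "a \<in> vcoset V (vnull V) x" unfolding vcoset_def by blast
qed

lemma coset_self: "x \<in> vcarrier V \<Longrightarrow> x \<in> vcoset V (vnull V) x"
  by (simp add: coset_eq norm_diff_self)

lemma coset_eq_iff:
  assumes x: "x \<in> vcarrier V" and y: "y \<in> vcarrier V"
  shows "vcoset V (vnull V) x = vcoset V (vnull V) y \<longleftrightarrow> vnorm V (vdiff V x y) = 0"
proof
  assume "vcoset V (vnull V) x = vcoset V (vnull V) y"
  then show "vnorm V (vdiff V x y) = 0" using coset_self[OF x] y by (simp add: coset_eq)
next
  assume 0: "vnorm V (vdiff V x y) = 0"
  have "vnorm V (vdiff V a x) = 0 \<longleftrightarrow> vnorm V (vdiff V a y) = 0" if a: "a \<in> vcarrier V" for a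
    using 0 norm_diff_triangle[OF a x y] norm_diff_triangle[OF a y x] norm_diff_commute[OF x y]
      a x y norm_nonneg[OF diff_closed[OF a x]] norm_nonneg[OF diff_closed[OF a y]]
    by linarith
  then show "vcoset V (vnull V) x = vcoset V (vnull V) y" using x y by (auto simp: coset_eq)
qed

lemma coset_memD:
  assumes "a \<in> vcoset V (vnull V) x" "x \<in> vcarrier V"
  shows "a \<in> vcarrier V" "vnorm V (vdiff V a x) = 0" "vcoset V (vnull V) a = vcoset V (vnull V) x"
proof -
  show *: "a \<in> vcarrier V" "vnorm V (vdiff V a x) = 0" using assms by (simp_all add: coset_eq)
  with assms show "vcoset V (vnull V) a = vcoset V (vnull V) x" by (simp add: coset_eq_iff)
qed

lemma quotient_add:
  assumes x: "x \<in> vcarrier V" and y: "y \<in> vcarrier V"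
  shows "vadd (vquotient V (vnull V)) (vcoset V (vnull V) x) (vcoset V (vnull V) y) =
    vcoset V (vnull V) (vadd V x y)"
proof -
  have "vcoset V (vnull V) (vadd V a b) = vcoset V (vnull V) (vadd V x y)"
    if "a \<in> vcoset V (vnull V) x" "b \<in> vcoset V (vnull V) y" for a b
    using coset_memD(1,2)[OF that(1) x] coset_memD(1,2)[OF that(2) y] norm_diff_add[of a b x y] x y
    by (simp add: coset_eq_iff closed order_antisym)
  then have "(\<Union>a\<in>vcoset V (vnull V) x. \<Union>b\<in>vcoset V (vnull V) y. vcoset V (vnull V) (vadd V a b)) =
    vcoset V (vnull V) (vadd V x y)"
    by (rule UN_UN_const[OF coset_self[OF x] coset_self[OF y]])
  then show ?thesis by (simp add: vquotient_def)
qed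

lemma quotient_scale:
  assumes x: "x \<in> vcarrier V"
  shows "vscale (vquotient V (vnull V)) c (vcoset V (vnull V) x) = vcoset V (vnull V) (vscale V c x)"
proof -
  have "vcoset V (vnull V) (vscale V c a) = vcoset V (vnull V) (vscale V c x)"
    if "a \<in> vcoset V (vnull V) x" for a
    using coset_memD(1,2)[OF that(1) x] x by (simp add: coset_eq_iff closed norm_diff_scale)
  then have "(\<Union>a\<in>vcoset V (vnull V) x. vcoset V (vnull V) (vscale V c a)) =
    vcoset V (vnull V) (vscale V c x)"
    by (intro UN_constant_eq[OF coset_self[OF x]] ballI)
  then show ?thesis by (simp add: vquotient_def)
qed

lemma quotient_inner:
  assumes x: "x \<in> vcarrier V" and y: "y \<in> vcarrier V"
  shows "vinner (vquotient V (vnull V)) (vcoset V (vnull V) x) (vcoset V (vnull V) y) = vinner V x y"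
proof -
  have "vinner V a b = vinner V x y"
    if "a \<in> vcoset V (vnull V) x" "b \<in> vcoset V (vnull V) y" for a b
    using coset_memD(1,2)[OF that(1) x] coset_memD(1,2)[OF that(2) y] inner_diff_bound[of a b x y] x y
    by simp
  then have "(\<Union>a\<in>vcoset V (vnull V) x. \<Union>b\<in>vcoset V (vnull V) y. {vinner V a b}) = {vinner V x y}"
    by (intro UN_UN_const[OF coset_self[OF x] coset_self[OF y]]) simp
  then show ?thesis by (simp add: vquotient_def)
qed

lemma quotient_carrier: "vcarrier (vquotient V (vnull V)) = vcoset V (vnull V) ` vcarrier V"
  by (simp add: vquotient_def)

lemma coset_linear_isometry: "linear_isometry V (vquotient V (vnull V)) (vcoset V (vnull V))"
  by (simp add: linear_isometry_def quotient_carrier quotient_add quotient_scale quotient_inner)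

lemma semi_ip_quotient: "semi_ip (vquotient V (vnull V))"
proof (unfold_locales, goal_cases)
  case (5 x y)
  then show ?case
    unfolding quotient_carrier by (elim imageE) (simp add: quotient_add add_comm)
next
  case (13 x y)
  then show ?case by (auto simp: quotient_carrier quotient_inner intro!: inner_cnj)
qed (use nonempty in \<open>auto simp: quotient_carrier quotient_add quotient_scale quotient_inner closed
    add_assoc scale_add_right scale_add_left scale_scale scale_one add_zero inner_add inner_scale
    inner_pos\<close>)

lemma quotient_norm_diff:
  assumes "x \<in> vcarrier V" "y \<in> vcarrier V"
  shows "vnorm (vquotient V (vnull V)) (vdiff (vquotient V (vnull V))
    (vcoset V (vnull V) x) (vcoset V (vnull V) y)) = vnorm V (vdiff V x y)"
  by (rule linear_isometry_norm_diff[OF coset_linear_isometry semi_ip_axioms assms])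

lemma quotient_definite: "vdefinite (vquotient V (vnull V))"
  by (auto simp: vdefinite_def quotient_carrier quotient_norm_diff coset_eq_iff)

text \<open>Two representatives of a coset are at distance zero, hence so are their images, and
  \<open>vdefinite W\<close> makes the images equal. The choice made by \<open>SOME\<close>
  therefore does not affect the value.\<close>

lemma linear_isometry_quotient:
  assumes "linear_isometry V W J" "vdefinite W"
  obtains J' where "linear_isometry (vquotient V (vnull V)) W J'"
    "\<And>x. x \<in> vcarrier V \<Longrightarrow> J' (vcoset V (vnull V) x) = J x"
proof
  define J' where "J' A = J (SOME x. x \<in> A)" for A
  show J': "J' (vcoset V (vnull V) x) = J x" if x: "x \<in> vcarrier V" for x
  proof -
    define a where "a = (SOME x'. x' \<in> vcoset V (vnull V) x)"
    have "a \<in> vcoset V (vnull V) x" unfolding a_def using coset_self[OF x] by (rule someI)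
    note a = coset_memD(1,2)[OF this x]
    have "vnorm W (vdiff W (J a) (J x)) = 0"
      using linear_isometry_norm_diff[OF assms(1) semi_ip_axioms a(1) x] a by simp
    then show ?thesis
      using assms a x unfolding J'_def a_def[symmetric] vdefinite_def linear_isometry_def by blast
  qed
  show "linear_isometry (vquotient V (vnull V)) W J'"
    using assms(1) by (auto simp: linear_isometry_def quotient_carrier quotient_add quotient_scale
      quotient_inner J' closed)
qed

end

section \<open>Completions\<close>

context semi_ip
begin

lemma Cauchy_space_simps:
  "s \<in> vcarrier (Cauchy_space V) \<longleftrightarrow> vCauchy V s"
  "vadd (Cauchy_space V) s t = (\<lambda>n. vadd V (s n) (t n))"
  "vscale (Cauchy_space V) c s = (\<lambda>n. vscale V c (s n))"
  "vinner (Cauchy_space V) s t = lim (\<lambda>n. vinner V (s n) (t n))"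
  "vdiff (Cauchy_space V) s t = (\<lambda>n. vdiff V (s n) (t n))"
  by (simp_all add: Cauchy_space_def vdiff_def)

lemma vCauchy_closed: "vCauchy V s \<Longrightarrow> s n \<in> vcarrier V"
  by (simp add: vCauchy_def)

lemma vCauchyD: "vCauchy V s \<Longrightarrow> e > 0 \<Longrightarrow> \<exists>M. \<forall>m\<ge>M. \<forall>n\<ge>M. vnorm V (vdiff V (s m) (s n)) < e"
  by (simp add: vCauchy_def)

lemma vCauchy_add:
  assumes s: "vCauchy V s" and t: "vCauchy V t"
  shows "vCauchy V (\<lambda>n. vadd V (s n) (t n))"
  unfolding vCauchy_def
proof (intro conjI allI impI)
  show "vadd V (s n) (t n) \<in> vcarrier V" for n using s t by (simp add: vCauchy_closed closed)
  fix e :: real assume e: "e > 0"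
  then have e2: "e / 2 > 0" by simp
  obtain M where M: "\<And>m n. m \<ge> M \<Longrightarrow> n \<ge> M \<Longrightarrow> vnorm V (vdiff V (s m) (s n)) < e / 2"
    using vCauchyD[OF s e2] by blast
  obtain M' where M': "\<And>m n. m \<ge> M' \<Longrightarrow> n \<ge> M' \<Longrightarrow> vnorm V (vdiff V (t m) (t n)) < e / 2"
    using vCauchyD[OF t e2] by blast
  have "vnorm V (vdiff V (vadd V (s m) (t m)) (vadd V (s n) (t n))) < e"
    if "m \<ge> max M M'" "n \<ge> max M M'" for m n
    using M[of m n] M'[of m n] that
      norm_diff_add[OF vCauchy_closed[OF s] vCauchy_closed[OF t] vCauchy_closed[OF s] vCauchy_closed[OF t], of m m n n]
    by auto
  then show "\<exists>M. \<forall>m\<ge>M. \<forall>n\<ge>M. vnorm V (vdiff V (vadd V (s m) (t m)) (vadd V (s n) (t n))) < e"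
    by blast
qed

lemma vCauchy_scale:
  assumes s: "vCauchy V s"
  shows "vCauchy V (\<lambda>n. vscale V c (s n))"
  unfolding vCauchy_def
proof (intro conjI allI impI)
  show "vscale V c (s n) \<in> vcarrier V" for n using s by (simp add: vCauchy_closed closed)
  fix e :: real assume e: "e > 0"
  then have e2: "e / (cmod c + 1) > 0" by (simp add: add_nonneg_pos)
  obtain M where M: "\<And>m n. m \<ge> M \<Longrightarrow> n \<ge> M \<Longrightarrow> vnorm V (vdiff V (s m) (s n)) < e / (cmod c + 1)"
    using vCauchyD[OF s e2] by blast
  have "vnorm V (vdiff V (vscale V c (s m)) (vscale V c (s n))) < e" if "m \<ge> M" "n \<ge> M" for m n
  proof -
    have "cmod c * vnorm V (vdiff V (s m) (s n)) \<le> cmod c * (e / (cmod c + 1))"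
      using M[OF that] by (intro mult_left_mono) auto
    also have "\<dots> < e" proof -
      have "cmod c * e < e * (cmod c + 1)" using e by (simp add: algebra_simps)
      then show ?thesis by (simp add: pos_divide_less_eq add_nonneg_pos)
    qed
    finally show ?thesis using s by (simp add: norm_diff_scale vCauchy_closed)
  qed
  then show "\<exists>M. \<forall>m\<ge>M. \<forall>n\<ge>M. vnorm V (vdiff V (vscale V c (s m)) (vscale V c (s n))) < e"
    by blast
qed

lemma vCauchy_diff: "vCauchy V s \<Longrightarrow> vCauchy V t \<Longrightarrow> vCauchy V (\<lambda>n. vdiff V (s n) (t n))"
  unfolding vdiff_def by (intro vCauchy_add vCauchy_scale)

lemma vCauchy_const: "x \<in> vcarrier V \<Longrightarrow> vCauchy V (\<lambda>n. x)"
  by (simp add: vCauchy_def norm_diff_self)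

lemma vCauchy_bounded:
  assumes s: "vCauchy V s"
  obtains B where "\<And>n. vnorm V (s n) \<le> B" "B > 0"
proof -
  obtain M where M: "\<And>m n. m \<ge> M \<Longrightarrow> n \<ge> M \<Longrightarrow> vnorm V (vdiff V (s m) (s n)) < 1"
    using vCauchyD[OF s, of 1] by auto
  define B where "B = vnorm V (s M) + 1 + (\<Sum>n<M. vnorm V (s n))"
  have pos: "vnorm V (s n) \<ge> 0" for n using s by (simp add: vCauchy_closed)
  have "vnorm V (s n) \<le> B" for n
  proof (cases "n < M")
    case True
    then have "vnorm V (s n) \<le> (\<Sum>n<M. vnorm V (s n))"
      using pos by (intro member_le_sum) auto
    then show ?thesis using pos[of M] by (simp add: B_def)
  next
    case False
    then have "vnorm V (s n) \<le> vnorm V (s M) + 1"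
      using M[of n M] norm_le_diff[OF vCauchy_closed[OF s] vCauchy_closed[OF s], of n M] by simp
    then show ?thesis using sum_nonneg[of "{..<M}" "\<lambda>n. vnorm V (s n)"] pos by (simp add: B_def)
  qed
  moreover have "B > 0" using sum_nonneg[of "{..<M}" "\<lambda>n. vnorm V (s n)"] pos[of M] pos unfolding B_def by (smt (verit) sum_nonneg)
  ultimately show ?thesis using that by blast
qed

lemma vCauchy_inner_convergent:
  assumes s: "vCauchy V s" and t: "vCauchy V t"
  shows "convergent (\<lambda>n. vinner V (s n) (t n))"
proof (rule Cauchy_convergent, rule CauchyI)
  fix e :: real assume e: "e > 0"
  obtain A where A: "\<And>n. vnorm V (s n) \<le> A" "A > 0" using vCauchy_bounded[OF s] by blast
  obtain B where B: "\<And>n. vnorm V (t n) \<le> B" "B > 0" using vCauchy_bounded[OF t] by blast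
  have e1: "e / (2 * B) > 0" "e / (2 * A) > 0" using e A B by simp_all
  obtain M where M: "\<And>m n. m \<ge> M \<Longrightarrow> n \<ge> M \<Longrightarrow> vnorm V (vdiff V (s m) (s n)) < e / (2 * B)"
    using vCauchyD[OF s e1(1)] by blast
  obtain M' where M': "\<And>m n. m \<ge> M' \<Longrightarrow> n \<ge> M' \<Longrightarrow> vnorm V (vdiff V (t m) (t n)) < e / (2 * A)"
    using vCauchyD[OF t e1(2)] by blast
  have "norm (vinner V (s m) (t m) - vinner V (s n) (t n)) < e"
    if mn: "m \<ge> max M M'" "n \<ge> max M M'" for m n
  proof -
    have "cmod (vinner V (s m) (t m) - vinner V (s n) (t n)) \<le>
      vnorm V (vdiff V (s m) (s n)) * vnorm V (t m) + vnorm V (s n) * vnorm V (vdiff V (t m) (t n))"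
      by (intro inner_diff_bound vCauchy_closed s t)
    also have "\<dots> \<le> vnorm V (vdiff V (s m) (s n)) * B + A * vnorm V (vdiff V (t m) (t n))"
      using A B s t by (intro add_mono mult_left_mono mult_right_mono) (simp_all add: vCauchy_closed closed)
    also have "\<dots> < e / (2 * B) * B + A * (e / (2 * A))"
      using M[of m n] M'[of m n] mn A B
      by (intro add_strict_mono mult_strict_right_mono mult_strict_left_mono) auto
    also have "\<dots> = e" using A B by simp
    finally show ?thesis .
  qed
  then show "\<exists>M. \<forall>m\<ge>M. \<forall>n\<ge>M. norm (vinner V (s m) (t m) - vinner V (s n) (t n)) < e" by blast
qed

lemma Cauchy_space_inner_tendsto:
  assumes s: "vCauchy V s" and t: "vCauchy V t"
  shows "(\<lambda>n. vinner V (s n) (t n)) \<longlonglongrightarrow> vinner (Cauchy_space V) s t"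
  using vCauchy_inner_convergent[OF s t] by (simp add: Cauchy_space_simps convergent_LIMSEQ_iff)

lemma Cauchy_space_inner_eqI:
  "(\<lambda>n. vinner V (s n) (t n)) \<longlonglongrightarrow> l \<Longrightarrow> vinner (Cauchy_space V) s t = l"
  by (simp add: Cauchy_space_simps limI)

lemma semi_ip_Cauchy_space: "semi_ip (Cauchy_space V)"
proof (unfold_locales, goal_cases)
  case 3
  then show ?case using nonempty vCauchy_const Cauchy_space_simps(1) by blast
next
  case (11 x y z)
  then have C: "vCauchy V x" "vCauchy V y" "vCauchy V z" by (simp_all add: Cauchy_space_simps)
  have "(\<lambda>n. vinner V (x n) (y n) + vinner V (x n) (z n)) \<longlonglongrightarrow>
    vinner (Cauchy_space V) x y + vinner (Cauchy_space V) x z"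
    by (intro tendsto_add Cauchy_space_inner_tendsto C)
  also have "(\<lambda>n. vinner V (x n) (y n) + vinner V (x n) (z n)) = (\<lambda>n. vinner V (x n) (vadd (Cauchy_space V) y z n))"
    using C by (simp add: Cauchy_space_simps(2) inner_add vCauchy_closed)
  finally show ?case by (rule Cauchy_space_inner_eqI)
next
  case (12 x y c)
  then have C: "vCauchy V x" "vCauchy V y" by (simp_all add: Cauchy_space_simps)
  have "(\<lambda>n. c * vinner V (x n) (y n)) \<longlonglongrightarrow> c * vinner (Cauchy_space V) x y"
    by (intro tendsto_mult tendsto_const Cauchy_space_inner_tendsto C)
  also have "(\<lambda>n. c * vinner V (x n) (y n)) = (\<lambda>n. vinner V (x n) (vscale (Cauchy_space V) c y n))"
    using C by (simp add: Cauchy_space_simps(3) inner_scale vCauchy_closed)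
  finally show ?case by (rule Cauchy_space_inner_eqI)
next
  case (13 x y)
  then have C: "vCauchy V x" "vCauchy V y" by (simp_all add: Cauchy_space_simps)
  have "(\<lambda>n. cnj (vinner V (x n) (y n))) \<longlonglongrightarrow> cnj (vinner (Cauchy_space V) x y)"
    by (intro tendsto_cnj Cauchy_space_inner_tendsto C)
  also have "(\<lambda>n. cnj (vinner V (x n) (y n))) = (\<lambda>n. vinner V (y n) (x n))"
    using inner_cnj[OF vCauchy_closed[OF C(1)] vCauchy_closed[OF C(2)]] by simp
  finally show ?case by (rule Cauchy_space_inner_eqI)
next
  case (14 x)
  then have C: "vCauchy V x" by (simp add: Cauchy_space_simps)
  show ?case
    by (rule tendsto_lowerbound[OF tendsto_Re[OF Cauchy_space_inner_tendsto[OF C C]]])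
      (use C in \<open>simp_all add: inner_pos vCauchy_closed\<close>)
qed (simp_all add: Cauchy_space_simps(1-3) vCauchy_add vCauchy_scale vCauchy_closed add_assoc
    add_comm scale_add_right scale_add_left scale_scale scale_one add_zero fun_eq_iff)

lemma Cauchy_space_norm:
  assumes "vCauchy V s"
  shows "(\<lambda>n. vnorm V (s n)) \<longlonglongrightarrow> vnorm (Cauchy_space V) s"
  unfolding vnorm_def by (intro tendsto_intros Cauchy_space_inner_tendsto assms)

lemma null_sequences_eq: "null_sequences V = vnull (Cauchy_space V)"
proof -
  have "(\<lambda>n. vnorm V (s n)) \<longlonglongrightarrow> 0 \<longleftrightarrow> vinner (Cauchy_space V) s s = 0" if s: "vCauchy V s" for s
  proof -
    have "(\<lambda>n. vnorm V (s n)) \<longlonglongrightarrow> 0 \<longleftrightarrow> vnorm (Cauchy_space V) s = 0"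
      using Cauchy_space_norm[OF s] LIMSEQ_unique by auto
    also have "\<dots> \<longleftrightarrow> vinner (Cauchy_space V) s s = 0"
      using semi_ip.inner_self[OF semi_ip_Cauchy_space, of s] s by (simp add: Cauchy_space_simps(1))
    finally show ?thesis .
  qed
  then show ?thesis by (auto simp: null_sequences_def vnull_def Cauchy_space_simps(1))
qed

lemma completion_eq: "completion V = vquotient (Cauchy_space V) (vnull (Cauchy_space V))"
  by (simp add: completion_def null_sequences_eq)

lemma completion_embed_eq: "completion_embed V x = vcoset (Cauchy_space V) (vnull (Cauchy_space V)) (\<lambda>n. x)"
  by (simp add: completion_embed_def null_sequences_eq)

lemma completion_carrier:
  "vcarrier (completion V) = vcoset (Cauchy_space V) (vnull (Cauchy_space V)) ` {s. vCauchy V s}"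
  by (auto simp: completion_eq vquotient_def Cauchy_space_simps(1))

lemma completion_embed_closed: "x \<in> vcarrier V \<Longrightarrow> completion_embed V x \<in> vcarrier (completion V)"
  using vCauchy_const[of x] by (auto simp: completion_embed_eq completion_carrier)

lemma semi_ip_completion: "semi_ip (completion V)"
  unfolding completion_eq by (rule semi_ip.semi_ip_quotient[OF semi_ip_Cauchy_space])

text \<open>A Cauchy sequence converges to its own class: its distance to the constant sequence at
  \<open>s n\<close> is the limit over m of the distances of \<open>s n\<close> and
  \<open>s m\<close>. Density of the embedded space, and with it uniqueness of a continuous
  extension, rests on this.\<close>

lemma completion_embed_tendsto:
  assumes s: "vCauchy V s"
  shows "(\<lambda>n. vnorm (completion V) (vdiff (completion V) (completion_embed V (s n))
    (vcoset (Cauchy_space V) (vnull (Cauchy_space V)) s))) \<longlonglongrightarrow> 0"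
proof -
  interpret C: semi_ip "Cauchy_space V" by (rule semi_ip_Cauchy_space)
  have eq: "vnorm (completion V) (vdiff (completion V) (completion_embed V (s n))
    (vcoset (Cauchy_space V) (vnull (Cauchy_space V)) s)) = vnorm (Cauchy_space V) (vdiff (Cauchy_space V) (\<lambda>m. s n) s)" for n
    unfolding completion_eq completion_embed_eq
    by (rule C.quotient_norm_diff) (use s in \<open>simp_all add: Cauchy_space_simps(1) vCauchy_const vCauchy_closed\<close>)
  have nonneg: "vnorm (Cauchy_space V) (vdiff (Cauchy_space V) (\<lambda>m. s n) s) \<ge> 0" for n
    by (intro C.norm_nonneg C.diff_closed) (use s in \<open>simp_all add: Cauchy_space_simps(1) vCauchy_const vCauchy_closed\<close>)
  show ?thesis unfolding eq
  proof (rule LIMSEQ_I)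
    fix e :: real assume e: "e > 0"
    then have e2: "e / 2 > 0" by simp
    obtain M where M: "\<And>m n. m \<ge> M \<Longrightarrow> n \<ge> M \<Longrightarrow> vnorm V (vdiff V (s m) (s n)) < e / 2"
      using vCauchyD[OF s e2] by blast
    have "norm (vnorm (Cauchy_space V) (vdiff (Cauchy_space V) (\<lambda>m. s n) s) - 0) < e" if n: "n \<ge> M" for n
    proof -
      have "(\<lambda>m. vnorm V (vdiff V (s n) (s m))) \<longlonglongrightarrow> vnorm (Cauchy_space V) (vdiff (Cauchy_space V) (\<lambda>m. s n) s)"
        using Cauchy_space_norm[OF vCauchy_diff[OF vCauchy_const[OF vCauchy_closed[OF s, of n]] s]]
        by (simp add: Cauchy_space_simps(5))
      then have "vnorm (Cauchy_space V) (vdiff (Cauchy_space V) (\<lambda>m. s n) s) \<le> e / 2"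
      proof (rule LIMSEQ_le_const2)
        show "\<exists>N. \<forall>m\<ge>N. vnorm V (vdiff V (s n) (s m)) \<le> e / 2"
          using M[OF n] less_imp_le by blast
      qed
      then show ?thesis using e nonneg[of n] by simp
    qed
    then show "\<exists>M. \<forall>n\<ge>M. norm (vnorm (Cauchy_space V) (vdiff (Cauchy_space V) (\<lambda>m. s n) s) - 0) < e" by blast
  qed
qed

end

section \<open>Extension of isometries to the completion\<close>

lemma (in semi_ip) vlim_unique:
  assumes "vdefinite V" "\<And>n. w n \<in> vcarrier V" "u \<in> vcarrier V" "v \<in> vcarrier V"
    and "(\<lambda>n. vnorm V (vdiff V (w n) u)) \<longlonglongrightarrow> 0" "(\<lambda>n. vnorm V (vdiff V (w n) v)) \<longlonglongrightarrow> 0"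
  shows "u = v"
proof -
  have "(\<lambda>n. vnorm V (vdiff V (w n) u) + vnorm V (vdiff V (w n) v)) \<longlonglongrightarrow> 0 + 0"
    by (intro tendsto_add assms)
  then have "vnorm V (vdiff V u v) \<le> 0 + 0"
  proof (rule LIMSEQ_le_const)
    show "\<exists>N. \<forall>n\<ge>N. vnorm V (vdiff V u v) \<le> vnorm V (vdiff V (w n) u) + vnorm V (vdiff V (w n) v)"
      using norm_diff_triangle[OF assms(3) assms(2) assms(4)] norm_diff_commute[OF assms(3) assms(2)] by metis
  qed
  then have "vnorm V (vdiff V u v) = 0" using norm_nonneg[OF diff_closed[OF assms(3,4)]] by linarith
  then show ?thesis using assms by (simp add: vdefinite_def)
qed

text \<open>An isometry sends Cauchy sequences to Cauchy sequences; completeness of \<open>W\<close>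
  supplies the limit and definiteness its uniqueness, so the algebraic identities pass to the
  limit.\<close>

lemma (in semi_ip) linear_isometry_extend:
  assumes J: "linear_isometry V W J" and W: "semi_ip W" "vdefinite W" "vcomplete W"
  obtains J' where "linear_isometry (Cauchy_space V) W J'"
    "\<And>s. vCauchy V s \<Longrightarrow> (\<lambda>n. vnorm W (vdiff W (J (s n)) (J' s))) \<longlonglongrightarrow> 0"
proof -
  interpret W: semi_ip W by fact
  have JC: "J x \<in> vcarrier W" if "x \<in> vcarrier V" for x using J that by (simp add: linear_isometry_def)
  have "\<exists>u\<in>vcarrier W. (\<lambda>n. vnorm W (vdiff W (J (s n)) u)) \<longlonglongrightarrow> 0" if s: "vCauchy V s" for s
  proof -
    have "vCauchy W (\<lambda>n. J (s n))"
      using s JC unfolding vCauchy_def by (simp add: linear_isometry_norm_diff[OF J semi_ip_axioms])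
    then show ?thesis using W(3) by (simp add: vcomplete_def)
  qed
  then obtain J' where J': "\<And>s. vCauchy V s \<Longrightarrow> J' s \<in> vcarrier W"
    "\<And>s. vCauchy V s \<Longrightarrow> (\<lambda>n. vnorm W (vdiff W (J (s n)) (J' s))) \<longlonglongrightarrow> 0"
    by metis
  have "linear_isometry (Cauchy_space V) W J'"
    unfolding linear_isometry_def
  proof (intro conjI ballI allI)
    fix s assume "s \<in> vcarrier (Cauchy_space V)"
    then have s: "vCauchy V s" by (simp add: Cauchy_space_simps)
    note sc = vCauchy_closed[OF s]
    show "J' s \<in> vcarrier W" using J' s by simp
    show "J' (vscale (Cauchy_space V) c s) = vscale W c (J' s)" for c
    proof (rule W.vlim_unique[OF W(2)])
      have "(\<lambda>n. cmod c * vnorm W (vdiff W (J (s n)) (J' s))) \<longlonglongrightarrow> cmod c * 0"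
        by (intro tendsto_intros J' s)
      then show "(\<lambda>n. vnorm W (vdiff W (J (vscale V c (s n))) (vscale W c (J' s)))) \<longlonglongrightarrow> 0"
        using J sc J'(1)[OF s] by (simp add: linear_isometry_def W.norm_diff_scale)
      show "(\<lambda>n. vnorm W (vdiff W (J (vscale V c (s n))) (J' (vscale (Cauchy_space V) c s)))) \<longlonglongrightarrow> 0"
        using J'(2)[OF vCauchy_scale[OF s]] by (simp add: Cauchy_space_simps)
    qed (use J' s in \<open>simp_all add: JC sc closed W.closed Cauchy_space_simps vCauchy_scale\<close>)
    fix t assume "t \<in> vcarrier (Cauchy_space V)"
    then have t: "vCauchy V t" by (simp add: Cauchy_space_simps)
    note tc = vCauchy_closed[OF t]
    show "J' (vadd (Cauchy_space V) s t) = vadd W (J' s) (J' t)"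
    proof (rule W.vlim_unique[OF W(2)])
      have lim: "(\<lambda>n. vnorm W (vdiff W (J (s n)) (J' s)) + vnorm W (vdiff W (J (t n)) (J' t))) \<longlonglongrightarrow> 0"
        using tendsto_add[OF J'(2)[OF s] J'(2)[OF t]] by simp
      show "(\<lambda>n. vnorm W (vdiff W (J (vadd V (s n) (t n))) (vadd W (J' s) (J' t)))) \<longlonglongrightarrow> 0"
      proof (rule tendsto_sandwich[OF _ _ tendsto_const lim]; rule always_eventually; rule allI)
        fix n
        have e: "J (vadd V (s n) (t n)) = vadd W (J (s n)) (J (t n))" using J sc tc by (simp add: linear_isometry_def)
        show "0 \<le> vnorm W (vdiff W (J (vadd V (s n) (t n))) (vadd W (J' s) (J' t)))"
          unfolding e by (intro W.norm_nonneg W.closed JC sc tc J'(1) s t)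
        show "vnorm W (vdiff W (J (vadd V (s n) (t n))) (vadd W (J' s) (J' t)))
          \<le> vnorm W (vdiff W (J (s n)) (J' s)) + vnorm W (vdiff W (J (t n)) (J' t))"
          unfolding e by (intro W.norm_diff_add JC sc tc J'(1) s t)
      qed
      show "(\<lambda>n. vnorm W (vdiff W (J (vadd V (s n) (t n))) (J' (vadd (Cauchy_space V) s t)))) \<longlonglongrightarrow> 0"
        using J'(2)[OF vCauchy_add[OF s t]] by (simp add: Cauchy_space_simps)
    qed (use J' s t in \<open>simp_all add: JC sc tc closed W.closed Cauchy_space_simps vCauchy_add\<close>)
    have "(\<lambda>n. vinner W (J (s n)) (J (t n))) \<longlonglongrightarrow> vinner W (J' s) (J' t)"
      using J' s t by (intro W.inner_tendsto JC sc tc) simp_all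
    moreover have "(\<lambda>n. vinner W (J (s n)) (J (t n))) = (\<lambda>n. vinner V (s n) (t n))"
      using J sc tc by (simp add: linear_isometry_def)
    ultimately show "vinner W (J' s) (J' t) = vinner (Cauchy_space V) s t"
      using Cauchy_space_inner_eqI by metis
  qed
  then show ?thesis using that J'(2) by blast
qed

lemma linear_isometry_inj:
  assumes "linear_isometry V W J" "semi_ip V" "vdefinite V" "semi_ip W"
  shows "inj_on J (vcarrier V)"
proof (rule inj_onI)
  fix x y assume *: "x \<in> vcarrier V" "y \<in> vcarrier V" "J x = J y"
  have "J y \<in> vcarrier W" using assms * by (simp add: linear_isometry_def)
  then have "vnorm V (vdiff V x y) = 0"
    using linear_isometry_norm_diff[OF assms(1,2) *(1,2)] *(3) semi_ip.norm_diff_self[OF assms(4)] by simp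
  then show "x = y" using * assms by (simp add: vdefinite_def)
qed

text \<open>An approximating sequence chosen by density is Cauchy already in \<open>V\<close>,
  because \<open>J\<close> preserves distances and the images converge.\<close>

lemma linear_isometry_surj:
  assumes J: "linear_isometry V W J" and V: "semi_ip V" and W: "semi_ip W" "vdefinite W"
    and dense: "\<And>w e. w \<in> vcarrier W \<Longrightarrow> e > 0 \<Longrightarrow> \<exists>x\<in>vcarrier V. vnorm W (vdiff W (J x) w) < e"
    and w: "w \<in> vcarrier W"
  obtains s where "vCauchy V s" "(\<lambda>n. vnorm W (vdiff W (J (s n)) w)) \<longlonglongrightarrow> 0"
proof -
  interpret V: semi_ip V by fact
  interpret W: semi_ip W by fact
  have "\<forall>n. \<exists>x\<in>vcarrier V. vnorm W (vdiff W (J x) w) < 1 / real (Suc n)"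
    using dense[OF w] by simp
  then obtain s where s: "\<And>n. s n \<in> vcarrier V" "\<And>n. vnorm W (vdiff W (J (s n)) w) < 1 / real (Suc n)"
    by metis
  have Js: "J (s n) \<in> vcarrier W" for n using J s by (simp add: linear_isometry_def)
  have lim: "(\<lambda>n. vnorm W (vdiff W (J (s n)) w)) \<longlonglongrightarrow> 0"
  proof (rule tendsto_sandwich[OF _ _ tendsto_const LIMSEQ_inverse_real_of_nat]; rule always_eventually; rule allI)
    show "0 \<le> vnorm W (vdiff W (J (s n)) w)" for n by (intro W.norm_nonneg W.closed Js w)
    show "vnorm W (vdiff W (J (s n)) w) \<le> inverse (real (Suc n))" for n
      using s(2)[of n] by (simp add: inverse_eq_divide)
  qed
  have "vCauchy V s"
    unfolding vCauchy_def
  proof (intro conjI allI impI)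
    show "s n \<in> vcarrier V" for n by (rule s)
    fix e :: real assume "e > 0"
    then have "e / 2 > 0" by simp
    from LIMSEQ_D[OF lim this] obtain M where M: "\<And>n. n \<ge> M \<Longrightarrow> vnorm W (vdiff W (J (s n)) w) < e / 2"
      by (metis diff_zero real_norm_def abs_less_iff)
    have "vnorm V (vdiff V (s m) (s n)) < e" if "m \<ge> M" "n \<ge> M" for m n
      using M[OF that(1)] M[OF that(2)] W.norm_diff_triangle[OF Js w Js, of m n] W.norm_diff_commute[OF w Js, of n]
        linear_isometry_norm_diff[OF J V s(1) s(1), of m n] by linarith
    then show "\<exists>M. \<forall>m\<ge>M. \<forall>n\<ge>M. vnorm V (vdiff V (s m) (s n)) < e" by blast
  qed
  then show ?thesis using that lim by blast
qed

text \<open>\<open>J\<close> is extended to Cauchy sequences and factored through null sequences;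
  density yields surjectivity and definiteness of the completion yields injectivity. Membership in
  \<open>extensional\<close> fixes the values off the carrier, about which an isometric isomorphism
  says nothing, so that uniqueness can be an equality of functions.\<close>

theorem completion_iso:
  fixes V :: "'v ip_space" and W :: "'w ip_space"
  assumes V: "semi_ip V" and W: "semi_ip W" "vdefinite W" "vcomplete W"
    and J: "linear_isometry V W J"
    and dense: "\<And>w e. w \<in> vcarrier W \<Longrightarrow> e > 0 \<Longrightarrow> \<exists>x\<in>vcarrier V. vnorm W (vdiff W (J x) w) < e"
  shows "\<exists>!U. U \<in> extensional (vcarrier (completion V)) \<and> isometric_isomorphism (completion V) W U \<and>
    (\<forall>x\<in>vcarrier V. U (completion_embed V x) = J x)"
proof -
  interpret V: semi_ip V by fact
  interpret W: semi_ip W by fact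
  interpret C: semi_ip "Cauchy_space V" by (rule V.semi_ip_Cauchy_space)
  interpret Q: semi_ip "completion V" by (rule V.semi_ip_completion)
  have JC: "J x \<in> vcarrier W" if "x \<in> vcarrier V" for x using J that by (simp add: linear_isometry_def)
  obtain J' where J': "linear_isometry (Cauchy_space V) W J'"
    "\<And>s. vCauchy V s \<Longrightarrow> (\<lambda>n. vnorm W (vdiff W (J (s n)) (J' s))) \<longlonglongrightarrow> 0"
    using V.linear_isometry_extend[OF J W] by blast
  obtain U0 where U0: "linear_isometry (completion V) W U0"
    "\<And>s. vCauchy V s \<Longrightarrow> U0 (vcoset (Cauchy_space V) (vnull (Cauchy_space V)) s) = J' s"
    using C.linear_isometry_quotient[OF J'(1) W(2)] unfolding V.completion_eq V.Cauchy_space_simps(1) by blast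
  have J'C: "J' s \<in> vcarrier W" if "vCauchy V s" for s
    using J'(1) that by (simp add: linear_isometry_def V.Cauchy_space_simps(1))
  have J'_const: "J' (\<lambda>n. x) = J x" if x: "x \<in> vcarrier V" for x
    using J'(2)[OF V.vCauchy_const[OF x]] W.norm_diff_self[OF JC[OF x]]
    by (intro W.vlim_unique[OF W(2), of "\<lambda>n. J x"]) (simp_all add: JC x J'C V.vCauchy_const)
  have U0_embed: "U0 (completion_embed V x) = J x" if x: "x \<in> vcarrier V" for x
    using U0(2)[OF V.vCauchy_const[OF x]] J'_const[OF x] by (simp add: V.completion_embed_eq)
  have surj: "vcarrier W \<subseteq> U0 ` vcarrier (completion V)"
  proof
    fix w assume w: "w \<in> vcarrier W"
    obtain s where s: "vCauchy V s" "(\<lambda>n. vnorm W (vdiff W (J (s n)) w)) \<longlonglongrightarrow> 0"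
      using linear_isometry_surj[OF J V W(1,2) dense w] by blast
    have "J' s = w"
      using J'(2)[OF s(1)] s w by (intro W.vlim_unique[OF W(2), of "\<lambda>n. J (s n)"]) (simp_all add: JC J'C V.vCauchy_closed)
    then show "w \<in> U0 ` vcarrier (completion V)"
      using U0(2)[OF s(1)] s(1) by (auto simp: V.completion_carrier intro!: image_eqI)
  qed
  have def: "vdefinite (completion V)" unfolding V.completion_eq by (rule C.quotient_definite)
  define U where "U = restrict U0 (vcarrier (completion V))"
  have U_iso: "isometric_isomorphism (completion V) W U"
  proof -
    have "linear_isometry (completion V) W U"
      using U0(1) by (simp add: linear_isometry_def U_def Q.closed)
    moreover have "inj_on U (vcarrier (completion V))"
      by (rule linear_isometry_inj[OF calculation Q.semi_ip_axioms def W(1)])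
    moreover have "vcarrier W \<subseteq> U ` vcarrier (completion V)" using surj by (simp add: U_def)
    ultimately show ?thesis by (simp add: isometric_isomorphism_iff)
  qed
  have U_embed: "U (completion_embed V x) = J x" if "x \<in> vcarrier V" for x
    using U0_embed[OF that] V.completion_embed_closed[OF that] by (simp add: U_def)
  show ?thesis
  proof (rule ex1I[of _ U], intro conjI ballI)
    show "U \<in> extensional (vcarrier (completion V))" by (simp add: U_def)
  next
    fix U' assume U': "U' \<in> extensional (vcarrier (completion V)) \<and> isometric_isomorphism (completion V) W U' \<and>
      (\<forall>x\<in>vcarrier V. U' (completion_embed V x) = J x)"
    then have U'_iso: "linear_isometry (completion V) W U'" by (simp add: isometric_isomorphism_iff)
    have U_iso': "linear_isometry (completion V) W U" using U_iso by (simp add: isometric_isomorphism_iff)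
    show "U' = U"
    proof (rule extensionalityI)
      fix A assume A: "A \<in> vcarrier (completion V)"
      then obtain s where s: "vCauchy V s" "A = vcoset (Cauchy_space V) (vnull (Cauchy_space V)) s"
        by (auto simp: V.completion_carrier)
      have lim: "(\<lambda>n. vnorm W (vdiff W (J (s n)) (X A))) \<longlonglongrightarrow> 0"
        if X: "linear_isometry (completion V) W X" "\<forall>x\<in>vcarrier V. X (completion_embed V x) = J x" for X
      proof -
        have "vnorm W (vdiff W (J (s n)) (X A)) =
          vnorm (completion V) (vdiff (completion V) (completion_embed V (s n)) A)" for n
          using linear_isometry_norm_diff[OF X(1) Q.semi_ip_axioms V.completion_embed_closed A, of "s n"] X(2)
            V.vCauchy_closed[OF s(1)] by simp
        then show ?thesis using V.completion_embed_tendsto[OF s(1)] s(2) by simp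
      qed
      show "U' A = U A"
        by (rule W.vlim_unique[OF W(2) _ _ _ lim[OF U'_iso] lim[OF U_iso']])
          (use A U' U'_iso U_iso' U_embed in \<open>auto simp: linear_isometry_def JC V.vCauchy_closed[OF s(1)]\<close>)
    qed (use U' in \<open>auto simp: U_def\<close>)
  qed (auto simp: U_iso U_embed)
qed

section \<open>Square-integrable functions\<close>

abbreviation SQ :: "'a measure \<Rightarrow> ('a \<Rightarrow> complex) ip_space" where
  "SQ \<equiv> sq_integrable_space"

lemma SQ_simps:
  "f \<in> vcarrier (SQ M) \<longleftrightarrow> f \<in> borel_measurable M \<and> integrable M (\<lambda>x. (cmod (f x))\<^sup>2)"
  "vadd (SQ M) f g = (\<lambda>x. f x + g x)"
  "vscale (SQ M) c f = (\<lambda>x. c * f x)"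
  "vinner (SQ M) f g = (LINT x|M. cnj (f x) * g x)"
  "vdiff (SQ M) f g = (\<lambda>x. f x - g x)"
  by (simp_all add: sq_integrable_space_def vdiff_def)

lemma norm_add_sq_le: "(norm (a + b))\<^sup>2 \<le> 2 * (norm a)\<^sup>2 + 2 * (norm b)\<^sup>2"
  for a b :: "'a::real_normed_vector"
proof -
  have "(norm (a + b))\<^sup>2 \<le> (norm a + norm b)\<^sup>2" by (intro power_mono norm_triangle_ineq) simp
  also have "\<dots> \<le> 2 * (norm a)\<^sup>2 + 2 * (norm b)\<^sup>2"
    using sum_squares_bound[of "norm a" "norm b"] by (simp add: power2_sum)
  finally show ?thesis .
qed

lemma norm_mult_sq_le: "cmod (a * b) \<le> (cmod a)\<^sup>2 + (cmod b)\<^sup>2"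
proof -
  have "2 * cmod a * cmod b \<le> (cmod a)\<^sup>2 + (cmod b)\<^sup>2" by (rule sum_squares_bound)
  moreover have "0 \<le> cmod a * cmod b" by simp
  ultimately show ?thesis unfolding norm_mult by linarith
qed

lemma cnj_measurable [measurable]: "cnj \<in> borel_measurable borel"
  by (intro borel_measurable_continuous_onI continuous_intros)

lemma SQ_add:
  assumes "f \<in> vcarrier (SQ M)" "g \<in> vcarrier (SQ M)"
  shows "(\<lambda>x. f x + g x) \<in> vcarrier (SQ M)"
proof -
  have [measurable]: "f \<in> borel_measurable M" "g \<in> borel_measurable M" using assms by (simp_all add: SQ_simps)
  have "integrable M (\<lambda>x. (cmod (f x + g x))\<^sup>2)"
  proof (rule Bochner_Integration.integrable_bound)
    show "integrable M (\<lambda>x. 2 * (cmod (f x))\<^sup>2 + 2 * (cmod (g x))\<^sup>2)"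
      using assms by (simp add: SQ_simps)
  qed (use norm_add_sq_le in \<open>auto\<close>)
  then show ?thesis by (simp add: SQ_simps)
qed

lemma SQ_scale: "f \<in> vcarrier (SQ M) \<Longrightarrow> (\<lambda>x. c * f x) \<in> vcarrier (SQ M)"
  by (auto simp: SQ_simps norm_mult power_mult_distrib)

lemma SQ_diff: "f \<in> vcarrier (SQ M) \<Longrightarrow> g \<in> vcarrier (SQ M) \<Longrightarrow> (\<lambda>x. f x - g x) \<in> vcarrier (SQ M)"
  using SQ_add[of f M "\<lambda>x. -1 * g x"] SQ_scale[of g M "-1"] by simp

lemma SQ_mult_integrable:
  assumes "f \<in> vcarrier (SQ M)" "g \<in> vcarrier (SQ M)"
  shows "integrable M (\<lambda>x. f x * g x)"
proof (rule Bochner_Integration.integrable_bound)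
  show "integrable M (\<lambda>x. (cmod (f x))\<^sup>2 + (cmod (g x))\<^sup>2)" using assms by (simp add: SQ_simps)
  have [measurable]: "f \<in> borel_measurable M" "g \<in> borel_measurable M" using assms by (simp_all add: SQ_simps)
  show "(\<lambda>x. f x * g x) \<in> borel_measurable M" by measurable
qed (use norm_mult_sq_le in \<open>auto\<close>)

lemma SQ_cnj: "f \<in> vcarrier (SQ M) \<Longrightarrow> (\<lambda>x. cnj (f x)) \<in> vcarrier (SQ M)"
  by (auto simp: SQ_simps)

lemma SQ_mult_bounded:
  assumes f: "f \<in> vcarrier (SQ M)" and k: "k \<in> borel_measurable M" and B: "AE x in M. cmod (k x) \<le> B"
  shows "(\<lambda>x. f x * k x) \<in> vcarrier (SQ M)"
proof -
  have [measurable]: "f \<in> borel_measurable M" "k \<in> borel_measurable M" using f k by (simp_all add: SQ_simps)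
  have "integrable M (\<lambda>x. (cmod (f x * k x))\<^sup>2)"
  proof (rule Bochner_Integration.integrable_bound)
    show "integrable M (\<lambda>x. (cmod (f x))\<^sup>2 * B\<^sup>2)" using f by (simp add: SQ_simps)
    show "AE x in M. norm ((cmod (f x * k x))\<^sup>2) \<le> norm ((cmod (f x))\<^sup>2 * B\<^sup>2)"
      using B by eventually_elim (simp add: norm_mult power_mult_distrib mult_left_mono power_mono)
  qed measurable
  then show ?thesis by (simp add: SQ_simps)
qed

lemma SQ_inner_integrable:
  "f \<in> vcarrier (SQ M) \<Longrightarrow> g \<in> vcarrier (SQ M) \<Longrightarrow> integrable M (\<lambda>x. cnj (f x) * g x)"
  by (intro SQ_mult_integrable SQ_cnj)

lemma SQ_norm: "f \<in> vcarrier (SQ M) \<Longrightarrow> vnorm (SQ M) f = sqrt (LINT x|M. (cmod (f x))\<^sup>2)"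
proof -
  assume f: "f \<in> vcarrier (SQ M)"
  have "vinner (SQ M) f f = (LINT x|M. complex_of_real ((cmod (f x))\<^sup>2))"
    by (simp only: SQ_simps complex_norm_square mult.commute)
  also have "\<dots> = complex_of_real (LINT x|M. (cmod (f x))\<^sup>2)"
    by (rule integral_complex_of_real)
  finally show ?thesis by (simp add: vnorm_def)
qed

lemma semi_ip_SQ: "semi_ip (SQ M)"
proof (unfold_locales, goal_cases)
  case (3)
  have "(\<lambda>x. 0) \<in> vcarrier (SQ M)" by (simp add: SQ_simps)
  then show ?case by blast
next
  case (13 x y)
  have "cnj (vinner (SQ M) x y) = (LINT t|M. cnj (cnj (x t) * y t))"
    unfolding SQ_simps by (rule Bochner_Integration.integral_cnj[symmetric])
  also have "\<dots> = vinner (SQ M) y x" by (simp add: SQ_simps mult.commute)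
  finally show ?case by simp
next
  case (14 x)
  have "vinner (SQ M) x x = (LINT t|M. complex_of_real ((cmod (x t))\<^sup>2))"
    by (simp only: SQ_simps complex_norm_square mult.commute)
  also have "\<dots> = complex_of_real (LINT t|M. (cmod (x t))\<^sup>2)"
    by (rule integral_complex_of_real)
  finally show ?case by simp
next
  case (11 x y z)
  then show ?case
    by (simp add: SQ_simps(2,4) SQ_inner_integrable distrib_left)
next
  case (12 x y c)
  then show ?case
    using Bochner_Integration.integral_mult_right_zero[of M c "\<lambda>t. cnj (x t) * y t"] by (simp add: SQ_simps(3,4) SQ_inner_integrable mult.left_commute)
qed (simp_all add: SQ_simps(2,3) SQ_add SQ_scale algebra_simps)

lemma SQ_norm_zero_iff:
  assumes "f \<in> vcarrier (SQ M)"
  shows "vnorm (SQ M) f = 0 \<longleftrightarrow> (AE x in M. f x = 0)"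
  using assms integral_nonneg_eq_0_iff_AE[of M "\<lambda>x. (cmod (f x))\<^sup>2"]
  by (simp add: SQ_norm SQ_simps)

lemma ae_zero_eq: "ae_zero M = vnull (SQ M)"
  using SQ_norm_zero_iff semi_ip.vnull_iff[OF semi_ip_SQ] unfolding ae_zero_def
  by (auto simp: vnull_def)

lemma L2_eq: "L2 M = vquotient (SQ M) (vnull (SQ M))"
  by (simp add: L2_def ae_zero_eq)

lemma L2_class_eq: "L2_class M f = vcoset (SQ M) (vnull (SQ M)) f"
  by (simp add: L2_class_def ae_zero_eq)

section \<open>Cauchy's formula on horizontal lines\<close>

abbreviation UHP :: "complex set" where
  "UHP \<equiv> {z. Im z > 0}"

lemma open_UHP: "open UHP" by (rule open_halfspace_Im_gt)

lemma convex_UHP: "convex UHP" by (rule convex_halfspace_Im_gt)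

section \<open>Line integrals, rectangles and the choice of their vertical sides\<close>

lemma Complex_measurable [measurable (raw)]:
  assumes [measurable]: "f \<in> borel_measurable M" "g \<in> borel_measurable M"
  shows "(\<lambda>x. Complex (f x) (g x)) \<in> borel_measurable M"
  unfolding Complex_eq by measurable

lemma continuous_on_Complex_line: "continuous_on S (\<lambda>x. Complex x y)"
  unfolding Complex_eq by (intro continuous_intros)

lemma continuous_on_Complex_vline: "continuous_on S (\<lambda>y. Complex x y)"
  unfolding Complex_eq by (intro continuous_intros)

lemma continuous_on_hline:
  assumes "f holomorphic_on UHP" "y > 0"
  shows "continuous_on S (\<lambda>x. f (Complex x y))"
  by (rule continuous_on_compose2[OF holomorphic_on_imp_continuous_on[OF assms(1)] continuous_on_Complex_line])
    (use assms in auto)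

lemma measurable_hline:
  assumes "f holomorphic_on UHP" "y > 0"
  shows "(\<lambda>x. f (Complex x y)) \<in> borel_measurable borel"
  by (intro borel_measurable_continuous_onI continuous_on_hline assms)

lemma contour_integral_linepath_same_Im:
  assumes "a < b"
  shows "contour_integral (linepath (Complex a y) (Complex b y)) f = integral {a..b} (\<lambda>x. f (Complex x y))"
proof -
  have "contour_integral (linepath (Complex a y) (Complex b y)) f =
    of_real (b - a) * integral {0..1} (\<lambda>x. f (linepath (Complex a y) (Complex b y) x))"
    by (simp add: contour_integral_integral Complex_eq)
  also have "integral {0..1} (\<lambda>x. f (linepath (Complex a y) (Complex b y) x)) =
    integral {0..1} (\<lambda>x. f (Complex (linepath a b x) y))"
    by (simp add: linepath_def Complex_eq scaleR_conv_of_real algebra_simps)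
  also have "\<dots> = integral {0..(b - a) / (b - a)} (\<lambda>x. f (Complex (a + (b - a) * x) y))"
    using \<open>a < b\<close> by (simp add: algebra_simps linepath_def)
  also have "{0..(b - a) / (b - a)} = (\<lambda>x. x / (b - a)) ` {0..b - a}"
    using \<open>a < b\<close> by simp
  also have "integral \<dots> (\<lambda>x. f (Complex (a + (b - a) * x) y)) =
    integral {a-a..b-a} (\<lambda>x. f (Complex (x + a) y)) / of_real (b - a)"
    using \<open>a < b\<close> by (subst integral_stretch_real) (auto simp: scaleR_conv_of_real add_ac)
  also have "\<dots> = integral {a..b} (\<lambda>x. f (Complex x y)) / of_real (b - a)"
    by (subst integral_shift_real_ivl) auto
  finally show ?thesis using \<open>a < b\<close> by simp
qed

lemma rectpath_contour_integral:
  assumes "a < b" "c < d" and f: "continuous_on (path_image (rectpath (Complex a c) (Complex b d))) f"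
  shows "contour_integral (rectpath (Complex a c) (Complex b d)) f =
    integral {a..b} (\<lambda>x. f (Complex x c)) + \<i> * integral {c..d} (\<lambda>y. f (Complex b y))
    - integral {a..b} (\<lambda>x. f (Complex x d)) - \<i> * integral {c..d} (\<lambda>y. f (Complex a y))"
proof -
  define l1 where "l1 = linepath (Complex a c) (Complex b c)"
  define l2 where "l2 = linepath (Complex b c) (Complex b d)"
  define l3 where "l3 = linepath (Complex b d) (Complex a d)"
  define l4 where "l4 = linepath (Complex a d) (Complex a c)"
  have r: "rectpath (Complex a c) (Complex b d) = l1 +++ l2 +++ l3 +++ l4"
    by (simp add: rectpath_def Let_def l1_def l2_def l3_def l4_def)
  have "path_image (rectpath (Complex a c) (Complex b d)) =
    path_image l1 \<union> path_image l2 \<union> path_image l3 \<union> path_image l4"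
    unfolding r by (simp add: path_image_join l1_def l2_def l3_def l4_def Un_assoc)
  then have i: "f contour_integrable_on l1" "f contour_integrable_on l2"
    "f contour_integrable_on l3" "f contour_integrable_on l4"
    using f unfolding l1_def l2_def l3_def l4_def
    by (auto intro!: contour_integrable_continuous_linepath intro: continuous_on_subset)
  have v: "valid_path l1" "valid_path l2" "valid_path l3" "valid_path l4"
    by (simp_all add: l1_def l2_def l3_def l4_def)
  have "contour_integral (rectpath (Complex a c) (Complex b d)) f =
    contour_integral l1 f + (contour_integral l2 f + (contour_integral l3 f + contour_integral l4 f))"
    unfolding r using i v by (simp add: l1_def l2_def l3_def l4_def valid_path_join contour_integrable_joinI)
  also have "contour_integral l1 f = integral {a..b} (\<lambda>x. f (Complex x c))"
    unfolding l1_def by (rule contour_integral_linepath_same_Im) fact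
  also have "contour_integral l2 f = \<i> * integral {c..d} (\<lambda>y. f (Complex b y))"
    unfolding l2_def by (rule contour_integral_linepath_same_Re) (use assms in auto)
  also have "contour_integral l3 f = - integral {a..b} (\<lambda>x. f (Complex x d))"
    using contour_integral_reverse_linepath[of "Complex a d" "Complex b d" f]
      contour_integral_linepath_same_Im[OF assms(1), of d f] f i(3)
    unfolding l3_def by (metis add.inverse_inverse contour_integrable_reversepath_eq contour_integral_reversepath reversepath_linepath valid_path_linepath)
  also have "contour_integral l4 f = - (\<i> * integral {c..d} (\<lambda>y. f (Complex a y)))"
    using contour_integral_linepath_same_Re[of "Complex a c" a "Complex a d" c d f] assms(2) i(4)
    unfolding l4_def by (metis complex.sel add.inverse_inverse contour_integrable_reversepath_eq contour_integral_reversepath reversepath_linepath valid_path_linepath)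
  finally show ?thesis by simp
qed

text \<open>If the sum stayed at least e beyond K, a window of length L = (2 c + 1) / e would
  already contribute 2 c + 1, more than the total 2 c of both half-lines. Both signs are treated at
  once because the two vertical sides of a rectangle lie at R and -R.\<close>

lemma nn_integral_symmetric_small:
  fixes g :: "real \<Rightarrow> ennreal"
  assumes [measurable]: "g \<in> borel_measurable borel" and fin: "(\<integral>\<^sup>+x. g x \<partial>lborel) < \<infinity>" and e: "e > 0"
  obtains R where "R > K" "g R + g (- R) < ennreal e"
proof -
  have "\<exists>R>K. g R + g (- R) < ennreal e"
  proof (rule ccontr)
    assume n: "\<not> ?thesis"
    obtain c where c: "(\<integral>\<^sup>+x. g x \<partial>lborel) = ennreal c" "c \<ge> 0"
      using fin by (cases "\<integral>\<^sup>+x. g x \<partial>lborel") auto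
    define L where "L = (2 * c + 1) / e"
    have L: "L > 0" using c e by (simp add: L_def)
    have "(\<integral>\<^sup>+x. ennreal e * indicator {K<..<K + L} x \<partial>lborel) \<le> (\<integral>\<^sup>+x. g x + g (- x) \<partial>lborel)"
      using n by (intro nn_integral_mono) (force simp: not_less split: split_indicator)
    also have "\<dots> = (\<integral>\<^sup>+x. g x \<partial>lborel) + (\<integral>\<^sup>+x. g (- x) \<partial>lborel)"
      by (intro nn_integral_add) measurable
    also have "(\<integral>\<^sup>+x. g (- x) \<partial>lborel) = (\<integral>\<^sup>+x. g x \<partial>lborel)"
      using nn_integral_real_affine[of g "-1" 0] by simp
    finally have "ennreal e * ennreal L \<le> ennreal (2 * c)"
      using c L by (simp add: nn_integral_cmult_indicator flip: ennreal_plus)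
    then have "e * L \<le> 2 * c" using e L c by (simp flip: ennreal_mult)
    then show False using e by (simp add: L_def)
  qed
  then show ?thesis using that by blast
qed

section \<open>Cauchy's theorem for functions that are uniformly integrable on lines\<close>

text \<open>Membership in the Hardy space H^1 with an explicit bound; products of two functions in
  H^2 are of this kind. The bound is a parameter because it has to control the upper side of a
  rectangle uniformly in its height.\<close>

definition hardy1_bound :: "(complex \<Rightarrow> complex) \<Rightarrow> real \<Rightarrow> bool" where
  "hardy1_bound V M \<longleftrightarrow> V holomorphic_on UHP \<and>
    (\<forall>y>0. integrable lborel (\<lambda>x. V (Complex x y)) \<and> (LINT x|lborel. cmod (V (Complex x y))) \<le> M)"

lemma hardy1_boundD:
  assumes "hardy1_bound V M"
  shows "V holomorphic_on UHP" "y > 0 \<Longrightarrow> integrable lborel (\<lambda>x. V (Complex x y))"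
    "y > 0 \<Longrightarrow> (LINT x|lborel. cmod (V (Complex x y))) \<le> M"
  using assms by (auto simp: hardy1_bound_def)

text \<open>No pointwise decay of \<open>V\<close> is available. By Fubini the integral of |V| over
  the strip between c and d is at most M (d - c), so the integrals over vertical segments, as a
  function of the abscissa, are integrable and hence small at some pair R, -R arbitrarily far
  out.\<close>

lemma hardy1_vertical:
  assumes V: "hardy1_bound V M" and ec: "0 < c" "c < d" and e: "e > 0"
  obtains R where "R > K" "integral {c..d} (\<lambda>y. cmod (V (Complex R y))) + integral {c..d} (\<lambda>y. cmod (V (Complex (-R) y))) < e"
proof -
  have hol: "V holomorphic_on UHP" using V by (simp add: hardy1_bound_def)
  \<comment> \<open>Extension by zero: outside the half-plane the values of \<open>V\<close> are
    arbitrary and might not be measurable, but Fubini needs a function measurable on the whole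
    plane.\<close>
  define W where "W z = indicator UHP z *\<^sub>R V z" for z
  have W [measurable]: "W \<in> borel_measurable borel"
    unfolding W_def by (intro borel_measurable_continuous_on_indicator holomorphic_on_imp_continuous_on hol)
      (simp add: open_UHP borel_open)
  have WV: "W (Complex x y) = V (Complex x y)" if "y > 0" for x y using that by (simp add: W_def)
  define g where "g x = (\<integral>\<^sup>+y. ennreal (cmod (W (Complex x y))) * indicator {c..d} y \<partial>lborel)" for x
  have g [measurable]: "g \<in> borel_measurable borel" unfolding g_def by measurable
  have geq: "g x = ennreal (integral {c..d} (\<lambda>y. cmod (V (Complex x y))))" for x
  proof -
    have cont: "continuous_on {c..d} (\<lambda>y. cmod (V (Complex x y)))"
      by (intro continuous_on_norm continuous_on_compose2[OF holomorphic_on_imp_continuous_on[OF hol] continuous_on_Complex_vline])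
        (use ec in auto)
    have si: "set_integrable lborel {c..d} (\<lambda>y. cmod (V (Complex x y)))"
      by (rule borel_integrable_atLeastAtMost'[OF cont])
    have "g x = (\<integral>\<^sup>+y. ennreal (indicator {c..d} y *\<^sub>R cmod (V (Complex x y))) \<partial>lborel)"
      unfolding g_def using ec by (intro nn_integral_cong) (auto simp: WV split: split_indicator)
    also have "\<dots> = ennreal (LINT y|lborel. indicator {c..d} y *\<^sub>R cmod (V (Complex x y)))"
      by (intro nn_integral_eq_integral) (use si in \<open>auto simp: set_integrable_def\<close>)
    also have "(LINT y|lborel. indicator {c..d} y *\<^sub>R cmod (V (Complex x y))) = integral {c..d} (\<lambda>y. cmod (V (Complex x y)))"
      using set_borel_integral_eq_integral(2)[OF si] by (simp add: set_lebesgue_integral_def)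
    finally show ?thesis .
  qed
  have "(\<integral>\<^sup>+x. g x \<partial>lborel) = (\<integral>\<^sup>+y. (\<integral>\<^sup>+x. ennreal (cmod (W (Complex x y))) * indicator {c..d} y \<partial>lborel) \<partial>lborel)"
    unfolding g_def by (rule lborel_pair.Fubini') measurable
  also have "\<dots> \<le> (\<integral>\<^sup>+y. ennreal M * indicator {c..d} y \<partial>lborel)"
  proof (intro nn_integral_mono)
    fix y
    show "(\<integral>\<^sup>+x. ennreal (cmod (W (Complex x y))) * indicator {c..d} y \<partial>lborel) \<le> ennreal M * indicator {c..d} y"
    proof (cases "y \<in> {c..d}")
      case True
      then have y: "y > 0" using ec by simp
      have "(\<integral>\<^sup>+x. ennreal (cmod (W (Complex x y))) * indicator {c..d} y \<partial>lborel) = (\<integral>\<^sup>+x. ennreal (cmod (V (Complex x y))) \<partial>lborel)"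
        using True y by (simp add: WV)
      also have "\<dots> = ennreal (LINT x|lborel. cmod (V (Complex x y)))"
        using hardy1_boundD(2)[OF V y] by (intro nn_integral_eq_integral) auto
      also have "\<dots> \<le> ennreal M" using hardy1_boundD(3)[OF V y] by (rule ennreal_leI)
      finally show ?thesis using True by simp
    qed simp
  qed
  also have "\<dots> < \<infinity>" using ec by (simp add: nn_integral_cmult_indicator ennreal_mult_less_top)
  finally obtain R where R: "R > K" "g R + g (- R) < ennreal e" using nn_integral_symmetric_small[OF g _ e] by metis
  have nn: "integral {c..d} (\<lambda>y. cmod (V (Complex x y))) \<ge> 0" for x
    by (cases "(\<lambda>y. cmod (V (Complex x y))) integrable_on {c..d}")
      (auto intro: Henstock_Kurzweil_Integration.integral_nonneg simp: not_integrable_integral)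
  show ?thesis using that R nn by (simp add: geq ennreal_less_iff flip: ennreal_plus)
qed

lemma set_lebesgue_limit_symmetric:
  fixes f :: "real \<Rightarrow> complex"
  assumes f: "integrable lborel f" and R: "\<And>n::nat. R n > real n"
  shows "(\<lambda>n. LINT x|lborel. indicator {- R n..R n} x *\<^sub>R f x) \<longlonglongrightarrow> (LINT x|lborel. f x)"
proof (rule integral_dominated_convergence[where w = "\<lambda>x. norm (f x)"])
  show "f \<in> borel_measurable lborel" using f by auto
  then show "(\<lambda>x. indicator {- R n..R n} x *\<^sub>R f x) \<in> borel_measurable lborel" for n by measurable
  show "integrable lborel (\<lambda>x. norm (f x))" using f by (rule integrable_norm)
  show "AE x in lborel. (\<lambda>n. indicator {- R n..R n} x *\<^sub>R f x) \<longlonglongrightarrow> f x"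
  proof (rule AE_I2, rule tendsto_eventually)
    fix x :: real
    obtain N :: nat where N: "\<bar>x\<bar> \<le> real N" using real_arch_simple by blast
    show "\<forall>\<^sub>F n in sequentially. indicator {- R n..R n} x *\<^sub>R f x = f x"
    proof (rule eventually_sequentiallyI[of N])
      fix n assume "n \<ge> N"
      then have "\<bar>x\<bar> \<le> R n" using N R[of n] by linarith
      then show "indicator {- R n..R n} x *\<^sub>R f x = f x" by (simp add: abs_le_iff)
    qed
  qed
qed (auto split: split_indicator)

lemma line_kernel_bound:
  assumes V: "hardy1_bound V M" and y: "y > 0" and ne: "Im z0 \<noteq> y"
  shows "integrable lborel (\<lambda>x. V (Complex x y) / (Complex x y - z0))"
    "cmod (V (Complex x y) / (Complex x y - z0)) \<le> cmod (V (Complex x y)) / \<bar>y - Im z0\<bar>"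
proof -
  have d: "\<bar>y - Im z0\<bar> \<le> cmod (Complex x y - z0)" for x
    using abs_Im_le_cmod[of "Complex x y - z0"] by simp
  show b: "cmod (V (Complex x y) / (Complex x y - z0)) \<le> cmod (V (Complex x y)) / \<bar>y - Im z0\<bar>" for x
    unfolding norm_divide using ne d[of x] by (intro divide_left_mono mult_pos_pos) auto
  have [measurable]: "(\<lambda>x. V (Complex x y)) \<in> borel_measurable borel"
    using measurable_hline hardy1_boundD(1)[OF V] y by blast
  show "integrable lborel (\<lambda>x. V (Complex x y) / (Complex x y - z0))"
    by (rule Bochner_Integration.integrable_bound[of _ "\<lambda>x. cmod (V (Complex x y)) / \<bar>y - Im z0\<bar>"])
      (use hardy1_boundD(2)[OF V y] b in auto)
qed

lemma rectangle_value:
  assumes hol: "V holomorphic_on UHP" and e: "0 < e" "e < T" and R: "R > \<bar>Re z0\<bar>"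
    and z0: "Im z0 > e \<and> Im z0 < T \<or> Im z0 < 0"
  shows "contour_integral (rectpath (Complex (-R) e) (Complex R T)) (\<lambda>w. V w / (w - z0)) =
    (if Im z0 > e then 2 * pi * \<i> * V z0 else 0)"
proof (rule contour_integral_unique)
  let ?p = "rectpath (Complex (-R) e) (Complex R T)"
  have img: "path_image ?p \<subseteq> UHP"
    using path_image_rectpath_subset_cbox[of "Complex (-R) e" "Complex R T"] e R
    by (force simp: in_cbox_complex_iff)
  show "((\<lambda>w. V w / (w - z0)) has_contour_integral (if Im z0 > e then 2 * pi * \<i> * V z0 else 0)) ?p"
  proof (cases "Im z0 > e")
    case True
    then have box: "z0 \<in> box (Complex (-R) e) (Complex R T)" using z0 e R by (auto simp: in_box_complex_iff)
    have R0: "R \<ge> 0" using R by linarith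
    have "z0 \<notin> path_image ?p"
      using path_image_rectpath_inter_box[of "Complex (-R) e" "Complex R T"] box e R R0 by auto
    then show ?thesis
      using Cauchy_integral_formula_convex_simple[OF convex_UHP hol, of z0 ?p] img True e
        winding_number_rectpath[OF box] by (auto simp: interior_open[OF open_UHP])
  next
    case False
    then have "(\<lambda>w. V w / (w - z0)) holomorphic_on UHP"
      using z0 by (intro holomorphic_intros hol) auto
    then show ?thesis using Cauchy_theorem_convex_simple[OF _ convex_UHP _ img] False by simp
  qed
qed

lemma integral_interval_lborel:
  fixes f :: "real \<Rightarrow> complex"
  assumes "integrable lborel f"
  shows "integral {a..b} f = (LINT x|lborel. indicator {a..b} x *\<^sub>R f x)"
proof -
  have "set_integrable lborel {a..b} f"
    unfolding set_integrable_def by (rule integrable_mult_indicator[OF _ assms]) simp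
  from set_borel_integral_eq_integral(2)[OF this] show ?thesis by (simp add: set_lebesgue_integral_def)
qed

text \<open>The wanted integral is the lower side of a rectangle. For fixed height T the vertical
  sides vanish along a chosen sequence R n, and the upper side contributes at most M / (T - Im z0).
  The second limit, T to infinity, removes it.\<close>

lemma hardy1_line_Cauchy:
  assumes V: "hardy1_bound V M" and e: "e > 0" and z0: "Im z0 > e \<or> Im z0 < 0"
  shows "(LINT x|lborel. V (Complex x e) / (Complex x e - z0)) = (if Im z0 > e then 2 * pi * \<i> * V z0 else 0)"
    (is "?I = ?c")
proof -
  have hol: "V holomorphic_on UHP" using V by (simp add: hardy1_bound_def)
  have M0: "M \<ge> 0" using hardy1_boundD(3)[OF V e] by (smt (verit) integral_nonneg_AE norm_ge_zero AE_I2 Bochner_Integration.integral_nonneg)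
  have bound: "cmod (?I - ?c) \<le> M / (T - Im z0)" if T: "T > e" "T > Im z0" for T
  proof -
    define W where "W w = V w / (w - z0)" for w
    define s where "s x = integral {e..T} (\<lambda>y. cmod (V (Complex x y)))" for x
    have "\<exists>R>real n + \<bar>Re z0\<bar> + 1. s R + s (- R) < 1 / real (Suc n)" for n
      using hardy1_vertical[OF V e T(1), of "1 / real (Suc n)" "real n + \<bar>Re z0\<bar> + 1"] unfolding s_def by (metis of_nat_0_less_iff zero_less_Suc zero_less_divide_1_iff)
    then obtain R where R: "\<And>n. R n > real n + \<bar>Re z0\<bar> + 1" "\<And>n. s (R n) + s (- R n) < 1 / real (Suc n)"
      by metis
    have Rn: "R n > real n" for n using R(1)[of n] by linarith
    define J where "J n = (LINT x|lborel. indicator {- R n..R n} x *\<^sub>R W (Complex x e))" for n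
    have iW: "integrable lborel (\<lambda>x. W (Complex x e))" "integrable lborel (\<lambda>x. W (Complex x T))"
      unfolding W_def using line_kernel_bound(1)[OF V] e T z0 by auto
    have est: "cmod (J n - ?c) \<le> 1 / real (Suc n) + M / (T - Im z0)" for n
    proof -
      have Rp: "R n > \<bar>Re z0\<bar> + 1" using R(1)[of n] by linarith
      have sub: "path_image (rectpath (Complex (- R n) e) (Complex (R n) T)) \<subseteq> UHP - {z0}"
        using path_image_rectpath[of "Complex (- R n) e" "Complex (R n) T"] e T z0 Rp by auto
      have cont: "continuous_on (UHP - {z0}) W" unfolding W_def
        by (intro continuous_intros continuous_on_subset[OF holomorphic_on_imp_continuous_on[OF hol]]) auto
      have "?c = integral {- R n..R n} (\<lambda>x. W (Complex x e)) + \<i> * integral {e..T} (\<lambda>y. W (Complex (R n) y))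
        - integral {- R n..R n} (\<lambda>x. W (Complex x T)) - \<i> * integral {e..T} (\<lambda>y. W (Complex (- R n) y))"
        using rectangle_value[OF hol e T(1), of z0 "R n"] rectpath_contour_integral[of "- R n" "R n" e T W] Rp T z0
          continuous_on_subset[OF cont sub] unfolding W_def by auto
      then have eq: "J n - ?c = integral {- R n..R n} (\<lambda>x. W (Complex x T))
        + (\<i> * integral {e..T} (\<lambda>y. W (Complex (- R n) y)) - \<i> * integral {e..T} (\<lambda>y. W (Complex (R n) y)))"
        unfolding J_def using integral_interval_lborel[OF iW(1)] by simp
      have side: "cmod (integral {e..T} (\<lambda>y. W (Complex x y))) \<le> s x" if x: "\<bar>x\<bar> = R n" for x
        unfolding s_def
      proof (rule integral_norm_bound_integral)
        have x1: "1 \<le> \<bar>x - Re z0\<bar>" using Rp x by linarith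
        have contV: "continuous_on {e..T} (\<lambda>y. V (Complex x y))"
          by (intro continuous_on_compose2[OF holomorphic_on_imp_continuous_on[OF hol] continuous_on_Complex_vline])
            (use e in auto)
        have ne: "Complex x y \<noteq> z0" for y using x1 by auto
        show "(\<lambda>y. W (Complex x y)) integrable_on {e..T}" unfolding W_def
          by (intro integrable_continuous_interval continuous_intros contV continuous_on_Complex_vline) (use ne in auto)
        show "(\<lambda>y. cmod (V (Complex x y))) integrable_on {e..T}"
          by (intro integrable_continuous_interval continuous_intros contV)
        fix y assume "y \<in> {e..T}"
        have "1 \<le> cmod (Complex x y - z0)"
          using abs_Re_le_cmod[of "Complex x y - z0"] x1 by simp
        then show "cmod (W (Complex x y)) \<le> cmod (V (Complex x y))"
          unfolding W_def norm_divide by (simp add: divide_le_eq mult_left_le_one_le mult_le_cancel_left1)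
      qed
      have top: "cmod (integral {- R n..R n} (\<lambda>x. W (Complex x T))) \<le> M / (T - Im z0)"
      proof -
        have T0: "T > 0" using e T by linarith
        have "cmod (integral {- R n..R n} (\<lambda>x. W (Complex x T))) =
          cmod (LINT x|lborel. indicator {- R n..R n} x *\<^sub>R W (Complex x T))"
          using integral_interval_lborel[OF iW(2)] by simp
        also have "\<dots> \<le> (LINT x|lborel. cmod (V (Complex x T)) / (T - Im z0))"
        proof (rule order_trans[OF integral_norm_bound integral_mono])
          have "integrable lborel (\<lambda>x. indicator {- R n..R n} x *\<^sub>R W (Complex x T))"
            by (rule integrable_mult_indicator[OF _ iW(2)]) simp
          then show "integrable lborel (\<lambda>x. norm (indicator {- R n..R n} x *\<^sub>R W (Complex x T)))"
            by (rule integrable_norm)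
          show "integrable lborel (\<lambda>x. cmod (V (Complex x T)) / (T - Im z0))"
            using hardy1_boundD(2)[OF V T0] by auto
          show "norm (indicator {- R n..R n} x *\<^sub>R W (Complex x T)) \<le> cmod (V (Complex x T)) / (T - Im z0)" for x
            using line_kernel_bound(2)[OF V T0, of z0 x] T unfolding W_def by (auto split: split_indicator)
        qed
        also have "\<dots> \<le> M / (T - Im z0)" using hardy1_boundD(3)[OF V T0] T by (simp add: divide_right_mono)
        finally show ?thesis .
      qed
      have "cmod (J n - ?c) \<le> cmod (integral {- R n..R n} (\<lambda>x. W (Complex x T)))
        + (cmod (\<i> * integral {e..T} (\<lambda>y. W (Complex (- R n) y))) + cmod (\<i> * integral {e..T} (\<lambda>y. W (Complex (R n) y))))"
        unfolding eq by (intro norm_triangle_mono order_refl norm_triangle_ineq4)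
      also have "\<dots> \<le> M / (T - Im z0) + (s (- R n) + s (R n))"
        using Rp by (intro add_mono top) (simp_all add: norm_mult side)
      finally show ?thesis using R(2)[of n] by linarith
    qed
    have "J \<longlonglongrightarrow> (LINT x|lborel. W (Complex x e))"
      unfolding J_def by (rule set_lebesgue_limit_symmetric[OF iW(1) Rn])
    then have l1: "(\<lambda>n. cmod (J n - ?c)) \<longlonglongrightarrow> cmod (?I - ?c)"
      unfolding W_def by (intro tendsto_intros)
    have l2: "(\<lambda>n. 1 / real (Suc n) + M / (T - Im z0)) \<longlonglongrightarrow> 0 + M / (T - Im z0)"
      by (intro tendsto_add tendsto_const LIMSEQ_Suc[OF lim_1_over_n])
    show ?thesis using LIMSEQ_le[OF l1 l2] est by auto
  qed
  have lim: "((\<lambda>T. M / (T - Im z0)) \<longlongrightarrow> 0) at_top"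
    by real_asymp
  have "cmod (?I - ?c) \<le> 0"
  proof (rule tendsto_lowerbound[OF lim])
    show "\<forall>\<^sub>F T in at_top. cmod (?I - ?c) \<le> M / (T - Im z0)"
      using eventually_gt_at_top[of "max e (Im z0)"] by eventually_elim (rule bound, simp_all)
  qed simp
  then show ?thesis by simp
qed

text \<open>With N = n + 1, the kernel \<open>k n\<close> equals i N / (x + i e + i N): it is
  bounded by 1, tends to 1 as n grows, and has its pole at -i N in the lower half-plane. The line
  formula gives 0 for each n, and dominated convergence removes the kernel.\<close>

lemma hardy1_line_integral_zero:
  assumes V: "hardy1_bound V M" and e: "e > 0"
  shows "(LINT x|lborel. V (Complex x e)) = 0"
proof -
  define k where "k n x = \<i> * of_real (real (Suc n)) / (Complex x e + \<i> * of_real (real (Suc n)))" for n x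
  have kb: "cmod (k n x) \<le> 1" for n x
  proof -
    have "real (Suc n) \<le> \<bar>Im (Complex x e + \<i> * of_real (real (Suc n)))\<bar>" using e by simp
    also have "\<dots> \<le> cmod (Complex x e + \<i> * of_real (real (Suc n)))" by (rule abs_Im_le_cmod)
    finally have "real (Suc n) \<le> cmod (Complex x e + \<i> * of_real (real (Suc n)))" .
    then show ?thesis unfolding k_def norm_divide norm_mult by (simp add: divide_le_eq_1 del: of_nat_Suc)
  qed
  have klim: "(\<lambda>n. k n x) \<longlonglongrightarrow> 1" for x
  proof -
    have "(\<lambda>n. 1 / (Complex x e * (- \<i>) * of_real (inverse (real (Suc n))) + 1)) \<longlonglongrightarrow> 1 / (Complex x e * (- \<i>) * of_real 0 + 1)"
      by (intro tendsto_intros LIMSEQ_inverse_real_of_nat) auto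
    moreover have "1 / (Complex x e * (- \<i>) * of_real (inverse (real (Suc n))) + 1) = k n x" for n
    proof -
      define t :: complex where "t = of_real (real (Suc n))"
      have t: "t \<noteq> 0" "of_real (inverse (real (Suc n))) = inverse t" by (simp_all add: t_def del: of_nat_Suc)
      have "k n x = (\<i> * t) / (\<i> * t * (Complex x e * (- \<i>) * inverse t + 1))"
      proof -
        have "\<i> * t * (Complex x e * (- \<i>) * inverse t + 1) = Complex x e * (t * inverse t) * (- (\<i> * \<i>)) + \<i> * t"
          by algebra
        also have "\<dots> = Complex x e + \<i> * t" using t(1) by simp
        finally show ?thesis unfolding k_def t_def[symmetric] by simp
      qed
      also have "\<dots> = 1 / (Complex x e * (- \<i>) * inverse t + 1)"
        by (rule nonzero_divide_mult_cancel_left) (simp add: t)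
      finally show ?thesis by (simp only: t)
    qed
    ultimately show ?thesis by simp
  qed
  have [measurable]: "(\<lambda>x. V (Complex x e)) \<in> borel_measurable borel"
    using measurable_hline hardy1_boundD(1)[OF V] e by blast
  have "(\<lambda>n. LINT x|lborel. V (Complex x e) * k n x) \<longlonglongrightarrow> (LINT x|lborel. V (Complex x e))"
  proof (rule integral_dominated_convergence[where w = "\<lambda>x. cmod (V (Complex x e))"])
    show "integrable lborel (\<lambda>x. cmod (V (Complex x e)))" using hardy1_boundD(2)[OF V e] by simp
    show "AE x in lborel. (\<lambda>n. V (Complex x e) * k n x) \<longlonglongrightarrow> V (Complex x e)"
      using tendsto_mult[OF tendsto_const klim] by (intro AE_I2) simp
    show "AE x in lborel. norm (V (Complex x e) * k n x) \<le> cmod (V (Complex x e))" for n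
      using kb by (intro AE_I2) (simp add: norm_mult mult_left_le)
  qed (auto simp: k_def)
  moreover have "(LINT x|lborel. V (Complex x e) * k n x) = 0" for n
  proof -
    have "(LINT x|lborel. V (Complex x e) * k n x) =
      (LINT x|lborel. (\<i> * of_real (real (Suc n))) * (V (Complex x e) / (Complex x e - (- \<i> * of_real (real (Suc n))))))"
      unfolding k_def by (intro Bochner_Integration.integral_cong) (simp_all add: mult_ac)
    also have "\<dots> = (\<i> * of_real (real (Suc n))) * (LINT x|lborel. V (Complex x e) / (Complex x e - (- \<i> * of_real (real (Suc n)))))"
      by (rule integral_mult_right_zero)
    also have "(LINT x|lborel. V (Complex x e) / (Complex x e - (- \<i> * of_real (real (Suc n))))) = 0"
      using hardy1_line_Cauchy[OF V e, of "- \<i> * of_real (real (Suc n))"] e by simp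
    finally show ?thesis by simp
  qed
  ultimately show ?thesis by (simp add: LIMSEQ_const_iff)
qed

section \<open>Boundary values in the Hardy space\<close>

text \<open>A Hardy function together with one representative of its boundary values. The supremum
  of extended integrals in \<open>hardy2\<close> is replaced by a real bound, so that the Bochner
  integral can be used throughout; \<open>hardy_pair_iff\<close> shows that nothing is lost.\<close>

definition hardy_pair :: "(complex \<Rightarrow> complex) \<Rightarrow> (real \<Rightarrow> complex) \<Rightarrow> bool" where
  "hardy_pair f g \<longleftrightarrow> f holomorphic_on UHP \<and>
    (\<exists>M. \<forall>y>0. (\<lambda>x. f (Complex x y)) \<in> vcarrier (SQ lborel) \<and>
      (LINT x|lborel. (cmod (f (Complex x y)))\<^sup>2) \<le> M) \<and>
    g \<in> vcarrier (SQ lborel) \<and>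
    (AE x in lborel. ((\<lambda>\<epsilon>. f (Complex x \<epsilon>)) \<longlongrightarrow> g x) (at_right 0))"

lemma hardy_pair_iff: "f \<in> hardy2 \<and> boundary_function f g \<longleftrightarrow> hardy_pair f g"
proof -
  have "(SUP y\<in>{0<..}. \<integral>\<^sup>+x. ennreal ((cmod (f (Complex x y)))\<^sup>2) \<partial>lborel) < \<infinity> \<longleftrightarrow>
    (\<exists>M. \<forall>y>0. (\<lambda>x. f (Complex x y)) \<in> vcarrier (SQ lborel) \<and>
      (LINT x|lborel. (cmod (f (Complex x y)))\<^sup>2) \<le> M)" (is "?S < \<infinity> \<longleftrightarrow> ?R")
    if hol: "f holomorphic_on UHP"
  proof
    assume fin: "?S < \<infinity>"
    then obtain M where M: "?S = ennreal M" "M \<ge> 0" by (cases ?S) auto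
    have "(\<lambda>x. f (Complex x y)) \<in> vcarrier (SQ lborel) \<and> (LINT x|lborel. (cmod (f (Complex x y)))\<^sup>2) \<le> M"
      if y: "y > 0" for y
    proof -
      have [measurable]: "(\<lambda>x. f (Complex x y)) \<in> borel_measurable borel" by (rule measurable_hline[OF hol y])
      have le: "(\<integral>\<^sup>+x. ennreal ((cmod (f (Complex x y)))\<^sup>2) \<partial>lborel) \<le> ennreal M"
        unfolding M(1)[symmetric] using y by (intro SUP_upper) simp
      have i: "integrable lborel (\<lambda>x. (cmod (f (Complex x y)))\<^sup>2)"
        by (rule integrableI_bounded) (use le in \<open>auto simp: order_le_less_trans[OF le]\<close>)
      have "ennreal (LINT x|lborel. (cmod (f (Complex x y)))\<^sup>2) \<le> ennreal M"
        using le nn_integral_eq_integral[OF i] by simp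
      then show ?thesis using i M(2) by (simp add: SQ_simps ennreal_le_iff)
    qed
    then show ?R by blast
  next
    assume ?R
    then obtain M where M: "\<And>y. y > 0 \<Longrightarrow> integrable lborel (\<lambda>x. (cmod (f (Complex x y)))\<^sup>2)"
      "\<And>y. y > 0 \<Longrightarrow> (LINT x|lborel. (cmod (f (Complex x y)))\<^sup>2) \<le> M" by (auto simp: SQ_simps)
    have "?S \<le> ennreal M"
      by (intro SUP_least) (use M in \<open>simp add: nn_integral_eq_integral ennreal_leI\<close>)
    then show "?S < \<infinity>" by (rule order_le_less_trans) simp
  qed
  then show ?thesis unfolding hardy_pair_def hardy2_def boundary_function_def by blast
qed

lemma hardy_pairD:
  assumes "hardy_pair f g"
  shows "f holomorphic_on UHP" "g \<in> vcarrier (SQ lborel)"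
    "y > 0 \<Longrightarrow> (\<lambda>x. f (Complex x y)) \<in> vcarrier (SQ lborel)"
    "AE x in lborel. ((\<lambda>\<epsilon>. f (Complex x \<epsilon>)) \<longlongrightarrow> g x) (at_right 0)"
  using assms by (auto simp: hardy_pair_def)

lemma hardy_pair_bound:
  assumes "hardy_pair f g"
  obtains M where "\<And>y. y > 0 \<Longrightarrow> (LINT x|lborel. (cmod (f (Complex x y)))\<^sup>2) \<le> M" "M \<ge> 0"
proof -
  obtain M where M: "\<And>y. y > 0 \<Longrightarrow> (LINT x|lborel. (cmod (f (Complex x y)))\<^sup>2) \<le> M"
    using assms by (auto simp: hardy_pair_def)
  have "0 \<le> (LINT x|lborel. (cmod (f (Complex x 1)))\<^sup>2)" by (rule Bochner_Integration.integral_nonneg) simp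
  then have "M \<ge> 0" using M[of 1] by linarith
  then show ?thesis using that M by blast
qed

text \<open>The pointwise estimate |f r| \<le> |f|^2 + |r|^2 is enough here, since what counts is a
  bound uniform in y.\<close>

lemma hardy1_bound_mult:
  assumes f: "f holomorphic_on UHP" "\<And>y. y > 0 \<Longrightarrow> (\<lambda>x. f (Complex x y)) \<in> vcarrier (SQ lborel)"
      "\<And>y. y > 0 \<Longrightarrow> (LINT x|lborel. (cmod (f (Complex x y)))\<^sup>2) \<le> A"
    and r: "r holomorphic_on UHP" "\<And>y. y > 0 \<Longrightarrow> (\<lambda>x. r (Complex x y)) \<in> vcarrier (SQ lborel)"
      "\<And>y. y > 0 \<Longrightarrow> (LINT x|lborel. (cmod (r (Complex x y)))\<^sup>2) \<le> B"
  shows "hardy1_bound (\<lambda>z. f z * r z) (A + B)"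
  unfolding hardy1_bound_def
proof (intro conjI allI impI)
  show "(\<lambda>z. f z * r z) holomorphic_on UHP" by (intro holomorphic_intros f r)
  fix y :: real assume y: "y > 0"
  show i: "integrable lborel (\<lambda>x. f (Complex x y) * r (Complex x y))" by (rule SQ_mult_integrable[OF f(2)[OF y] r(2)[OF y]])
  have "(LINT x|lborel. cmod (f (Complex x y) * r (Complex x y))) \<le>
    (LINT x|lborel. (cmod (f (Complex x y)))\<^sup>2 + (cmod (r (Complex x y)))\<^sup>2)"
    using f(2)[OF y] r(2)[OF y] by (intro integral_mono integrable_norm i norm_mult_sq_le) (simp add: SQ_simps)
  also have "\<dots> = (LINT x|lborel. (cmod (f (Complex x y)))\<^sup>2) + (LINT x|lborel. (cmod (r (Complex x y)))\<^sup>2)"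
    using f(2)[OF y] r(2)[OF y] by (simp add: SQ_simps)
  finally show "(LINT x|lborel. cmod (f (Complex x y) * r (Complex x y))) \<le> A + B"
    using f(3)[OF y] r(3)[OF y] by linarith
qed

lemma hardy_pair_mult_hardy1:
  assumes "hardy_pair f1 g1" "hardy_pair f2 g2"
  obtains M where "hardy1_bound (\<lambda>z. f1 z * f2 z) M"
proof -
  obtain A where A: "\<And>y. y > 0 \<Longrightarrow> (LINT x|lborel. (cmod (f1 (Complex x y)))\<^sup>2) \<le> A" using hardy_pair_bound[OF assms(1)] by blast
  obtain B where B: "\<And>y. y > 0 \<Longrightarrow> (LINT x|lborel. (cmod (f2 (Complex x y)))\<^sup>2) \<le> B" using hardy_pair_bound[OF assms(2)] by blast
  have "hardy1_bound (\<lambda>z. f1 z * f2 z) (A + B)"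
    by (rule hardy1_bound_mult[OF hardy_pairD(1,3)[OF assms(1)] A hardy_pairD(1,3)[OF assms(2)] B])
  then show ?thesis by (rule that)
qed

section \<open>The Poisson kernel, weak limits and the Poisson formula\<close>

lemma
  fixes a y :: real
  assumes y: "y > 0"
  shows integrable_Poisson: "integrable lborel (\<lambda>x. y / ((x - a)\<^sup>2 + y\<^sup>2))"
    and integral_Poisson: "(LINT x|lborel. y / ((x - a)\<^sup>2 + y\<^sup>2)) = pi"
proof -
  have y0: "y \<noteq> 0" using y by simp
  have pos: "(x - a)\<^sup>2 + y\<^sup>2 > 0" for x using y by (simp add: add_nonneg_pos)
  have F: "DERIV (\<lambda>x. arctan ((x - a) / y)) x :> y / ((x - a)\<^sup>2 + y\<^sup>2)" for x
  proof -
    have "DERIV (\<lambda>x. arctan ((x - a) / y)) x :> inverse (1 + ((x - a) / y)\<^sup>2) * (1 / y)"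
      using y0 by (auto intro!: derivative_eq_intros)
    also have "inverse (1 + ((x - a) / y)\<^sup>2) * (1 / y) = y / ((x - a)\<^sup>2 + y\<^sup>2)"
    proof -
      have "1 + ((x - a) / y)\<^sup>2 = ((x - a)\<^sup>2 + y\<^sup>2) / y\<^sup>2"
        using y0 by (simp add: power_divide add_divide_distrib)
      then show ?thesis using y0 by (simp add: power2_eq_square)
    qed
    finally show ?thesis .
  qed
  have C: "isCont (\<lambda>x. y / ((x - a)\<^sup>2 + y\<^sup>2)) x" for x
    using pos[of x] by (intro continuous_intros) auto
  have A: "((\<lambda>x. arctan ((x - a) / y)) \<longlongrightarrow> - (pi / 2)) at_bot"
    and B: "((\<lambda>x. arctan ((x - a) / y)) \<longlongrightarrow> pi / 2) at_top"
    using y by real_asymp+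
  note FTC = interval_integral_FTC_nonneg[of "-\<infinity>" "\<infinity>", OF _ F C, unfolded ereal_tendsto_simps, OF _ _ A B]
  have "set_integrable lborel (einterval (-\<infinity>) \<infinity>) (\<lambda>x. y / ((x - a)\<^sup>2 + y\<^sup>2))"
    by (rule FTC(1)) (use y in auto)
  then show "integrable lborel (\<lambda>x. y / ((x - a)\<^sup>2 + y\<^sup>2))" by (simp add: set_integrable_def)
  have "(LBINT x=-\<infinity>..\<infinity>. y / ((x - a)\<^sup>2 + y\<^sup>2)) = pi / 2 - - (pi / 2)"
    by (rule FTC(2)) (use y in auto)
  then show "(LINT x|lborel. y / ((x - a)\<^sup>2 + y\<^sup>2)) = pi"
    by (simp add: interval_lebesgue_integral_def set_lebesgue_integral_def)
qed

lemma SQ_Cauchy_kernel: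
  assumes "Im z \<noteq> 0"
  shows "(\<lambda>x. 1 / (of_real x - z)) \<in> vcarrier (SQ lborel)"
proof -
  have eq: "(cmod (1 / (of_real x - z)))\<^sup>2 = \<bar>Im z\<bar> / ((x - Re z)\<^sup>2 + \<bar>Im z\<bar>\<^sup>2) / \<bar>Im z\<bar>" for x
    using assms by (simp add: norm_divide power_divide cmod_power2)
  have "integrable lborel (\<lambda>x. \<bar>Im z\<bar> / ((x - Re z)\<^sup>2 + \<bar>Im z\<bar>\<^sup>2) / \<bar>Im z\<bar>)"
    using assms by (intro Bochner_Integration.integrable_divide integrable_Poisson) auto
  then show ?thesis unfolding SQ_simps eq by simp
qed

text \<open>Bounded sequences that converge almost everywhere converge weakly; the estimate behind this is
  \<open>v Q \<le> min v (Q / d) * Q + d v\<^sup>2\<close>, whose first term is dominated by \<open>Q\<^sup>2 / d\<close>.\<close>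

lemma SQ_weak_convergence:
  assumes u: "\<And>n. u n \<in> vcarrier (SQ M)" "\<And>n. (LINT x|M. (cmod (u n x))\<^sup>2) \<le> B"
    and w: "w \<in> vcarrier (SQ M)" and lim: "AE x in M. (\<lambda>n. u n x) \<longlonglongrightarrow> w x"
    and q: "q \<in> vcarrier (SQ M)"
  shows "(\<lambda>n. LINT x|M. q x * u n x) \<longlonglongrightarrow> (LINT x|M. q x * w x)"
proof (rule LIM_zero_cancel, rule tendstoI)
  fix e :: real assume e: "e > 0"
  have [measurable]: "u n \<in> borel_measurable M" "w \<in> borel_measurable M" "q \<in> borel_measurable M" for n
    using u w q by (simp_all add: SQ_simps)
  define C where "C = 2 * B + 2 * (LINT x|M. (cmod (w x))\<^sup>2)"
  have iu: "integrable M (\<lambda>x. (cmod (u n x - w x))\<^sup>2)" for n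
    using SQ_diff[OF u(1) w] by (simp add: SQ_simps)
  have Cb: "(LINT x|M. (cmod (u n x - w x))\<^sup>2) \<le> C" for n
  proof -
    have "(LINT x|M. (cmod (u n x - w x))\<^sup>2) \<le> (LINT x|M. 2 * (cmod (u n x))\<^sup>2 + 2 * (cmod (w x))\<^sup>2)"
      by (rule integral_mono[OF iu]) (use u(1) w norm_add_sq_le[of "u n _" "- w _"] in \<open>auto simp: SQ_simps\<close>)
    also have "\<dots> = 2 * (LINT x|M. (cmod (u n x))\<^sup>2) + 2 * (LINT x|M. (cmod (w x))\<^sup>2)"
      using u(1) w by (simp add: SQ_simps)
    finally show ?thesis using u(2)[of n] by (simp add: C_def)
  qed
  have C0: "C \<ge> 0" 
  proof -
    have "0 \<le> (LINT x|M. (cmod (u 0 x - w x))\<^sup>2)" by simp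
    then show ?thesis using Cb[of 0] by linarith
  qed
  \<comment> \<open>\<open>C\<close> bounds all squared distances of \<open>u n\<close> from
    \<open>w\<close>. The splitting parameter d makes the part that does not tend to zero, at most d
    C, smaller than e / 2.\<close>
  define d where "d = e / (2 * (C + 1))"
  have d: "d > 0" "d * C < e / 2" using e C0 by (simp_all add: d_def field_simps add_pos_nonneg)
  define m where "m n x = min (cmod (u n x - w x)) (cmod (q x) / d) * cmod (q x)" for n x
  have m_bound: "\<bar>m n x\<bar> \<le> (cmod (q x))\<^sup>2 / d" for n x
  proof -
    have "m n x \<le> cmod (q x) / d * cmod (q x)" unfolding m_def by (intro mult_right_mono) auto
    moreover have "m n x \<ge> 0" using d by (simp add: m_def)
    ultimately show ?thesis by (simp add: power2_eq_square)
  qed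
  have iq: "integrable M (\<lambda>x. (cmod (q x))\<^sup>2 / d)" using q by (simp add: SQ_simps)
  have m_meas: "m n \<in> borel_measurable M" for n unfolding m_def by measurable
  have im: "integrable M (m n)" for n
    by (rule Bochner_Integration.integrable_bound[OF iq m_meas]) (use m_bound d in \<open>auto intro!: AE_I2\<close>)
  have "(\<lambda>n. integral\<^sup>L M (m n)) \<longlonglongrightarrow> (LINT x|M. 0)"
  proof (rule integral_dominated_convergence[OF _ m_meas iq])
    show "AE x in M. (\<lambda>n. m n x) \<longlonglongrightarrow> 0"
      using lim
    proof eventually_elim
      fix x assume l: "(\<lambda>n. u n x) \<longlonglongrightarrow> w x"
      have "(\<lambda>n. min (cmod (u n x - w x)) (cmod (q x) / d) * cmod (q x)) \<longlonglongrightarrow>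
        min (cmod (w x - w x)) (cmod (q x) / d) * cmod (q x)"
        by (intro tendsto_intros l)
      then show "(\<lambda>n. m n x) \<longlonglongrightarrow> 0" using d by (simp add: m_def)
    qed
  qed (use m_bound in auto)
  then have "\<forall>\<^sub>F n in sequentially. integral\<^sup>L M (m n) < e / 2"
    using e by (intro order_tendstoD(2)[where y = "integral\<^sup>L M (\<lambda>x. 0)"]) auto
  then show "\<forall>\<^sub>F n in sequentially. dist ((LINT x|M. q x * u n x) - (LINT x|M. q x * w x)) 0 < e"
  proof eventually_elim
    fix n assume small: "integral\<^sup>L M (m n) < e / 2"
    have "(LINT x|M. q x * u n x) - (LINT x|M. q x * w x) = (LINT x|M. q x * (u n x - w x))"
      using SQ_mult_integrable[OF q u(1)] SQ_mult_integrable[OF q w] by (simp add: right_diff_distrib)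
    also have "cmod \<dots> \<le> (LINT x|M. m n x + d * (cmod (u n x - w x))\<^sup>2)"
    proof (rule order_trans[OF integral_norm_bound integral_mono])
      show "integrable M (\<lambda>x. norm (q x * (u n x - w x)))"
        using SQ_mult_integrable[OF q SQ_diff[OF u(1) w]] by (rule integrable_norm)
      show "integrable M (\<lambda>x. m n x + d * (cmod (u n x - w x))\<^sup>2)" using im iu by simp
      fix x
      show "norm (q x * (u n x - w x)) \<le> m n x + d * (cmod (u n x - w x))\<^sup>2"
      proof (cases "cmod (u n x - w x) \<le> cmod (q x) / d")
        case True
        then show ?thesis using d by (simp add: m_def norm_mult mult.commute)
      next
        case False
        then have "cmod (q x) \<le> d * cmod (u n x - w x)" using d by (simp add: field_simps)
        then have "cmod (q x) * cmod (u n x - w x) \<le> d * cmod (u n x - w x) * cmod (u n x - w x)"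
          by (intro mult_right_mono) auto
        then show ?thesis using d by (simp add: m_def norm_mult power2_eq_square mult.assoc add_increasing)
      qed
    qed
    also have "\<dots> = integral\<^sup>L M (m n) + d * (LINT x|M. (cmod (u n x - w x))\<^sup>2)" using im iu by simp
    also have "\<dots> \<le> integral\<^sup>L M (m n) + d * C" using Cb d by (intro add_left_mono mult_left_mono) auto
    also have "\<dots> < e" using small d(2) by simp
    finally show "dist ((LINT x|M. q x * u n x) - (LINT x|M. q x * w x)) 0 < e" by simp
  qed
qed

lemma hardy_pair_tendsto:
  assumes "hardy_pair f g"
  shows "AE x in lborel. (\<lambda>n. f (Complex x (1 / real (Suc n)))) \<longlonglongrightarrow> g x"
  using hardy_pairD(4)[OF assms]
proof eventually_elim
  fix x assume l: "((\<lambda>\<epsilon>. f (Complex x \<epsilon>)) \<longlongrightarrow> g x) (at_right 0)"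
  have "filterlim (\<lambda>n. 1 / real (Suc n)) (at_right 0) sequentially"
    by (intro tendsto_imp_filterlim_at_right LIMSEQ_Suc[OF lim_1_over_n]) simp
  from filterlim_compose[OF l this] show "(\<lambda>n. f (Complex x (1 / real (Suc n)))) \<longlonglongrightarrow> g x" .
qed

lemma shift_up_tendsto:
  assumes "f holomorphic_on UHP" "Im z > 0"
  shows "(\<lambda>n. f (z + \<i> * of_real (1 / real (Suc n)))) \<longlonglongrightarrow> f z"
proof (rule isCont_tendsto_compose[where g = f])
  show "isCont f z" using assms continuous_on_eq_continuous_at[OF open_UHP] holomorphic_on_imp_continuous_on by blast
  have "(\<lambda>n. z + \<i> * of_real (1 / real (Suc n))) \<longlonglongrightarrow> z + \<i> * of_real 0"
    by (intro tendsto_intros LIMSEQ_Suc[OF lim_1_over_n])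
  then show "(\<lambda>n. z + \<i> * of_real (1 / real (Suc n))) \<longlonglongrightarrow> z" by simp
qed


lemma Cauchy_kernel_line_bound:
  assumes w: "Im w < 0" and y: "y > 0"
  shows "(\<lambda>x. 1 / (Complex x y - w)) \<in> vcarrier (SQ lborel)"
    and "(LINT x|lborel. (cmod (1 / (Complex x y - w)))\<^sup>2) \<le> pi / \<bar>Im w\<bar>"
proof -
  have eq: "Complex x y - w = of_real x - (w - \<i> * of_real y)" for x by (simp add: Complex_eq)
  show 1: "(\<lambda>x. 1 / (Complex x y - w)) \<in> vcarrier (SQ lborel)"
    unfolding eq by (rule SQ_Cauchy_kernel) (use w y in simp)
  have "(LINT x|lborel. (cmod (1 / (Complex x y - w)))\<^sup>2) \<le>
    (LINT x|lborel. \<bar>Im w\<bar> / ((x - Re w)\<^sup>2 + \<bar>Im w\<bar>\<^sup>2) / \<bar>Im w\<bar>)"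
  proof (rule integral_mono)
    show "integrable lborel (\<lambda>x. (cmod (1 / (Complex x y - w)))\<^sup>2)" using 1 by (simp add: SQ_simps)
    show "integrable lborel (\<lambda>x. \<bar>Im w\<bar> / ((x - Re w)\<^sup>2 + \<bar>Im w\<bar>\<^sup>2) / \<bar>Im w\<bar>)"
      using w by (intro Bochner_Integration.integrable_divide integrable_Poisson) simp
    fix x
    have "(Im w)\<^sup>2 \<le> (y - Im w)\<^sup>2" using w y by (intro power2_le_iff_abs_le[THEN iffD2]) auto
    moreover have "0 < (x - Re w)\<^sup>2 + (Im w)\<^sup>2" using w by (simp add: add_nonneg_pos)
    ultimately have "1 / ((x - Re w)\<^sup>2 + (y - Im w)\<^sup>2) \<le> 1 / ((x - Re w)\<^sup>2 + (Im w)\<^sup>2)"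
      by (intro divide_left_mono mult_pos_pos) auto
    then show "(cmod (1 / (Complex x y - w)))\<^sup>2 \<le> \<bar>Im w\<bar> / ((x - Re w)\<^sup>2 + \<bar>Im w\<bar>\<^sup>2) / \<bar>Im w\<bar>"
      using w by (simp add: norm_divide power_divide cmod_power2)
  qed
  also have "\<dots> = pi / \<bar>Im w\<bar>" 
    unfolding integral_divide_zero by (subst integral_Poisson) (use w in auto)
  finally show "(LINT x|lborel. (cmod (1 / (Complex x y - w)))\<^sup>2) \<le> pi / \<bar>Im w\<bar>" .
qed

text \<open>Cauchy's formula at z + i e is applied to f(u) / (u - w) with w = cnj z + i e, which
  lies in the lower half-plane because e < Im z. On the line at height e both shifts by i e cancel,
  so the two Cauchy kernels combine to the Poisson kernel of \<open>z\<close> divided by Im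
  z.\<close>

lemma hardy_pair_line_Poisson:
  fixes f :: "complex \<Rightarrow> complex"
  assumes p: "hardy_pair f g" and e: "e > 0" "e < Im z"
  shows "(LINT x|lborel. (1 / ((of_real x - z) * (of_real x - cnj z))) * f (Complex x e)) = pi * f (z + \<i> * of_real e) / Im z"
proof -
  obtain M where M: "\<And>y. y > 0 \<Longrightarrow> (LINT x|lborel. (cmod (f (Complex x y)))\<^sup>2) \<le> M" using hardy_pair_bound[OF p] by blast
  define w where "w = cnj z + \<i> * of_real e"
  have w: "Im w < 0" using e by (simp add: w_def)
  have V: "hardy1_bound (\<lambda>u. f u * (1 / (u - w))) (M + pi / \<bar>Im w\<bar>)"
  proof (rule hardy1_bound_mult[OF hardy_pairD(1,3)[OF p] M _ Cauchy_kernel_line_bound[OF w]])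
    show "(\<lambda>u. 1 / (u - w)) holomorphic_on UHP" using w by (intro holomorphic_intros) auto
  qed
  have "(LINT x|lborel. f (Complex x e) * (1 / (Complex x e - w)) / (Complex x e - (z + \<i> * of_real e))) =
    2 * pi * \<i> * (f (z + \<i> * of_real e) * (1 / (z + \<i> * of_real e - w)))"
    using hardy1_line_Cauchy[OF V e(1), of "z + \<i> * of_real e"] e by simp
  also have "(\<lambda>x. f (Complex x e) * (1 / (Complex x e - w)) / (Complex x e - (z + \<i> * of_real e))) =
    (\<lambda>x. (1 / ((of_real x - z) * (of_real x - cnj z))) * f (Complex x e))"
    by (simp add: fun_eq_iff Complex_eq w_def)
  also have "z + \<i> * of_real e - w = 2 * \<i> * of_real (Im z)" by (simp add: w_def complex_eq_iff)
  also have "2 * pi * \<i> * (f (z + \<i> * of_real e) * (1 / (2 * \<i> * of_real (Im z)))) = pi * f (z + \<i> * of_real e) / Im z"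
    using e by simp
  finally show ?thesis .
qed

text \<open>At this stage the traces on the lines at height 1 / (n + 1) are only known to be bounded
  in norm and to converge to \<open>g\<close> almost everywhere. Weak convergence is enough, because
  the Poisson kernel \<open>q\<close> is square-integrable.\<close>

lemma hardy_pair_Poisson:
  assumes p: "hardy_pair f g" and z: "Im z > 0"
  shows "f z = (LINT x|lborel. of_real (Im z / ((x - Re z)\<^sup>2 + (Im z)\<^sup>2)) * g x) / pi"
proof -
  obtain M where M: "\<And>y. y > 0 \<Longrightarrow> (LINT x|lborel. (cmod (f (Complex x y)))\<^sup>2) \<le> M" using hardy_pair_bound[OF p] by blast
  define q where "q x = 1 / ((of_real x - z) * (of_real x - cnj z))" for x :: real
  have qeq: "q x = of_real (1 / ((x - Re z)\<^sup>2 + (Im z)\<^sup>2))" for x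
  proof -
    have "(of_real x - z) * (of_real x - cnj z) = complex_of_real ((x - Re z)\<^sup>2 + (Im z)\<^sup>2)"
      by (simp add: complex_eq_iff power2_eq_square algebra_simps)
    then show ?thesis by (simp add: q_def)
  qed
  have "q \<in> vcarrier (SQ lborel)"
  proof -
    have "(\<lambda>x. 1 / (of_real x - z) * (1 / (of_real x - cnj z))) \<in> vcarrier (SQ lborel)"
    proof (rule SQ_mult_bounded[OF SQ_Cauchy_kernel])
      show "AE x in lborel. cmod (1 / (of_real x - cnj z)) \<le> 1 / Im z"
      proof (rule AE_I2)
        fix x
        have "Im z \<le> cmod (of_real x - cnj z)" using abs_Im_le_cmod[of "of_real x - cnj z"] z by simp
        then show "cmod (1 / (of_real x - cnj z)) \<le> 1 / Im z" using z by (simp add: norm_divide frac_le)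
      qed
    qed (use z in auto)
    then show ?thesis by (simp add: q_def[abs_def])
  qed
  then have lim: "(\<lambda>n. LINT x|lborel. q x * f (Complex x (1 / real (Suc n)))) \<longlonglongrightarrow> (LINT x|lborel. q x * g x)"
    by (intro SQ_weak_convergence[where B = M] hardy_pair_tendsto[OF p] hardy_pairD[OF p] M) simp_all
  have "\<forall>\<^sub>F n in sequentially. 1 / real (Suc n) < Im z"
    using LIMSEQ_Suc[OF lim_1_over_n] z by (rule order_tendstoD(2))
  then have "\<forall>\<^sub>F n in sequentially. (LINT x|lborel. q x * f (Complex x (1 / real (Suc n)))) =
    pi * f (z + \<i> * of_real (1 / real (Suc n))) / Im z"
    by eventually_elim (unfold q_def, rule hardy_pair_line_Poisson[OF p], simp_all)
  then have "(\<lambda>n. pi * f (z + \<i> * of_real (1 / real (Suc n))) / Im z) \<longlonglongrightarrow> (LINT x|lborel. q x * g x)"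
    by (rule Lim_transform_eventually[OF lim])
  moreover have "(\<lambda>n. pi * f (z + \<i> * of_real (1 / real (Suc n))) / Im z) \<longlonglongrightarrow> pi * f z / Im z"
    using z by (intro tendsto_intros shift_up_tendsto[OF hardy_pairD(1)[OF p] z]) auto
  ultimately have "pi * f z / Im z = (LINT x|lborel. q x * g x)" using LIMSEQ_unique by blast
  then have "f z = of_real (Im z) * (LINT x|lborel. q x * g x) / pi" using z by (simp add: field_simps)
  also have "of_real (Im z) * (LINT x|lborel. q x * g x) = (LINT x|lborel. of_real (Im z / ((x - Re z)\<^sup>2 + (Im z)\<^sup>2)) * g x)"
    unfolding integral_mult_right_zero[symmetric] by (intro Bochner_Integration.integral_cong) (simp_all add: qeq)
  finally show ?thesis .
qed

section \<open>Strong convergence to the boundary values\<close>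

text \<open>The Poisson kernel \<open>P a\<close> is a probability density, so Jensen's inequality
  bounds |f(a + i y)|^2 by the Poisson integral of |g|^2. Integration over \<open>a\<close> and
  Fubini conclude, because the kernel is symmetric in \<open>a\<close> and \<open>x\<close>.\<close>

lemma hardy_pair_norm_le:
  assumes p: "hardy_pair f g" and y: "y > 0"
  shows "(LINT x|lborel. (cmod (f (Complex x y)))\<^sup>2) \<le> (LINT x|lborel. (cmod (g x))\<^sup>2)"
proof -
  define P where "P a x = y / ((x - a)\<^sup>2 + y\<^sup>2) / pi" for a x :: real
  have P0: "P a x \<ge> 0" for a x using y by (simp add: P_def)
  have P_meas [measurable]: "(\<lambda>(a, x). P a x) \<in> borel_measurable (borel \<Otimes>\<^sub>M borel)" unfolding P_def by measurable
  have iP: "integrable lborel (P a)" and IP: "integral\<^sup>L lborel (P a) = 1" for a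
    unfolding P_def integral_divide_zero integral_Poisson[OF y]
    by (intro Bochner_Integration.integrable_divide integrable_Poisson y) simp
  have IP': "(\<integral>\<^sup>+a. ennreal (P a x) \<partial>lborel) = 1" for x
  proof -
    have "(\<integral>\<^sup>+a. ennreal (P a x) \<partial>lborel) = (\<integral>\<^sup>+a. ennreal (P x a) \<partial>lborel)"
      by (simp add: P_def power2_commute)
    also have "\<dots> = 1" using nn_integral_eq_integral[OF iP] P0 IP by simp
    finally show ?thesis .
  qed
  have g: "g \<in> vcarrier (SQ lborel)" by (rule hardy_pairD[OF p])
  have [measurable]: "g \<in> borel_measurable borel" using g by (simp add: SQ_simps)
  have ig2: "integrable lborel (\<lambda>x. (cmod (g x))\<^sup>2)" using g by (simp add: SQ_simps)
  have Pb: "P a x \<le> 1 / (y * pi)" for a x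
  proof -
    have "y / ((x - a)\<^sup>2 + y\<^sup>2) \<le> y / y\<^sup>2" using y by (intro divide_left_mono mult_pos_pos) (auto simp: add_nonneg_pos)
    then have "P a x \<le> y / y\<^sup>2 / pi" unfolding P_def by (rule divide_right_mono) simp
    then show ?thesis using y by (simp add: power2_eq_square)
  qed
  have iPg2: "integrable lborel (\<lambda>x. P a x * (cmod (g x))\<^sup>2)" for a
  proof (rule Bochner_Integration.integrable_bound[of _ "\<lambda>x. 1 / (y * pi) * (cmod (g x))\<^sup>2"])
    show "AE x in lborel. norm (P a x * (cmod (g x))\<^sup>2) \<le> norm (1 / (y * pi) * (cmod (g x))\<^sup>2)"
      unfolding norm_mult using P0 Pb y by (intro AE_I2 mult_right_mono) auto
    show "(\<lambda>x. P a x * (cmod (g x))\<^sup>2) \<in> borel_measurable lborel" unfolding P_def by measurable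
  qed (use ig2 in simp)
  have iPg: "integrable lborel (\<lambda>x. P a x * cmod (g x))" for a
  proof (rule Bochner_Integration.integrable_bound[of _ "\<lambda>x. P a x + P a x * (cmod (g x))\<^sup>2"])
    show "integrable lborel (\<lambda>x. P a x + P a x * (cmod (g x))\<^sup>2)" using iP iPg2 by simp
    show "(\<lambda>x. P a x * cmod (g x)) \<in> borel_measurable lborel" unfolding P_def by measurable
    show "AE x in lborel. norm (P a x * cmod (g x)) \<le> norm (P a x + P a x * (cmod (g x))\<^sup>2)"
    proof (rule AE_I2)
      fix x
      have "2 * cmod (g x) \<le> 1 + (cmod (g x))\<^sup>2" using sum_squares_bound[of 1 "cmod (g x)"] by simp
      then have "cmod (g x) \<le> 1 + (cmod (g x))\<^sup>2" using norm_ge_zero[of "g x"] by linarith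
      then have "P a x * cmod (g x) \<le> P a x * (1 + (cmod (g x))\<^sup>2)" using P0 by (rule mult_left_mono)
      then show "norm (P a x * cmod (g x)) \<le> norm (P a x + P a x * (cmod (g x))\<^sup>2)"
        using P0[of a x] by (simp add: distrib_left)
    qed
  qed
  have pt: "(cmod (f (Complex a y)))\<^sup>2 \<le> (LINT x|lborel. P a x * (cmod (g x))\<^sup>2)" for a
  proof -
    define c where "c = (LINT x|lborel. P a x * cmod (g x))"
    have "f (Complex a y) = (LINT x|lborel. of_real (P a x) * g x)"
      using hardy_pair_Poisson[OF p, of "Complex a y"] y
      by (simp add: P_def flip: integral_divide_zero)
    then have "cmod (f (Complex a y)) \<le> (LINT x|lborel. norm (of_real (P a x) * g x))" by simp
    also have "\<dots> = c" using P0 by (simp add: c_def norm_mult)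
    finally have 1: "cmod (f (Complex a y)) \<le> c" .
    \<comment> \<open>Jensen's inequality for the square as nonnegativity of a variance: c is the
      mean of |g| under \<open>P a\<close>, and expanding the square gives c^2 \<le> mean of
      |g|^2.\<close>
    have "0 \<le> (LINT x|lborel. P a x * (cmod (g x) - c)\<^sup>2)"
      using P0 by (intro Bochner_Integration.integral_nonneg) simp
    also have "(\<lambda>x. P a x * (cmod (g x) - c)\<^sup>2) = (\<lambda>x. P a x * (cmod (g x))\<^sup>2 - 2 * c * (P a x * cmod (g x)) + c\<^sup>2 * P a x)"
      by (simp add: fun_eq_iff power2_eq_square algebra_simps)
    also have "(LINT x|lborel. P a x * (cmod (g x))\<^sup>2 - 2 * c * (P a x * cmod (g x)) + c\<^sup>2 * P a x) =
      (LINT x|lborel. P a x * (cmod (g x))\<^sup>2) - 2 * c * c + c\<^sup>2 * 1"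
      using iP iPg iPg2 IP by (simp add: c_def)
    finally have "c\<^sup>2 \<le> (LINT x|lborel. P a x * (cmod (g x))\<^sup>2)" by (simp add: power2_eq_square)
    then show ?thesis using 1 power_mono[OF 1 norm_ge_zero, of 2] by linarith
  qed
  have [measurable]: "(\<lambda>x. f (Complex x y)) \<in> borel_measurable borel" by (rule measurable_hline[OF hardy_pairD(1)[OF p] y])
  have "(\<integral>\<^sup>+a. ennreal ((cmod (f (Complex a y)))\<^sup>2) \<partial>lborel) \<le> (\<integral>\<^sup>+a. (\<integral>\<^sup>+x. ennreal (P a x * (cmod (g x))\<^sup>2) \<partial>lborel) \<partial>lborel)"
    using P0 pt by (intro nn_integral_mono) (simp add: nn_integral_eq_integral iPg2 ennreal_leI)
  also have "\<dots> = (\<integral>\<^sup>+x. (\<integral>\<^sup>+a. ennreal (P a x * (cmod (g x))\<^sup>2) \<partial>lborel) \<partial>lborel)"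
    by (rule lborel_pair.Fubini') (unfold P_def, measurable)
  also have "\<dots> = (\<integral>\<^sup>+x. ennreal ((cmod (g x))\<^sup>2) \<partial>lborel)"
  proof (rule nn_integral_cong)
    fix x
    have "(\<integral>\<^sup>+a. ennreal (P a x * (cmod (g x))\<^sup>2) \<partial>lborel) = (\<integral>\<^sup>+a. ennreal (P a x) * ennreal ((cmod (g x))\<^sup>2) \<partial>lborel)"
      using P0 by (simp add: ennreal_mult)
    also have "\<dots> = ennreal ((cmod (g x))\<^sup>2)"
    proof (subst nn_integral_multc)
      show "(\<lambda>a. ennreal (P a x)) \<in> borel_measurable lborel" unfolding P_def by measurable
    qed (simp add: IP')
    finally show "(\<integral>\<^sup>+a. ennreal (P a x * (cmod (g x))\<^sup>2) \<partial>lborel) = ennreal ((cmod (g x))\<^sup>2)" .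
  qed
  finally have "(\<integral>\<^sup>+a. ennreal ((cmod (f (Complex a y)))\<^sup>2) \<partial>lborel) \<le> (\<integral>\<^sup>+x. ennreal ((cmod (g x))\<^sup>2) \<partial>lborel)" .
  then show ?thesis
    using hardy_pairD(3)[OF p y] ig2 by (simp add: SQ_simps nn_integral_eq_integral)
qed

text \<open>Weak convergence together with norms that do not exceed the norm of the limit is strong
  convergence: the squared distance is at most twice the real part of the inner product of g with g
  - u n.\<close>

lemma hardy_pair_norm_convergence:
  assumes p: "hardy_pair f g"
  shows "(\<lambda>n. vnorm (SQ lborel) (vdiff (SQ lborel) (\<lambda>x. f (Complex x (1 / real (Suc n)))) g)) \<longlonglongrightarrow> 0"
proof -
  interpret S: semi_ip "SQ lborel :: (real \<Rightarrow> complex) ip_space" by (rule semi_ip_SQ)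
  define u where "u n = (\<lambda>x. f (Complex x (1 / real (Suc n))))" for n
  have u: "u n \<in> vcarrier (SQ lborel)" for n unfolding u_def by (rule hardy_pairD[OF p]) simp
  have g: "g \<in> vcarrier (SQ lborel)" by (rule hardy_pairD[OF p])
  have ub: "(LINT x|lborel. (cmod (u n x))\<^sup>2) \<le> (LINT x|lborel. (cmod (g x))\<^sup>2)" for n
    unfolding u_def by (rule hardy_pair_norm_le[OF p]) simp
  have ubn: "(vnorm (SQ lborel) (u n))\<^sup>2 \<le> (vnorm (SQ lborel) g)\<^sup>2" for n
    using ub[of n] u g by (simp add: SQ_norm)
  have expand: "a - b - (c - d) = a + d - (b + c)" for a b c d :: complex by simp
  have lim0: "AE x in lborel. (\<lambda>n. u n x) \<longlonglongrightarrow> g x"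
    using hardy_pair_tendsto[OF p] by (simp add: u_def)
  have lim: "(\<lambda>n. vinner (SQ lborel) g (u n)) \<longlonglongrightarrow> vinner (SQ lborel) g g"
    unfolding SQ_simps using SQ_weak_convergence[OF u ub g lim0 SQ_cnj[OF g]] .
  have le: "(vnorm (SQ lborel) (vdiff (SQ lborel) (u n) g))\<^sup>2 \<le>
    2 * (Re (vinner (SQ lborel) g g) - Re (vinner (SQ lborel) g (u n)))" for n
  proof -
    have "of_real ((vnorm (SQ lborel) (vdiff (SQ lborel) (u n) g))\<^sup>2) =
      vinner (SQ lborel) (u n) (u n) + vinner (SQ lborel) g g - (vinner (SQ lborel) g (u n) + cnj (vinner (SQ lborel) g (u n)))"
      unfolding S.inner_self[OF S.diff_closed[OF u g], symmetric] S.inner_cnj[OF g u, symmetric]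
        S.inner_diff[OF S.diff_closed[OF u g] u g] S.inner_diff_left[OF u u g] S.inner_diff_left[OF g u g]
      by (rule expand)
    also have "\<dots> = of_real ((vnorm (SQ lborel) (u n))\<^sup>2 + (vnorm (SQ lborel) g)\<^sup>2 - 2 * Re (vinner (SQ lborel) g (u n)))"
      unfolding S.inner_self[OF u] S.inner_self[OF g] complex_add_cnj by simp
    finally have "(vnorm (SQ lborel) (vdiff (SQ lborel) (u n) g))\<^sup>2 =
      (vnorm (SQ lborel) (u n))\<^sup>2 + (vnorm (SQ lborel) g)\<^sup>2 - 2 * Re (vinner (SQ lborel) g (u n))"
      using of_real_eq_iff by blast
    moreover have "Re (vinner (SQ lborel) g g) = (vnorm (SQ lborel) g)\<^sup>2" using S.inner_self[OF g] by simp
    ultimately show ?thesis using ubn[of n] by simp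
  qed
  have "(\<lambda>n. 2 * (Re (vinner (SQ lborel) g g) - Re (vinner (SQ lborel) g (u n)))) \<longlonglongrightarrow>
    2 * (Re (vinner (SQ lborel) g g) - Re (vinner (SQ lborel) g g))"
    by (intro tendsto_intros lim)
  then have lim2: "(\<lambda>n. 2 * (Re (vinner (SQ lborel) g g) - Re (vinner (SQ lborel) g (u n)))) \<longlonglongrightarrow> 0"
    by (simp only: diff_self mult_zero_right)
  have "(\<lambda>n. (vnorm (SQ lborel) (vdiff (SQ lborel) (u n) g))\<^sup>2) \<longlonglongrightarrow> 0"
    by (rule tendsto_sandwich[OF _ _ tendsto_const lim2]; intro always_eventually allI; rule le zero_le_power2)
  then have "(\<lambda>n. sqrt ((vnorm (SQ lborel) (vdiff (SQ lborel) (u n) g))\<^sup>2)) \<longlonglongrightarrow> sqrt 0"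
    by (rule tendsto_real_sqrt)
  then show ?thesis unfolding u_def[symmetric] using S.norm_nonneg[OF S.diff_closed[OF u g]] by simp
qed

text \<open>Both factors vary with n, so weak convergence would not be enough. The bounded weight
  \<open>k\<close> is 1 for Cauchy's theorem and 1 / (x - z) for Cauchy's formula.\<close>

lemma hardy_pair_product_convergence:
  assumes p: "hardy_pair f1 g1" "hardy_pair f2 g2" and k: "k \<in> borel_measurable borel" "\<And>x. cmod (k x) \<le> B"
  shows "(\<lambda>n. LINT x|lborel. f1 (Complex x (1 / real (Suc n))) * (f2 (Complex x (1 / real (Suc n))) * k x)) \<longlonglongrightarrow>
    (LINT x|lborel. g1 x * (g2 x * k x))"
proof -
  interpret S: semi_ip "SQ lborel :: (real \<Rightarrow> complex) ip_space" by (rule semi_ip_SQ)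
  define y where "y n = 1 / real (Suc n)" for n
  have y: "y n > 0" for n by (simp add: y_def)
  note c1 = hardy_pairD(3)[OF p(1) y] and c2 = hardy_pairD(3)[OF p(2) y]
  note g1 = hardy_pairD(2)[OF p(1)] and g2 = hardy_pairD(2)[OF p(2)]
  have k': "k \<in> borel_measurable lborel" "AE x in lborel. cmod (k x) \<le> B" using k by auto
  have B0: "B \<ge> 0" using k(2)[of 0] norm_ge_zero[of "k 0"] by linarith
  have lim1: "(\<lambda>n. vnorm (SQ lborel) (vdiff (SQ lborel) (\<lambda>x. cnj (f1 (Complex x (y n)))) (\<lambda>x. cnj (g1 x)))) \<longlonglongrightarrow> 0"
  proof -
    have "vnorm (SQ lborel) (vdiff (SQ lborel) (\<lambda>x. cnj (f1 (Complex x (y n)))) (\<lambda>x. cnj (g1 x))) =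
      vnorm (SQ lborel) (vdiff (SQ lborel) (\<lambda>x. f1 (Complex x (y n))) g1)" for n
      unfolding SQ_simps using SQ_diff[OF c1 g1, of n] SQ_cnj[OF SQ_diff[OF c1 g1, of n]]
      by (simp add: SQ_norm flip: complex_cnj_diff)
    then show ?thesis using hardy_pair_norm_convergence[OF p(1)] by (simp add: y_def)
  qed
  have lim2: "(\<lambda>n. vnorm (SQ lborel) (vdiff (SQ lborel) (\<lambda>x. f2 (Complex x (y n)) * k x) (\<lambda>x. g2 x * k x))) \<longlonglongrightarrow> 0"
  proof (rule tendsto_sandwich[OF _ _ tendsto_const])
    have "(\<lambda>n. B * vnorm (SQ lborel) (vdiff (SQ lborel) (\<lambda>x. f2 (Complex x (y n))) g2)) \<longlonglongrightarrow> B * 0"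
      unfolding y_def by (intro tendsto_mult tendsto_const hardy_pair_norm_convergence[OF p(2)])
    then show "(\<lambda>n. B * vnorm (SQ lborel) (vdiff (SQ lborel) (\<lambda>x. f2 (Complex x (y n))) g2)) \<longlonglongrightarrow> 0" by simp
    show "\<forall>\<^sub>F n in sequentially. 0 \<le> vnorm (SQ lborel) (vdiff (SQ lborel) (\<lambda>x. f2 (Complex x (y n)) * k x) (\<lambda>x. g2 x * k x))"
      by (intro always_eventually allI S.norm_nonneg S.diff_closed SQ_mult_bounded[OF c2 k'] SQ_mult_bounded[OF g2 k'])
    show "\<forall>\<^sub>F n in sequentially. vnorm (SQ lborel) (vdiff (SQ lborel) (\<lambda>x. f2 (Complex x (y n)) * k x) (\<lambda>x. g2 x * k x))
      \<le> B * vnorm (SQ lborel) (vdiff (SQ lborel) (\<lambda>x. f2 (Complex x (y n))) g2)"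
    proof (intro always_eventually allI)
      fix n
      let ?d = "\<lambda>x. f2 (Complex x (y n)) - g2 x"
      have d: "?d \<in> vcarrier (SQ lborel)" by (rule SQ_diff[OF c2 g2])
      have dk: "(\<lambda>x. ?d x * k x) \<in> vcarrier (SQ lborel)" by (rule SQ_mult_bounded[OF d k'])
      have "(LINT x|lborel. (cmod (?d x * k x))\<^sup>2) \<le> (LINT x|lborel. B\<^sup>2 * (cmod (?d x))\<^sup>2)"
      proof (rule integral_mono)
        show "integrable lborel (\<lambda>x. (cmod (?d x * k x))\<^sup>2)" using dk by (simp add: SQ_simps)
        show "integrable lborel (\<lambda>x. B\<^sup>2 * (cmod (?d x))\<^sup>2)" using d by (simp add: SQ_simps)
        show "(cmod (?d x * k x))\<^sup>2 \<le> B\<^sup>2 * (cmod (?d x))\<^sup>2" for x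
          unfolding norm_mult power_mult_distrib
          by (subst mult.commute) (intro mult_right_mono power_mono k, auto)
      qed
      also have "\<dots> = B\<^sup>2 * (LINT x|lborel. (cmod (?d x))\<^sup>2)" by (rule integral_mult_right_zero)
      finally have "sqrt (LINT x|lborel. (cmod (?d x * k x))\<^sup>2) \<le> sqrt (B\<^sup>2 * (LINT x|lborel. (cmod (?d x))\<^sup>2))" by simp
      also have "\<dots> = B * sqrt (LINT x|lborel. (cmod (?d x))\<^sup>2)" using B0 by (simp add: real_sqrt_mult)
      finally show "vnorm (SQ lborel) (vdiff (SQ lborel) (\<lambda>x. f2 (Complex x (y n)) * k x) (\<lambda>x. g2 x * k x))
      \<le> B * vnorm (SQ lborel) (vdiff (SQ lborel) (\<lambda>x. f2 (Complex x (y n))) g2)"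
        unfolding SQ_simps using SQ_norm[OF d] SQ_norm[OF dk] by (simp add: left_diff_distrib)
    qed
  qed
  have "(\<lambda>n. vinner (SQ lborel) (\<lambda>x. cnj (f1 (Complex x (y n)))) (\<lambda>x. f2 (Complex x (y n)) * k x)) \<longlonglongrightarrow>
    vinner (SQ lborel) (\<lambda>x. cnj (g1 x)) (\<lambda>x. g2 x * k x)"
    by (intro S.inner_tendsto lim1 lim2 SQ_cnj c1 g1 SQ_mult_bounded[OF c2 k'] SQ_mult_bounded[OF g2 k'])
  then show ?thesis by (simp add: SQ_simps y_def)
qed

section \<open>Cauchy's theorem and formula for boundary values of products\<close>

lemma hardy_pair_integral_zero:
  assumes p: "hardy_pair f1 g1" "hardy_pair f2 g2"
  shows "(LINT x|lborel. g1 x * g2 x) = 0"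
proof -
  obtain M where M: "hardy1_bound (\<lambda>z. f1 z * f2 z) M" using hardy_pair_mult_hardy1[OF p] .
  have "(LINT x|lborel. f1 (Complex x (1 / real (Suc n))) * (f2 (Complex x (1 / real (Suc n))) * 1)) = 0" for n
    using hardy1_line_integral_zero[OF M, of "1 / real (Suc n)"] by simp
  then show ?thesis using hardy_pair_product_convergence[OF p, of "\<lambda>x. 1" 1] by (simp add: LIMSEQ_const_iff)
qed

lemma hardy_pair_Cauchy_formula:
  assumes p: "hardy_pair f1 g1" "hardy_pair f2 g2" and z: "Im z > 0"
  shows "(LINT x|lborel. g1 x * g2 x / (of_real x - z)) = 2 * pi * \<i> * f1 z * f2 z"
proof -
  obtain M where M: "hardy1_bound (\<lambda>z. f1 z * f2 z) M" using hardy_pair_mult_hardy1[OF p] .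
  have eq: "(LINT x|lborel. f1 (Complex x e) * (f2 (Complex x e) * (1 / (of_real x - z)))) =
    2 * pi * \<i> * (f1 (z + \<i> * of_real e) * f2 (z + \<i> * of_real e))" if e: "e > 0" for e
    using hardy1_line_Cauchy[OF M e, of "z + \<i> * of_real e"] e z by (simp add: Complex_eq)
  have "(\<lambda>n. LINT x|lborel. f1 (Complex x (1 / real (Suc n))) * (f2 (Complex x (1 / real (Suc n))) * (1 / (of_real x - z)))) \<longlonglongrightarrow>
    (LINT x|lborel. g1 x * (g2 x * (1 / (of_real x - z))))"
  proof (rule hardy_pair_product_convergence[OF p])
    show "cmod (1 / (of_real x - z)) \<le> 1 / Im z" for x
    proof -
      have "Im z \<le> cmod (of_real x - z)" using abs_Im_le_cmod[of "of_real x - z"] z by simp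
      then show ?thesis using z by (simp add: norm_divide frac_le)
    qed
  qed measurable
  moreover have "(\<lambda>n. 2 * pi * \<i> * (f1 (z + \<i> * of_real (1 / real (Suc n))) * f2 (z + \<i> * of_real (1 / real (Suc n))))) \<longlonglongrightarrow>
    2 * pi * \<i> * (f1 z * f2 z)"
    by (intro tendsto_intros shift_up_tendsto hardy_pairD(1)[OF p(1)] hardy_pairD(1)[OF p(2)] z)
  ultimately have "(LINT x|lborel. g1 x * (g2 x * (1 / (of_real x - z)))) = 2 * pi * \<i> * (f1 z * f2 z)"
    using eq LIMSEQ_unique by (simp add: LIMSEQ_unique)
  then show ?thesis by (simp add: mult.assoc)
qed

text \<open>This is the means of producing new Hardy functions below, notably by dividing by the
  outer function. The bound on the boundary factor \<open>c\<close> is inherited from the bound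
  inside by taking the limit.\<close>

lemma hardy_pair_mult_bounded:
  assumes p: "hardy_pair f g" and hol: "b holomorphic_on UHP" and B: "\<And>z. Im z > 0 \<Longrightarrow> cmod (b z) \<le> B"
    and c: "c \<in> borel_measurable borel" "AE x in lborel. ((\<lambda>\<epsilon>. b (Complex x \<epsilon>)) \<longlongrightarrow> c x) (at_right 0)"
  shows "hardy_pair (\<lambda>z. f z * b z) (\<lambda>x. g x * c x)"
  unfolding hardy_pair_def
proof (intro conjI)
  obtain M where M: "\<And>y. y > 0 \<Longrightarrow> (LINT x|lborel. (cmod (f (Complex x y)))\<^sup>2) \<le> M" using hardy_pair_bound[OF p] by blast
  show "(\<lambda>z. f z * b z) holomorphic_on UHP" by (intro holomorphic_intros hol hardy_pairD[OF p])
  have c1: "(\<lambda>x. f (Complex x y) * b (Complex x y)) \<in> vcarrier (SQ lborel)" if "y > 0" for y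
    by (rule SQ_mult_bounded[where B = B, OF hardy_pairD(3)[OF p that]]) (use B that measurable_hline[OF hol that] in auto)
  have "(LINT x|lborel. (cmod (f (Complex x y) * b (Complex x y)))\<^sup>2) \<le> M * B\<^sup>2" if y: "y > 0" for y
  proof -
    have "(LINT x|lborel. (cmod (f (Complex x y) * b (Complex x y)))\<^sup>2) \<le> (LINT x|lborel. (cmod (f (Complex x y)))\<^sup>2 * B\<^sup>2)"
    proof (rule integral_mono)
      show "integrable lborel (\<lambda>x. (cmod (f (Complex x y) * b (Complex x y)))\<^sup>2)" using c1[OF y] by (simp add: SQ_simps)
      show "integrable lborel (\<lambda>x. (cmod (f (Complex x y)))\<^sup>2 * B\<^sup>2)" using hardy_pairD(3)[OF p y] by (simp add: SQ_simps)
      show "(cmod (f (Complex x y) * b (Complex x y)))\<^sup>2 \<le> (cmod (f (Complex x y)))\<^sup>2 * B\<^sup>2" for x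
        unfolding norm_mult power_mult_distrib using y by (intro mult_left_mono power_mono B) auto
    qed
    also have "\<dots> = (LINT x|lborel. (cmod (f (Complex x y)))\<^sup>2) * B\<^sup>2" by (rule integral_mult_left_zero)
    also have "\<dots> \<le> M * B\<^sup>2" by (intro mult_right_mono M y) simp
    finally show ?thesis .
  qed
  with c1 show "\<exists>M. \<forall>y>0. (\<lambda>x. f (Complex x y) * b (Complex x y)) \<in> vcarrier (SQ lborel) \<and>
      (LINT x|lborel. (cmod (f (Complex x y) * b (Complex x y)))\<^sup>2) \<le> M" by blast
  have "AE x in lborel. cmod (c x) \<le> B" using c(2)
  proof eventually_elim
    fix x assume "((\<lambda>\<epsilon>. b (Complex x \<epsilon>)) \<longlongrightarrow> c x) (at_right 0)"
    then have "((\<lambda>\<epsilon>. cmod (b (Complex x \<epsilon>))) \<longlongrightarrow> cmod (c x)) (at_right 0)" by (rule tendsto_norm)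
    then show "cmod (c x) \<le> B"
    proof (rule tendsto_upperbound)
      show "\<forall>\<^sub>F \<epsilon> in at_right 0. cmod (b (Complex x \<epsilon>)) \<le> B"
        using eventually_at_right_less[of "0::real"] by eventually_elim (simp add: B)
    qed simp
  qed
  then show "(\<lambda>x. g x * c x) \<in> vcarrier (SQ lborel)"
    using SQ_mult_bounded[OF hardy_pairD(2)[OF p]] c(1) by simp
  show "AE x in lborel. ((\<lambda>\<epsilon>. f (Complex x \<epsilon>) * b (Complex x \<epsilon>)) \<longlongrightarrow> g x * c x) (at_right 0)"
    using hardy_pairD(4)[OF p] c(2) by eventually_elim (rule tendsto_mult)
qed

section \<open>The outer function\<close>

text \<open>For a \<ge> b put s = sqrt a, t = sqrt b; then ln a - ln b = 2 ln (s / t) \<le> 2 (s -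
  t) / t, which is enlarged to 2 (s - t) (s + t) / (s t). The factor |a - b| will cancel the
  singularity of the Cauchy kernel, and the denominator leaves only an integrable inverse square
  root at the origin.\<close>

lemma abs_ln_diff_le:
  fixes a b :: real
  assumes a: "a > 0" and b: "b > 0"
  shows "\<bar>ln a - ln b\<bar> \<le> 2 * \<bar>a - b\<bar> / sqrt (a * b)"
proof -
  have *: "ln a - ln b \<le> 2 * (a - b) / sqrt (a * b)" if ab: "a > 0" "b > 0" "a \<ge> b" for a b :: real
  proof -
    define s t where "s = sqrt a" and "t = sqrt b"
    have st: "s > 0" "t > 0" "s \<ge> t" "a = s * s" "b = t * t" using ab by (simp_all add: s_def t_def)
    have "ln a - ln b = 2 * ln (s / t)" using st by (simp add: ln_mult ln_div)
    also have "\<dots> \<le> 2 * (s / t - 1)" using st by (intro mult_left_mono ln_le_minus_one) auto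
    also have "\<dots> = 2 * ((s - t) * s / (s * t))" using st by (simp add: field_simps)
    also have "\<dots> \<le> 2 * ((s - t) * (s + t) / (s * t))"
      using st by (intro mult_left_mono divide_right_mono) auto
    also have "\<dots> = 2 * (a - b) / sqrt (a * b)"
      using st by (simp add: real_sqrt_mult algebra_simps)
    finally show ?thesis .
  qed
  show ?thesis
  proof (cases "a \<ge> b")
    case True
    then have "ln a \<ge> ln b" using a b by simp
    then show ?thesis using *[OF a b True] True by simp
  next
    case False
    then have "ln b \<ge> ln a" using a b by simp
    then show ?thesis using *[OF b a] False by (simp add: mult.commute)
  qed
qed

text \<open>On the positive axis this is the derivative of 2 arctan (sqrt p). It is the common
  majorant of the integrals that define the outer function, its derivative and its boundary values:
  an inverse square root at 0 and the decay |p|^(-3/2) at infinity.\<close>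

definition root_weight :: "real \<Rightarrow> real" where
  "root_weight p = 1 / (sqrt \<bar>p\<bar> * (1 + \<bar>p\<bar>))"

lemma root_weight_integrable: "integrable lborel root_weight"
proof -
  have F: "DERIV (\<lambda>p. 2 * arctan (sqrt p)) p :> root_weight p" if "0 < p" for p
  proof -
    have "DERIV (\<lambda>p. 2 * arctan (sqrt p)) p :> 2 * (inverse (1 + (sqrt p)\<^sup>2) * (inverse (sqrt p) / 2))"
      using that by (auto intro!: derivative_eq_intros)
    also have "2 * (inverse (1 + (sqrt p)\<^sup>2) * (inverse (sqrt p) / 2)) = root_weight p"
    proof -
      have sq: "(sqrt p)\<^sup>2 = p" using that by simp
      have "2 * (a * (b / 2)) = a * b" for a b :: real by simp
      then have "2 * (inverse (1 + (sqrt p)\<^sup>2) * (inverse (sqrt p) / 2)) = inverse (1 + p) * inverse (sqrt p)"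
        by (simp only: sq)
      also have "\<dots> = root_weight p"
        using that by (simp add: root_weight_def inverse_eq_divide mult.commute)
      finally show ?thesis .
    qed
    finally show ?thesis .
  qed
  have C: "isCont root_weight p" if "0 < p" for p
    unfolding root_weight_def using that by (intro continuous_intros) auto
  have A: "((\<lambda>p. 2 * arctan (sqrt p)) \<longlongrightarrow> 0) (at_right 0)" by real_asymp
  have B: "((\<lambda>p. 2 * arctan (sqrt p)) \<longlongrightarrow> pi) at_top" by real_asymp
  have "set_integrable lborel (einterval 0 \<infinity>) root_weight"
  proof (rule interval_integral_FTC_nonneg(1)[where F = "\<lambda>p. 2 * arctan (sqrt p)" and A = 0 and B = pi])
    show "DERIV (\<lambda>p. 2 * arctan (sqrt p)) x :> root_weight x" if "0 < ereal x" for x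
      using that by (intro F) simp
    show "isCont root_weight x" if "0 < ereal x" for x
      using that by (intro C) simp
    show "AE x in lborel. 0 < ereal x \<longrightarrow> ereal x < \<infinity> \<longrightarrow> 0 \<le> root_weight x"
      by (simp add: root_weight_def)
    show "(((\<lambda>p. 2 * arctan (sqrt p)) \<circ> real_of_ereal) \<longlongrightarrow> 0) (at_right 0)"
      using A by (simp add: zero_ereal_def ereal_tendsto_simps)
    show "(((\<lambda>p. 2 * arctan (sqrt p)) \<circ> real_of_ereal) \<longlongrightarrow> pi) (at_left \<infinity>)"
      using B by (simp add: ereal_tendsto_simps)
  qed simp
  then have i: "integrable lborel (\<lambda>p. indicator {0<..} p * root_weight p)"
    by (simp add: set_integrable_def zero_ereal_def)
  have "integrable lborel (\<lambda>p. indicator {0<..} (0 + - 1 * p) * root_weight (0 + - 1 * p))"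
    by (rule lborel_integrable_real_affine[OF i]) simp
  with i have "integrable lborel (\<lambda>p. indicator {0<..} p * root_weight p + indicator {0<..} (- p) * root_weight (- p))"
    by (intro Bochner_Integration.integrable_add) simp_all
  also have "(\<lambda>p. indicator {0<..} p * root_weight p + indicator {0<..} (- p) * root_weight (- p)) = root_weight"
    by (auto simp: fun_eq_iff root_weight_def split: split_indicator)
  finally show ?thesis .
qed

lemma root_weight_bound:
  assumes "p \<noteq> 0"
  shows "(1 + \<bar>p\<bar>) / (sqrt \<bar>p\<bar> * (1 + p\<^sup>2)) \<le> 2 * root_weight p"
proof -
  have "(1 + \<bar>p\<bar>) * (1 + \<bar>p\<bar>) \<le> 2 * (1 + p\<^sup>2)"
    using sum_squares_bound[of 1 "\<bar>p\<bar>"] by (simp add: power2_eq_square algebra_simps flip: abs_mult)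
  then have "(1 + \<bar>p\<bar>) / (1 + p\<^sup>2) \<le> 2 / (1 + \<bar>p\<bar>)"
    by (simp add: frac_le_eq add_nonneg_pos divide_le_0_iff pos_divide_le_eq pos_le_divide_eq add_pos_nonneg)
  then have "(1 + \<bar>p\<bar>) / (1 + p\<^sup>2) / sqrt \<bar>p\<bar> \<le> 2 / (1 + \<bar>p\<bar>) / sqrt \<bar>p\<bar>"
    by (rule divide_right_mono) simp
  then show ?thesis by (simp add: root_weight_def mult.commute)
qed

lemma one_le_root_ratio:
  assumes "p \<noteq> 0"
  shows "1 \<le> (1 + \<bar>p\<bar>) / sqrt \<bar>p\<bar>"
proof -
  have "2 * sqrt \<bar>p\<bar> \<le> 1 + \<bar>p\<bar>" using sum_squares_bound[of 1 "sqrt \<bar>p\<bar>"] by simp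
  then have "sqrt \<bar>p\<bar> \<le> 1 + \<bar>p\<bar>" using real_sqrt_ge_zero[of "\<bar>p\<bar>"] by linarith
  then show ?thesis using assms by simp
qed

section \<open>The kernel of the outer function\<close>

text \<open>The bracket in \<open>F_outer\<close>. The subtracted term is real, so it influences
  only the phase of the exponential, and it improves the decay of the Cauchy kernel to order 1 /
  p^2.\<close>

definition ker :: "complex \<Rightarrow> real \<Rightarrow> complex" where
  "ker z p = 1 / (of_real p - z) - of_real (p / (1 + p\<^sup>2))"

lemma ker_measurable [measurable]: "ker z \<in> borel_measurable borel"
  unfolding ker_def by measurable

lemma one_plus_sq_neq_0 [simp]: "1 + (p::real)\<^sup>2 \<noteq> 0"
  by (smt (verit) zero_le_power2)

lemma ker_eq:
  assumes "of_real p \<noteq> z"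
  shows "ker z p = (1 + of_real p * z) / ((of_real p - z) * of_real (1 + p\<^sup>2))"
proof -
  have "complex_of_real (1 + p\<^sup>2) \<noteq> 0" unfolding of_real_eq_0_iff by simp
  with assms show ?thesis
    unfolding ker_def of_real_divide by (simp add: diff_frac_eq) (simp add: power2_eq_square algebra_simps)
qed

lemma ker_bound:
  assumes z: "Im z > 0"
  shows "cmod (ker z p) \<le> (cmod (1 + z\<^sup>2) / Im z + cmod z) / (1 + p\<^sup>2)"
proof -
  have ne: "of_real p \<noteq> z" using z by auto
  have y: "Im z \<le> cmod (of_real p - z)" using abs_Im_le_cmod[of "of_real p - z"] z by simp
  then have pos: "cmod (of_real p - z) > 0" using z by linarith
  have pz: "1 + p\<^sup>2 > 0" by (simp add: add_pos_nonneg)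
  \<comment> \<open>Splitting off a multiple of p - z leaves a numerator independent of p, so that
    the quotient by |p - z| is bounded uniformly in p.\<close>
  have "cmod (1 + of_real p * z) = cmod ((1 + z\<^sup>2) + z * (of_real p - z))"
    by (simp add: power2_eq_square algebra_simps)
  also have "\<dots> \<le> cmod (1 + z\<^sup>2) + cmod z * cmod (of_real p - z)"
    by (metis norm_mult norm_triangle_ineq)
  finally have "cmod (1 + of_real p * z) / cmod (of_real p - z) \<le> cmod (1 + z\<^sup>2) / cmod (of_real p - z) + cmod z"
    using pos by (simp add: divide_simps)
  also have "\<dots> \<le> cmod (1 + z\<^sup>2) / Im z + cmod z"
    using y z by (intro add_right_mono divide_left_mono mult_pos_pos pos) auto
  finally have *: "cmod (1 + of_real p * z) / cmod (of_real p - z) \<le> cmod (1 + z\<^sup>2) / Im z + cmod z" .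
  have "cmod (ker z p) = cmod (1 + of_real p * z) / cmod (of_real p - z) / (1 + p\<^sup>2)"
    using pz by (simp add: ker_eq[OF ne] norm_divide norm_mult del: of_real_add)
  also have "\<dots> \<le> (cmod (1 + z\<^sup>2) / Im z + cmod z) / (1 + p\<^sup>2)"
    using * pz by (intro divide_right_mono) auto
  finally show ?thesis .
qed

lemma Im_ker: "Im z > 0 \<Longrightarrow> Im (ker z p) = Im z / ((p - Re z)\<^sup>2 + (Im z)\<^sup>2)"
  by (simp add: ker_def Im_divide cmod_power2)

lemma Re_ker: "Im z > 0 \<Longrightarrow> Re (ker z p) = (p - Re z) / ((p - Re z)\<^sup>2 + (Im z)\<^sup>2) - p / (1 + p\<^sup>2)"
  unfolding ker_def minus_complex.sel Re_complex_of_real by (simp add: Re_divide cmod_power2)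

text \<open>The imaginary part is the Poisson kernel with integral pi; the real part has the
  antiderivative \<open>H\<close>, half the logarithm of a quotient of quadratics, which tends to 0
  at both ends. The value pi i lets a constant be subtracted from the weight in the study of
  boundary values.\<close>

lemma
  assumes z: "Im z > 0"
  shows ker_integrable: "integrable lborel (ker z)" and ker_integral: "integral\<^sup>L lborel (ker z) = pi * \<i>"
proof -
  define x y where "x = Re z" and "y = Im z"
  have y: "y > 0" using z by (simp add: y_def)
  have i1: "integrable lborel (\<lambda>p. 1 / (1 + p\<^sup>2) :: real)"
    using integrable_Poisson[of 1 0] by (simp add: add.commute)
  have A0: "\<bar>cmod (1 + z\<^sup>2) / Im z + cmod z\<bar> = cmod (1 + z\<^sup>2) / Im z + cmod z" using z by simp
  show i: "integrable lborel (ker z)"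
  proof (rule Bochner_Integration.integrable_bound)
    show "integrable lborel (\<lambda>p. (cmod (1 + z\<^sup>2) / Im z + cmod z) * (1 / (1 + p\<^sup>2)))" using i1 by (rule integrable_mult_right)
    show "AE p in lborel. norm (ker z p) \<le> norm ((cmod (1 + z\<^sup>2) / Im z + cmod z) * (1 / (1 + p\<^sup>2)))"
      using ker_bound[OF z] A0 by (intro AE_I2) simp
  qed measurable
  have pos: "(p - x)\<^sup>2 + y\<^sup>2 > 0" for p using y by (simp add: add_nonneg_pos)
  have pos1: "1 + p\<^sup>2 > 0" for p :: real by (simp add: add_pos_nonneg)
  define H where "H p = (ln ((p - x)\<^sup>2 + y\<^sup>2) - ln (1 + p\<^sup>2)) / 2" for p
  have D: "(H has_vector_derivative Re (ker z p)) (at p)" for p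
    unfolding has_real_derivative_iff_has_vector_derivative[symmetric] H_def Re_ker[OF z] x_def[symmetric] y_def[symmetric]
    using pos[of p] pos1[of p] by (auto intro!: derivative_eq_intros simp: divide_simps)
  have C: "isCont (\<lambda>p. Re (ker z p)) p" for p
    unfolding Re_ker[OF z] x_def[symmetric] y_def[symmetric]
    using pos[of p] pos1[of p] by (intro continuous_intros) auto
  have A: "(H \<longlongrightarrow> 0) at_bot" and B: "(H \<longlongrightarrow> 0) at_top"
    unfolding H_def using y by real_asymp+
  have "(LBINT p=-\<infinity>..\<infinity>. Re (ker z p)) = 0 - 0"
    by (rule interval_integral_FTC_integrable[where F = H])
      (use D C A B i in \<open>simp_all add: ereal_tendsto_simps set_integrable_def\<close>)
  then have "(LINT p|lborel. Re (ker z p)) = 0"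
    by (simp add: interval_lebesgue_integral_def set_lebesgue_integral_def)
  moreover have "(LINT p|lborel. Im (ker z p)) = pi"
    using integral_Poisson[OF z, of "Re z"] by (simp add: Im_ker[OF z])
  ultimately show "integral\<^sup>L lborel (ker z) = pi * \<i>"
    using i by (simp add: complex_eq_iff)
qed

section \<open>The outer function of an even weight that is Lipschitz in the logarithm\<close>

text \<open>The instance of interest is \<open>\<phi> p = ln (sqrt (Psi \<nu> p))\<close>. The Lipschitz condition in \<open>ln \<bar>p\<bar>\<close> makes
  the boundary value of \<open>F\<close> exist at every \<open>x \<noteq> 0\<close>: it dominates \<open>ker z p * (\<phi> p - \<phi> x)\<close> uniformly in \<open>z\<close>
  above \<open>x\<close> by a multiple of \<open>root_weight\<close>.\<close>

locale log_weight =
  fixes \<phi> :: "real \<Rightarrow> real"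
  assumes phi_measurable [measurable]: "\<phi> \<in> borel_measurable borel"
    and phi_even: "\<phi> (- p) = \<phi> p"
    and phi_lipschitz: "p \<noteq> 0 \<Longrightarrow> x \<noteq> 0 \<Longrightarrow> \<bar>\<phi> p - \<phi> x\<bar> \<le> \<bar>ln \<bar>p\<bar> - ln \<bar>x\<bar>\<bar>"
begin

definition G :: "complex \<Rightarrow> complex" where
  "G z = (LINT p|lborel. ker z p * of_real (\<phi> p))"

definition F :: "complex \<Rightarrow> complex" where
  "F z = exp (1 / (of_real pi * \<i>) * G z)"

lemma phi_diff_le:
  assumes "p \<noteq> 0" "x \<noteq> 0"
  shows "\<bar>\<phi> p - \<phi> x\<bar> \<le> 2 * \<bar>p - x\<bar> / sqrt (\<bar>p\<bar> * \<bar>x\<bar>)"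
proof -
  have "\<bar>\<phi> p - \<phi> x\<bar> \<le> 2 * \<bar>\<bar>p\<bar> - \<bar>x\<bar>\<bar> / sqrt (\<bar>p\<bar> * \<bar>x\<bar>)"
    using phi_lipschitz[OF assms] abs_ln_diff_le[of "\<bar>p\<bar>" "\<bar>x\<bar>"] assms by simp
  also have "\<dots> \<le> 2 * \<bar>p - x\<bar> / sqrt (\<bar>p\<bar> * \<bar>x\<bar>)"
    by (intro divide_right_mono mult_left_mono) auto
  finally show ?thesis .
qed

text \<open>Comparison with the value at 1. The constant |\<phi> 1| is absorbed because (1 + |p|) /
  sqrt |p| is at least 1.\<close>

lemma phi_bound:
  assumes p: "p \<noteq> 0"
  shows "\<bar>\<phi> p\<bar> \<le> (\<bar>\<phi> 1\<bar> + 2) * ((1 + \<bar>p\<bar>) / sqrt \<bar>p\<bar>)"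
proof -
  have "\<bar>\<phi> p\<bar> \<le> \<bar>\<phi> 1\<bar> + \<bar>\<phi> p - \<phi> 1\<bar>" by linarith
  also have "\<bar>\<phi> p - \<phi> 1\<bar> \<le> 2 * \<bar>p - 1\<bar> / sqrt (\<bar>p\<bar> * \<bar>1\<bar>)" by (rule phi_diff_le) (use p in auto)
  also have "\<dots> \<le> 2 * (1 + \<bar>p\<bar>) / sqrt \<bar>p\<bar>"
  proof -
    have "2 * \<bar>p - 1\<bar> \<le> 2 * (1 + \<bar>p\<bar>)" by (auto simp: abs_if)
    then show ?thesis using divide_right_mono[of "2 * \<bar>p - 1\<bar>" _ "sqrt \<bar>p\<bar>"] by simp
  qed
  also have "\<bar>\<phi> 1\<bar> \<le> \<bar>\<phi> 1\<bar> * ((1 + \<bar>p\<bar>) / sqrt \<bar>p\<bar>)"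
    using mult_left_mono[OF one_le_root_ratio[OF p], of "\<bar>\<phi> 1\<bar>"] by simp
  finally show ?thesis by (simp add: distrib_right add_divide_distrib)
qed

lemma phi_mult_integrable:
  fixes k :: "real \<Rightarrow> complex"
  assumes k: "k \<in> borel_measurable borel" and M: "\<And>p. cmod (k p) \<le> M / (1 + p\<^sup>2)"
  shows "integrable lborel (\<lambda>p. k p * of_real (\<phi> p))"
proof (rule Bochner_Integration.integrable_bound)
  show "integrable lborel (\<lambda>p. M * (\<bar>\<phi> 1\<bar> + 2) * 2 * root_weight p)"
    using root_weight_integrable by (rule integrable_mult_right)
  show "(\<lambda>p. k p * of_real (\<phi> p)) \<in> borel_measurable lborel" using k by simp
  have "AE p in lborel. p \<noteq> (0::real)" by (rule AE_lborel_singleton)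
  then show "AE p in lborel. norm (k p * of_real (\<phi> p)) \<le> norm (M * (\<bar>\<phi> 1\<bar> + 2) * 2 * root_weight p)"
  proof eventually_elim
    fix p :: real assume p: "p \<noteq> 0"
    have M0: "M \<ge> 0" using order_trans[OF norm_ge_zero M[of 0]] by simp
    have "norm (k p * of_real (\<phi> p)) \<le> M / (1 + p\<^sup>2) * ((\<bar>\<phi> 1\<bar> + 2) * ((1 + \<bar>p\<bar>) / sqrt \<bar>p\<bar>))"
      unfolding norm_mult norm_of_real using M0 by (intro mult_mono M phi_bound p) (auto simp: add_nonneg_nonneg)
    also have "\<dots> = M * (\<bar>\<phi> 1\<bar> + 2) * ((1 + \<bar>p\<bar>) / (sqrt \<bar>p\<bar> * (1 + p\<^sup>2)))" by (simp add: mult_ac)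
    also have "\<dots> \<le> M * (\<bar>\<phi> 1\<bar> + 2) * (2 * root_weight p)"
      using M0 by (intro mult_left_mono root_weight_bound p) auto
    finally show "norm (k p * of_real (\<phi> p)) \<le> norm (M * (\<bar>\<phi> 1\<bar> + 2) * 2 * root_weight p)" by simp
  qed
qed

lemma G_integrable: "Im z > 0 \<Longrightarrow> integrable lborel (\<lambda>p. ker z p * of_real (\<phi> p))"
  by (rule phi_mult_integrable[OF ker_measurable ker_bound])

text \<open>Differentiation under the integral with an explicit remainder: the error of the
  difference quotient is h times the integral of \<phi> / ((p - z - h) (p - z)^2). For |h| < y / 2
  the extra factor is at most 2 / y, so the error is at most |h| B.\<close>

lemma G_has_derivative:
  assumes z: "Im z > 0"
  shows "(G has_field_derivative (LINT p|lborel. 1 / (of_real p - z)\<^sup>2 * of_real (\<phi> p))) (at z)"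
proof -
  define y where "y = Im z"
  have y: "y > 0" using z by (simp add: y_def)
  have pz: "y \<le> cmod (of_real p - z)" for p using abs_Im_le_cmod[of "of_real p - z"] z by (simp add: y_def)
  have pz0: "of_real p - z \<noteq> 0" for p using pz[of p] y by auto
  \<comment> \<open>From p = (p - z) + z one has 1 + p^2 \<le> 2 |p - z|^2 + (1 + 2 |z|^2), and the
    bracket is turned into a multiple of |p - z|^2 by y \<le> |p - z|.\<close>
  define M where "M = 2 + (1 + 2 * (cmod z)\<^sup>2) / y\<^sup>2"
  have M: "1 / (cmod (of_real p - z))\<^sup>2 \<le> M / (1 + p\<^sup>2)" for p
  proof -
    have "1 + p\<^sup>2 = 1 + (cmod ((of_real p - z) + z))\<^sup>2" by simp
    also have "\<dots> \<le> 1 + (2 * (cmod (of_real p - z))\<^sup>2 + 2 * (cmod z)\<^sup>2)"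
      by (intro add_left_mono norm_add_sq_le)
    also have "\<dots> = 2 * (cmod (of_real p - z))\<^sup>2 + (1 + 2 * (cmod z)\<^sup>2) / y\<^sup>2 * y\<^sup>2" using y by simp
    also have "\<dots> \<le> 2 * (cmod (of_real p - z))\<^sup>2 + (1 + 2 * (cmod z)\<^sup>2) / y\<^sup>2 * (cmod (of_real p - z))\<^sup>2"
      using y by (intro add_left_mono mult_left_mono power_mono pz) auto
    also have "\<dots> = M * (cmod (of_real p - z))\<^sup>2" by (simp add: M_def distrib_right)
    finally have "1 + p\<^sup>2 \<le> M * (cmod (of_real p - z))\<^sup>2" .
    moreover have "1 + p\<^sup>2 > 0" by (simp add: add_pos_nonneg)
    ultimately show ?thesis using pz0[of p] by (simp add: divide_le_eq pos_le_divide_eq)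
  qed
  have iD: "integrable lborel (\<lambda>p. 1 / (of_real p - z)\<^sup>2 * of_real (\<phi> p))"
    by (rule phi_mult_integrable[where M = M]) (use M in \<open>auto simp: norm_divide norm_power\<close>)
  define D where "D = (LINT p|lborel. 1 / (of_real p - z)\<^sup>2 * of_real (\<phi> p))"
  define B where "B = (LINT p|lborel. 2 / y * norm (1 / (of_real p - z)\<^sup>2 * of_real (\<phi> p)))"
  have est: "cmod ((G (z + h) - G z) / h - D) \<le> cmod h * B" if h: "h \<noteq> 0" "cmod h < y / 2" for h
  proof -
    have zh: "Im (z + h) > 0" using abs_Im_le_cmod[of h] h y by (simp add: y_def)
    have ph: "cmod (of_real p - z - h) \<ge> y / 2" for p
      using norm_triangle_ineq2[of "of_real p - z" h] pz[of p] h by linarith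
    have ph0: "of_real p - z - h \<noteq> 0" for p using ph[of p] y by auto
    have "(G (z + h) - G z) / h - D =
      (LINT p|lborel. (ker (z + h) p * of_real (\<phi> p) - ker z p * of_real (\<phi> p)) / h - 1 / (of_real p - z)\<^sup>2 * of_real (\<phi> p))"
      unfolding G_def D_def using G_integrable[OF z] G_integrable[OF zh] iD by simp
    also have "\<dots> = (LINT p|lborel. h * (1 / (of_real p - z - h) * (1 / (of_real p - z)\<^sup>2 * of_real (\<phi> p))))"
    proof (rule Bochner_Integration.integral_cong[OF refl])
      fix p
      have alg: "(1 / (a - h) - 1 / a) / h - 1 / a\<^sup>2 = h * (1 / (a - h) * (1 / a\<^sup>2))" if "a \<noteq> 0" "a - h \<noteq> 0" for a
        using that h(1) by (simp add: divide_simps) (simp add: power2_eq_square algebra_simps)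
      have "(ker (z + h) p * of_real (\<phi> p) - ker z p * of_real (\<phi> p)) / h - 1 / (of_real p - z)\<^sup>2 * of_real (\<phi> p) =
        ((1 / (of_real p - z - h) - 1 / (of_real p - z)) / h - 1 / (of_real p - z)\<^sup>2) * of_real (\<phi> p)"
        by (simp add: ker_def diff_diff_eq left_diff_distrib flip: diff_divide_distrib)
      also have "\<dots> = h * (1 / (of_real p - z - h) * (1 / (of_real p - z)\<^sup>2 * of_real (\<phi> p)))"
        by (subst alg[OF pz0 ph0]) (simp only: mult.assoc)
      finally show "(ker (z + h) p * of_real (\<phi> p) - ker z p * of_real (\<phi> p)) / h - 1 / (of_real p - z)\<^sup>2 * of_real (\<phi> p) =
        h * (1 / (of_real p - z - h) * (1 / (of_real p - z)\<^sup>2 * of_real (\<phi> p)))" .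
    qed
    also have "\<dots> = h * (LINT p|lborel. 1 / (of_real p - z - h) * (1 / (of_real p - z)\<^sup>2 * of_real (\<phi> p)))"
      by (rule integral_mult_right_zero)
    also have "cmod \<dots> \<le> cmod h * B"
      unfolding norm_mult
    proof (rule mult_left_mono)
      have b: "norm (1 / (of_real p - z - h) * (1 / (of_real p - z)\<^sup>2 * of_real (\<phi> p))) \<le>
        2 / y * norm (1 / (of_real p - z)\<^sup>2 * of_real (\<phi> p))" for p
      proof -
        have "norm (1 / (of_real p - z - h)) \<le> 2 / y"
          using ph[of p] y ph0[of p] by (simp add: norm_divide divide_simps)
        then show ?thesis unfolding norm_mult[of "1 / (of_real p - z - h)"] by (rule mult_right_mono) simp
      qed
      have i2: "integrable lborel (\<lambda>p. 2 / y * norm (1 / (of_real p - z)\<^sup>2 * of_real (\<phi> p)))"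
        using iD by (intro integrable_mult_right integrable_norm)
      have "integrable lborel (\<lambda>p. 1 / (of_real p - z - h) * (1 / (of_real p - z)\<^sup>2 * of_real (\<phi> p)))"
        by (rule Bochner_Integration.integrable_bound[OF i2]) (use b y in \<open>auto intro!: AE_I2\<close>)
      then show "cmod (LINT p|lborel. 1 / (of_real p - z - h) * (1 / (of_real p - z)\<^sup>2 * of_real (\<phi> p))) \<le> B"
        unfolding B_def by (intro order_trans[OF integral_norm_bound integral_mono] integrable_norm i2 b)
    qed simp
    finally show ?thesis .
  qed
  have "(\<lambda>h. (G (z + h) - G z) / h - D) \<midarrow>0\<rightarrow> 0"
  proof (rule Lim_null_comparison)
    have "\<forall>\<^sub>F h in at 0. h \<noteq> 0 \<and> cmod h < y / 2"
      using y by (auto simp: eventually_at dist_norm intro!: exI[of _ "y / 2"])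
    then show "\<forall>\<^sub>F h in at 0. norm ((G (z + h) - G z) / h - D) \<le> cmod h * B"
      by eventually_elim (use est in blast)
    have "(\<lambda>h::complex. cmod h * B) \<midarrow>0\<rightarrow> cmod 0 * B" by (intro tendsto_intros)
    then show "(\<lambda>h::complex. cmod h * B) \<midarrow>0\<rightarrow> 0" by simp
  qed
  then show ?thesis unfolding DERIV_def D_def[symmetric] by (rule LIM_zero_cancel)
qed

lemma F_holomorphic: "F holomorphic_on UHP"
proof -
  have "G holomorphic_on UHP"
    using G_has_derivative by (auto simp: holomorphic_on_open[OF open_UHP])
  then show ?thesis unfolding F_def[abs_def] by (intro holomorphic_intros) auto
qed

lemma F_nonzero [simp]: "F z \<noteq> 0"
  by (simp add: F_def)

text \<open>The substitution p to -p combined with evenness of \<open>\<phi>\<close>. It makes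
  \<open>F\<close> real on the imaginary axis and relates the boundary values at x and -x.\<close>

lemma F_reflect:
  assumes z: "Im z > 0"
  shows "F (- cnj z) = cnj (F z)"
proof -
  have "G (- cnj z) = (LINT p|lborel. ker (- cnj z) (- p) * of_real (\<phi> (- p)))"
    unfolding G_def using lborel_integral_real_affine[of "-1" "\<lambda>p. ker (- cnj z) p * of_real (\<phi> p)" 0] by simp
  also have "(\<lambda>p. ker (- cnj z) (- p) * of_real (\<phi> (- p))) = (\<lambda>p. - cnj (ker z p * of_real (\<phi> p)))"
  proof
    fix p
    have ne: "cnj z \<noteq> of_real p" "of_real p \<noteq> cnj z" using z by (auto simp: complex_eq_iff)
    have "ker (- cnj z) (- p) = - cnj (ker z p)"
      using minus_divide_right[of 1 "of_real p - cnj z"] by (simp add: ker_def)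
    then show "ker (- cnj z) (- p) * of_real (\<phi> (- p)) = - cnj (ker z p * of_real (\<phi> p))"
      by (simp add: phi_even)
  qed
  also have "(LINT p|lborel. - cnj (ker z p * of_real (\<phi> p))) = - cnj (G z)"
    unfolding G_def Bochner_Integration.integral_cnj[symmetric] by (rule integral_minus)
  finally have "1 / (of_real pi * \<i>) * G (- cnj z) = cnj (1 / (of_real pi * \<i>) * G z)" by simp
  then show ?thesis by (simp only: F_def exp_cnj)
qed

text \<open>The Poisson extension of \<open>\<phi>\<close> to the half-plane; by
  \<open>cmod_F\<close> it is ln |F|.\<close>

definition Pphi :: "complex \<Rightarrow> real" where
  "Pphi z = (LINT p|lborel. Im z / ((p - Re z)\<^sup>2 + (Im z)\<^sup>2) * \<phi> p) / pi"

lemma Poisson_phi_integrable: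
  assumes "Im z > 0"
  shows "integrable lborel (\<lambda>p. Im z / ((p - Re z)\<^sup>2 + (Im z)\<^sup>2) * \<phi> p)"
  using integrable_Im[OF G_integrable[OF assms]] by (simp add: Im_ker[OF assms])

lemma cmod_F:
  assumes "Im z > 0"
  shows "cmod (F z) = exp (Pphi z)"
proof -
  have "Im (G z) = (LINT p|lborel. Im (ker z p * of_real (\<phi> p)))"
    unfolding G_def by (rule integral_Im[symmetric, OF G_integrable[OF assms]])
  also have "\<dots> = pi * Pphi z" by (simp add: Pphi_def Im_ker[OF assms])
  finally show ?thesis by (simp add: F_def norm_exp_eq_Re Re_divide power2_eq_square)
qed

text \<open>The boundary value in closed form. The integral with the kernel at a real point is
  singular, so \<open>\<phi> x\<close> is subtracted from the weight; by \<open>ker_integral\<close>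
  the subtracted constant contributes pi i \<phi>(x) on every line above the real axis, hence also
  in the limit.\<close>

definition Fb :: "real \<Rightarrow> complex" where
  "Fb x = exp (1 / (of_real pi * \<i>) * ((LINT p|lborel. ker (of_real x) p * of_real (\<phi> p - \<phi> x)) + pi * \<i> * \<phi> x))"

lemma F_tendsto:
  assumes x: "x \<noteq> 0"
  shows "((\<lambda>\<epsilon>. F (Complex x \<epsilon>)) \<longlongrightarrow> Fb x) (at_right 0)"
proof (rule tendsto_at_right_sequentially[of 0 1])
  fix S :: "nat \<Rightarrow> real" assume S: "\<And>n. 0 < S n" "\<And>n. S n < 1" "S \<longlonglongrightarrow> 0"
  have pos: "Im (Complex x (S n)) > 0" for n using S by simp
  have split: "G (Complex x (S n)) = (LINT p|lborel. ker (Complex x (S n)) p * of_real (\<phi> p - \<phi> x)) + pi * \<i> * \<phi> x" for n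
    using G_integrable[OF pos, of n] ker_integrable[OF pos, of n] ker_integral[OF pos, of n]
    by (simp add: G_def right_diff_distrib)
  \<comment> \<open>Since S n < 1, the numerator |1 + p z| of the kernel is at most (2 + |x|) (1 +
    |p|). The factor 2 / sqrt |x| comes from \<open>phi_diff_le\<close>.\<close>
  define C where "C = (2 + \<bar>x\<bar>) * 2 / sqrt \<bar>x\<bar>"
  have "(\<lambda>n. LINT p|lborel. ker (Complex x (S n)) p * of_real (\<phi> p - \<phi> x)) \<longlonglongrightarrow>
    (LINT p|lborel. ker (of_real x) p * of_real (\<phi> p - \<phi> x))"
  proof (rule integral_dominated_convergence[where w = "\<lambda>p. C * 2 * root_weight p"])
    show "integrable lborel (\<lambda>p. C * 2 * root_weight p)" using root_weight_integrable by (rule integrable_mult_right)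
    have ae: "AE p in lborel. p \<noteq> 0 \<and> p \<noteq> x" using AE_lborel_singleton[of 0] AE_lborel_singleton[of x] by eventually_elim auto
    show "AE p in lborel. (\<lambda>n. ker (Complex x (S n)) p * of_real (\<phi> p - \<phi> x)) \<longlonglongrightarrow> ker (of_real x) p * of_real (\<phi> p - \<phi> x)"
      using ae
    proof eventually_elim
      fix p assume p: "p \<noteq> 0 \<and> p \<noteq> x"
      have "(\<lambda>n. 1 / (of_real p - (of_real x + \<i> * of_real (S n))) - of_real (p / (1 + p\<^sup>2))) \<longlonglongrightarrow>
        1 / (of_real p - (of_real x + \<i> * of_real 0)) - complex_of_real (p / (1 + p\<^sup>2))"
        using p by (intro tendsto_intros S) (simp flip: of_real_diff)
      then have "(\<lambda>n. ker (Complex x (S n)) p) \<longlonglongrightarrow> ker (of_real x) p" by (simp add: ker_def Complex_eq)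
      then show "(\<lambda>n. ker (Complex x (S n)) p * of_real (\<phi> p - \<phi> x)) \<longlonglongrightarrow> ker (of_real x) p * of_real (\<phi> p - \<phi> x)"
        by (intro tendsto_intros)
    qed
    show "AE p in lborel. norm (ker (Complex x (S n)) p * of_real (\<phi> p - \<phi> x)) \<le> C * 2 * root_weight p" for n
      using ae
    proof eventually_elim
      fix p assume p: "p \<noteq> 0 \<and> p \<noteq> x"
      let ?z = "Complex x (S n)"
      have ne: "of_real p \<noteq> ?z" using p by (auto simp: complex_eq_iff)
      have px: "\<bar>p - x\<bar> \<le> cmod (of_real p - ?z)" using abs_Re_le_cmod[of "of_real p - ?z"] by simp
      have "cmod ?z \<le> \<bar>x\<bar> + \<bar>S n\<bar>" using cmod_le[of ?z] by simp
      then have zb: "cmod ?z \<le> \<bar>x\<bar> + 1" using S(1,2)[of n] by linarith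
      have "cmod (1 + of_real p * ?z) \<le> 1 + \<bar>p\<bar> * cmod ?z"
        using norm_triangle_ineq[of 1 "of_real p * ?z"] by (simp add: norm_mult)
      also have "\<dots> \<le> 1 + \<bar>p\<bar> * (\<bar>x\<bar> + 1)" using zb by (intro add_left_mono mult_left_mono) auto
      also have "\<dots> \<le> (2 + \<bar>x\<bar>) * (1 + \<bar>p\<bar>)" by (simp add: algebra_simps)
      finally have num: "cmod (1 + of_real p * ?z) \<le> (2 + \<bar>x\<bar>) * (1 + \<bar>p\<bar>)" .
      have pp: "1 + p\<^sup>2 > 0" by (simp add: add_pos_nonneg)
      have sq: "sqrt (\<bar>p\<bar> * \<bar>x\<bar>) > 0" using p x by simp
      have "norm (ker ?z p * of_real (\<phi> p - \<phi> x)) =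
        cmod (1 + of_real p * ?z) / (cmod (of_real p - ?z) * (1 + p\<^sup>2)) * \<bar>\<phi> p - \<phi> x\<bar>"
        using pp unfolding ker_eq[OF ne] norm_mult norm_divide norm_of_real by simp
      also have "\<dots> \<le> (2 + \<bar>x\<bar>) * (1 + \<bar>p\<bar>) / (cmod (of_real p - ?z) * (1 + p\<^sup>2)) * (2 * cmod (of_real p - ?z) / sqrt (\<bar>p\<bar> * \<bar>x\<bar>))"
      proof (intro mult_mono divide_right_mono num)
        have "\<bar>\<phi> p - \<phi> x\<bar> \<le> 2 * \<bar>p - x\<bar> / sqrt (\<bar>p\<bar> * \<bar>x\<bar>)" using phi_diff_le p x by blast
        \<comment> \<open>Enlarging |p - x| to |p - z| lets this factor cancel the denominator of
          the kernel, so the majorant no longer depends on the height.\<close>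
        also have "\<dots> \<le> 2 * cmod (of_real p - ?z) / sqrt (\<bar>p\<bar> * \<bar>x\<bar>)"
          using px sq by (intro divide_right_mono mult_left_mono) auto
        finally show "\<bar>\<phi> p - \<phi> x\<bar> \<le> 2 * cmod (of_real p - ?z) / sqrt (\<bar>p\<bar> * \<bar>x\<bar>)" .
      qed (use pp in auto)
      also have "\<dots> = C * ((1 + \<bar>p\<bar>) / (sqrt \<bar>p\<bar> * (1 + p\<^sup>2)))"
      proof -
        have alg: "a * b / (d * q) * (2 * d / (s * t)) = a * 2 / t * (b / (s * q))" if "d \<noteq> 0" for a b d q s t :: real
          using that by (simp add: mult_ac)
        show ?thesis unfolding C_def real_sqrt_mult by (rule alg) (use ne in simp)
      qed
      also have "\<dots> \<le> C * (2 * root_weight p)"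
        using p by (intro mult_left_mono root_weight_bound) (auto simp: C_def)
      finally show "norm (ker ?z p * of_real (\<phi> p - \<phi> x)) \<le> C * 2 * root_weight p" by simp
    qed
  qed measurable
  then have "(\<lambda>n. G (Complex x (S n))) \<longlonglongrightarrow> (LINT p|lborel. ker (of_real x) p * of_real (\<phi> p - \<phi> x)) + pi * \<i> * \<phi> x"
    unfolding split by (intro tendsto_intros)
  then show "(\<lambda>n. F (Complex x (S n))) \<longlonglongrightarrow> Fb x"
    unfolding F_def Fb_def by (intro tendsto_intros)
qed simp

text \<open>The regularised integral is real; divided by pi i it contributes only a phase.\<close>

lemma cmod_Fb: "cmod (Fb x) = exp (\<phi> x)"
proof -
  have "(\<lambda>p. ker (of_real x) p * of_real (\<phi> p - \<phi> x)) =
    (\<lambda>p. complex_of_real ((1 / (p - x) - p / (1 + p\<^sup>2)) * (\<phi> p - \<phi> x)))"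
    by (simp add: ker_def fun_eq_iff)
  then have "(LINT p|lborel. ker (of_real x) p * of_real (\<phi> p - \<phi> x)) =
    of_real (LINT p|lborel. (1 / (p - x) - p / (1 + p\<^sup>2)) * (\<phi> p - \<phi> x))"
    by (simp only: integral_complex_of_real)
  then show ?thesis by (simp add: Fb_def norm_exp_eq_Re Re_divide power2_eq_square)
qed

lemma Fb_reflect:
  assumes x: "x \<noteq> 0"
  shows "Fb (- x) = cnj (Fb x)"
proof -
  have "((\<lambda>\<epsilon>. cnj (F (Complex x \<epsilon>))) \<longlongrightarrow> cnj (Fb x)) (at_right 0)"
    by (intro tendsto_cnj F_tendsto x)
  moreover have "\<forall>\<^sub>F \<epsilon> in at_right 0. cnj (F (Complex x \<epsilon>)) = F (Complex (- x) \<epsilon>)"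
    using eventually_at_right_less[of "0::real"]
  proof eventually_elim
    fix \<epsilon> :: real assume e: "0 < \<epsilon>"
    have "- cnj (Complex x \<epsilon>) = Complex (- x) \<epsilon>" by (simp add: complex_eq_iff)
    then show "cnj (F (Complex x \<epsilon>)) = F (Complex (- x) \<epsilon>)" using F_reflect[of "Complex x \<epsilon>"] e by simp
  qed
  ultimately have "((\<lambda>\<epsilon>. F (Complex (- x) \<epsilon>)) \<longlongrightarrow> cnj (Fb x)) (at_right 0)"
    by (rule Lim_transform_eventually)
  moreover have "- x \<noteq> 0" using x by simp
  ultimately show ?thesis
    using tendsto_unique[OF trivial_limit_at_right_real F_tendsto[of "- x"]] by blast
qed

lemma Fb_measurable [measurable]: "Fb \<in> borel_measurable borel"
proof (rule borel_measurable_LIMSEQ_metric)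
  \<comment> \<open>Convergence is known only for x \<noteq> 0, so the sequence is made constant at
    the origin.\<close>
  define u where "u n x = (if x = 0 then Fb 0 else F (Complex x (1 / real (Suc n))))" for n x
  have [measurable]: "(\<lambda>x. F (Complex x (1 / real (Suc n)))) \<in> borel_measurable borel" for n
    by (rule measurable_hline[OF F_holomorphic]) simp
  show "u n \<in> borel_measurable borel" for n unfolding u_def by measurable
  have l: "filterlim (\<lambda>n. 1 / real (Suc n)) (at_right 0) sequentially"
    by (intro tendsto_imp_filterlim_at_right LIMSEQ_Suc[OF lim_1_over_n]) simp
  show "(\<lambda>n. u n x) \<longlonglongrightarrow> Fb x" for x
    using filterlim_compose[OF F_tendsto l, of x] by (cases "x = 0") (simp_all add: u_def)
qed

end

section \<open>Lower bounds for the modulus of the outer function\<close>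

lemma sqrt_Poisson_integrable: "integrable lborel (\<lambda>s::real. sqrt \<bar>s\<bar> / (1 + s\<^sup>2))"
proof (rule Bochner_Integration.integrable_bound)
  show "integrable lborel (\<lambda>s. 2 * root_weight s)" using root_weight_integrable by (rule integrable_mult_right)
  show "AE s in lborel. norm (sqrt \<bar>s\<bar> / (1 + s\<^sup>2)) \<le> norm (2 * root_weight s)"
  proof (rule AE_I2)
    fix s :: real
    have rw: "root_weight s \<ge> 0" by (simp add: root_weight_def)
    have "sqrt \<bar>s\<bar> / (1 + s\<^sup>2) \<le> 2 * root_weight s"
    proof (cases "s = 0")
      case False
      have pos: "sqrt \<bar>s\<bar> * (1 + s\<^sup>2) > 0" using False by (intro mult_pos_pos) (auto simp: add_pos_nonneg)
      have "sqrt \<bar>s\<bar> / (1 + s\<^sup>2) = \<bar>s\<bar> / (sqrt \<bar>s\<bar> * (1 + s\<^sup>2))"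
        using False real_sqrt_mult_self[of "\<bar>s\<bar>"] by (simp add: frac_eq_eq add_pos_nonneg mult.assoc[symmetric])
      also have "\<dots> \<le> (1 + \<bar>s\<bar>) / (sqrt \<bar>s\<bar> * (1 + s\<^sup>2))" using pos by (intro divide_right_mono) auto
      also have "\<dots> \<le> 2 * root_weight s" by (rule root_weight_bound[OF False])
      finally show ?thesis .
    qed (use rw in simp)
    then show "norm (sqrt \<bar>s\<bar> / (1 + s\<^sup>2)) \<le> norm (2 * root_weight s)" using rw by simp
  qed
qed measurable

text \<open>The Poisson extension of \<open>sqrt \<bar>p\<bar>\<close> at the point i. By the
  substitution p = x + y s, the extension of \<open>sqrt \<bar>p - x\<bar>\<close> at x + i y is
  this constant times sqrt y.\<close>

definition sqrt_const :: real where
  "sqrt_const = (LINT s|lborel. sqrt \<bar>s\<bar> / (1 + s\<^sup>2)) / pi"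

lemma sqrt_const_nonneg: "sqrt_const \<ge> 0"
  unfolding sqrt_const_def by (intro divide_nonneg_nonneg Bochner_Integration.integral_nonneg) auto

lemma
  fixes x y :: real
  assumes y: "y > 0"
  shows sqrt_shift_integrable: "integrable lborel (\<lambda>p. y / ((p - x)\<^sup>2 + y\<^sup>2) * sqrt \<bar>p - x\<bar>)"
    and sqrt_shift_integral: "(LINT p|lborel. y / ((p - x)\<^sup>2 + y\<^sup>2) * sqrt \<bar>p - x\<bar>) = pi * sqrt_const * sqrt y"
proof -
  let ?f = "\<lambda>p. y / ((p - x)\<^sup>2 + y\<^sup>2) * sqrt \<bar>p - x\<bar>"
  have eq: "?f (x + y * s) = sqrt y / y * (sqrt \<bar>s\<bar> / (1 + s\<^sup>2))" for s
  proof -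
    have "?f (x + y * s) = y / ((y * s)\<^sup>2 + y\<^sup>2) * (sqrt y * sqrt \<bar>s\<bar>)"
      using y by (simp add: abs_mult real_sqrt_mult)
    also have "(y * s)\<^sup>2 + y\<^sup>2 = y * (y * (1 + s\<^sup>2))" by (simp add: power2_eq_square algebra_simps)
    also have "y / (y * (y * (1 + s\<^sup>2))) = 1 / (y * (1 + s\<^sup>2))" using y by simp
    finally show ?thesis by (simp add: mult_ac)
  qed
  have "integrable lborel (\<lambda>s. ?f (x + y * s))"
    unfolding eq using sqrt_Poisson_integrable by (rule integrable_mult_right)
  then show "integrable lborel ?f" using lborel_integrable_real_affine_iff[of y ?f x] y by simp
  have "integral\<^sup>L lborel ?f = \<bar>y\<bar> *\<^sub>R (LINT s|lborel. ?f (x + y * s))"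
    by (rule lborel_integral_real_affine) (use y in simp)
  also have "\<dots> = y * (sqrt y / y * (LINT s|lborel. sqrt \<bar>s\<bar> / (1 + s\<^sup>2)))"
    unfolding eq integral_mult_right_zero using y by simp
  also have "\<dots> = pi * sqrt_const * sqrt y" using y by (simp add: sqrt_const_def)
  finally show "integral\<^sup>L lborel ?f = pi * sqrt_const * sqrt y" .
qed

context log_weight
begin

lemma Pphi_lower_const:
  assumes c: "\<And>p. p \<noteq> 0 \<Longrightarrow> \<phi> p \<ge> c" and z: "Im z > 0"
  shows "Pphi z \<ge> c"
proof -
  let ?P = "\<lambda>p. Im z / ((p - Re z)\<^sup>2 + (Im z)\<^sup>2)"
  have "(LINT p|lborel. ?P p * c) \<le> (LINT p|lborel. ?P p * \<phi> p)"
  proof (rule integral_mono_AE)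
    show "integrable lborel (\<lambda>p. ?P p * c)" by (intro integrable_mult_left integrable_Poisson z)
    show "integrable lborel (\<lambda>p. ?P p * \<phi> p)" by (rule Poisson_phi_integrable[OF z])
    have "AE p in lborel. p \<noteq> (0::real)" by (rule AE_lborel_singleton)
    then show "AE p in lborel. ?P p * c \<le> ?P p * \<phi> p"
      by eventually_elim (rule mult_left_mono, use z c in simp_all)
  qed
  also have "(LINT p|lborel. ?P p * c) = pi * c"
    unfolding integral_mult_left_zero integral_Poisson[OF z] ..
  finally show ?thesis by (simp add: Pphi_def pos_le_divide_eq mult.commute)
qed

text \<open>The Poisson integral of \<open>ln (p\<^sup>2 + l\<^sup>2) / 2\<close> is \<open>ln \<bar>z + i l\<bar>\<close>. An additive constant is harmless below, so
  the exact evaluation is replaced by \<open>ln s \<le> s / m - 1 + ln m\<close> for \<open>s = sqrt \<bar>p\<bar> + sqrt l\<close> and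
  \<open>m = sqrt \<bar>z + i l\<bar>\<close>.\<close>

lemma Pphi_lower_log:
  assumes l: "l \<ge> 0" and c: "\<And>p. p \<noteq> 0 \<Longrightarrow> \<phi> p \<ge> c - ln (p\<^sup>2 + l\<^sup>2) / 2" and z: "Im z > 0"
  shows "Pphi z \<ge> c - 2 * (1 + sqrt_const) - ln (cmod (z + \<i> * of_real l))"
proof -
  let ?P = "\<lambda>p. Im z / ((p - Re z)\<^sup>2 + (Im z)\<^sup>2)"
  define x y where "x = Re z" and "y = Im z"
  define N where "N = cmod (z + \<i> * of_real l)"
  define m where "m = sqrt N"
  have y: "y > 0" using z by (simp add: y_def)
  have Nb: "\<bar>x\<bar> \<le> N" "y \<le> N" "l \<le> N"
    using abs_Re_le_cmod[of "z + \<i> * of_real l"] abs_Im_le_cmod[of "z + \<i> * of_real l"] y l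
    by (simp_all add: N_def x_def y_def)
  have N: "N > 0" using Nb y by linarith
  have m: "m > 0" "m * m = N" using N by (simp_all add: m_def)
  have mb: "sqrt \<bar>x\<bar> \<le> m" "sqrt y \<le> m" "sqrt l \<le> m" using Nb by (simp_all add: m_def)
  \<comment> \<open>The part of the lower bound that does not depend on p. As sqrt |x| and sqrt l
    are each at most m, the quotient is at most 2; with 2 ln m = ln N this gives A \<ge> c - 2 - ln
    N.\<close>
  define A where "A = c - 2 * ((sqrt \<bar>x\<bar> + sqrt l) / m - 1 + ln m)"
  have pt: "A - 2 / m * sqrt \<bar>p - x\<bar> \<le> \<phi> p" if p: "p \<noteq> 0" for p
  proof -
    define s where "s = sqrt \<bar>p\<bar> + sqrt l"
    have s: "s > 0" using p l by (simp add: s_def add_pos_nonneg)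
    \<comment> \<open>The fourth power of a sum of nonnegative numbers dominates the sum of the
      fourth powers. The logarithm of the quadratic is thereby controlled by square roots, whose
      Poisson integrals are known.\<close>
    have "p\<^sup>2 + l\<^sup>2 \<le> s ^ 4"
    proof -
      define a b where "a = sqrt \<bar>p\<bar>" and "b = sqrt l"
      have ab: "a \<ge> 0" "b \<ge> 0" "a ^ 4 = p\<^sup>2" "b ^ 4 = l\<^sup>2"
        using l power_mult[of "sqrt \<bar>p\<bar>" 2 2] power_mult[of "sqrt l" 2 2] by (simp_all add: a_def b_def)
      have "a ^ 4 + b ^ 4 \<le> (a + b) ^ 4"
      proof -
        have "(a + b) ^ 4 = a ^ 4 + b ^ 4 + (4 * a ^ 3 * b + 6 * a\<^sup>2 * b\<^sup>2 + 4 * a * b ^ 3)"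
          by algebra
        moreover have "0 \<le> 4 * a ^ 3 * b + 6 * a\<^sup>2 * b\<^sup>2 + 4 * a * b ^ 3" using ab by simp
        ultimately show ?thesis by linarith
      qed
      then show ?thesis using ab by (simp add: s_def a_def b_def)
    qed
    moreover have "p\<^sup>2 + l\<^sup>2 > 0" using p by (simp add: add_pos_nonneg)
    ultimately have "ln (p\<^sup>2 + l\<^sup>2) \<le> ln (s ^ 4)" using s by (subst ln_le_cancel_iff) auto
    also have "\<dots> = 4 * ln s" using s by (simp add: ln_realpow)
    finally have 1: "ln (p\<^sup>2 + l\<^sup>2) / 2 \<le> 2 * ln s" by simp
    have "ln s = ln (s / m) + ln m" using s m by (simp add: ln_div)
    also have "\<dots> \<le> s / m - 1 + ln m" using s m by (intro add_right_mono ln_le_minus_one) simp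
    finally have 2: "ln s \<le> s / m - 1 + ln m" .
    have "sqrt \<bar>p\<bar> \<le> sqrt (\<bar>p - x\<bar> + \<bar>x\<bar>)" by (intro real_sqrt_le_mono) linarith
    also have "\<dots> \<le> sqrt \<bar>p - x\<bar> + sqrt \<bar>x\<bar>" by (rule sqrt_add_le_add_sqrt) auto
    finally have "s / m \<le> (sqrt \<bar>p - x\<bar> + sqrt \<bar>x\<bar> + sqrt l) / m"
      using m by (intro divide_right_mono) (auto simp: s_def)
    then have 3: "s / m \<le> sqrt \<bar>p - x\<bar> / m + (sqrt \<bar>x\<bar> + sqrt l) / m" by (simp add: add_divide_distrib)
    have "c - 2 * ((sqrt \<bar>x\<bar> + sqrt l) / m - 1 + ln m) - 2 * (sqrt \<bar>p - x\<bar> / m) \<le> \<phi> p"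
      using 1 2 3 c[OF p] by (simp only: algebra_simps)
    then show ?thesis by (simp add: A_def)
  qed
  have iP: "integrable lborel (\<lambda>p. ?P p * A)" by (intro integrable_mult_left integrable_Poisson z)
  have iS: "integrable lborel (\<lambda>p. 2 / m * (?P p * sqrt \<bar>p - x\<bar>))"
    unfolding x_def by (intro integrable_mult_right sqrt_shift_integrable z)
  have "(LINT p|lborel. ?P p * A - 2 / m * (?P p * sqrt \<bar>p - x\<bar>)) \<le> (LINT p|lborel. ?P p * \<phi> p)"
  proof (rule integral_mono_AE)
    show "integrable lborel (\<lambda>p. ?P p * A - 2 / m * (?P p * sqrt \<bar>p - x\<bar>))" using iP iS by (rule Bochner_Integration.integrable_diff)
    show "integrable lborel (\<lambda>p. ?P p * \<phi> p)" by (rule Poisson_phi_integrable[OF z])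
    have "AE p in lborel. p \<noteq> (0::real)" by (rule AE_lborel_singleton)
    then show "AE p in lborel. ?P p * A - 2 / m * (?P p * sqrt \<bar>p - x\<bar>) \<le> ?P p * \<phi> p"
    proof eventually_elim
      fix p :: real assume p: "p \<noteq> 0"
      have "?P p * A - 2 / m * (?P p * sqrt \<bar>p - x\<bar>) = ?P p * (A - 2 / m * sqrt \<bar>p - x\<bar>)" by (simp only: right_diff_distrib mult.left_commute)
      also have "\<dots> \<le> ?P p * \<phi> p" using z by (intro mult_left_mono pt p) auto
      finally show "?P p * A - 2 / m * (?P p * sqrt \<bar>p - x\<bar>) \<le> ?P p * \<phi> p" .
    qed
  qed
  also have "(LINT p|lborel. ?P p * A - 2 / m * (?P p * sqrt \<bar>p - x\<bar>)) = pi * A - 2 / m * (pi * sqrt_const * sqrt y)"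
  proof -
    have "(LINT p|lborel. ?P p * A - 2 / m * (?P p * sqrt \<bar>p - x\<bar>)) =
      (LINT p|lborel. ?P p * A) - (LINT p|lborel. 2 / m * (?P p * sqrt \<bar>p - x\<bar>))"
      by (rule Bochner_Integration.integral_diff[OF iP iS])
    also have "(LINT p|lborel. ?P p * A) = pi * A" unfolding integral_mult_left_zero integral_Poisson[OF z] ..
    also have "(LINT p|lborel. 2 / m * (?P p * sqrt \<bar>p - x\<bar>)) = 2 / m * (pi * sqrt_const * sqrt y)"
      unfolding integral_mult_right_zero x_def y_def sqrt_shift_integral[OF z] ..
    finally show ?thesis .
  qed
  finally have "pi * (A - 2 * sqrt_const * (sqrt y / m)) \<le> pi * Pphi z"
    by (simp add: Pphi_def algebra_simps)
  then have 4: "A - 2 * sqrt_const * (sqrt y / m) \<le> Pphi z" by simp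
  have "sqrt y / m \<le> 1" using mb m by simp
  then have 5: "2 * sqrt_const * (sqrt y / m) \<le> 2 * sqrt_const * 1" by (intro mult_left_mono) (use sqrt_const_nonneg in auto)
  define q where "q = (sqrt \<bar>x\<bar> + sqrt l) / m"
  have "sqrt \<bar>x\<bar> + sqrt l \<le> 2 * m" using mb by linarith
  then have "q \<le> 2" using m unfolding q_def by (simp add: pos_divide_le_eq)
  moreover have "ln m = ln N / 2" using N by (simp add: m_def ln_sqrt)
  ultimately have 6: "c - 2 - ln N \<le> A" unfolding A_def q_def[symmetric] by (simp add: algebra_simps)
  show ?thesis using 4 5 6 unfolding N_def by (simp add: algebra_simps)
qed

lemma inverse_F_sq:
  assumes "Im z > 0"
  shows "cmod (1 / (F z)\<^sup>2) = exp (- 2 * Pphi z)"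
proof -
  have "cmod (1 / (F z)\<^sup>2) = 1 / (exp (Pphi z))\<^sup>2" by (simp add: norm_divide norm_power cmod_F[OF assms])
  also have "\<dots> = exp (- 2 * Pphi z)" by (simp add: exp_minus inverse_eq_divide flip: exp_double)
  finally show ?thesis .
qed

lemma inverse_F_bound_const:
  assumes c: "\<And>p. p \<noteq> 0 \<Longrightarrow> \<phi> p \<ge> c" and z: "Im z > 0"
  shows "cmod (1 / (F z)\<^sup>2) \<le> exp (- 2 * c)"
  unfolding inverse_F_sq[OF z] using Pphi_lower_const[OF c z] by simp

text \<open>\<open>Pphi_lower_log\<close> allows \<open>1 / F\<^sup>2\<close> to grow at most like
  |z + i l|^2, which is precisely what the divisor removes; the exponent is twice the constant found
  there.\<close>

lemma inverse_F_bound_log: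
  assumes l: "l \<ge> 0" and c: "\<And>p. p \<noteq> 0 \<Longrightarrow> \<phi> p \<ge> c - ln (p\<^sup>2 + l\<^sup>2) / 2" and z: "Im z > 0"
  shows "cmod (1 / (F z)\<^sup>2 / (z + \<i> * of_real l)\<^sup>2) \<le> exp (4 * (1 + sqrt_const) - 2 * c)"
proof -
  define N where "N = cmod (z + \<i> * of_real l)"
  have "z + \<i> * of_real l \<noteq> 0" using l z by (auto simp: complex_eq_iff)
  then have N: "N > 0" by (simp add: N_def)
  have "cmod (1 / (F z)\<^sup>2) \<le> exp (4 * (1 + sqrt_const) - 2 * c + 2 * ln N)"
    unfolding inverse_F_sq[OF z] using Pphi_lower_log[OF l c z] by (simp add: N_def)
  also have "\<dots> = exp (4 * (1 + sqrt_const) - 2 * c) * N\<^sup>2"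
    using N by (simp add: exp_add exp_double)
  finally have le: "cmod (1 / (F z)\<^sup>2) \<le> exp (4 * (1 + sqrt_const) - 2 * c) * N\<^sup>2" .
  have "cmod (1 / (F z)\<^sup>2 / (z + \<i> * of_real l)\<^sup>2) = cmod (1 / (F z)\<^sup>2) / N\<^sup>2"
    unfolding N_def norm_divide norm_power ..
  moreover have "N\<^sup>2 > 0" using N by simp
  ultimately show ?thesis using le by (simp only: pos_divide_le_eq)
qed

end

section \<open>The data attached to a measure\<close>

locale nu_data = finite_measure \<nu> for \<nu> :: "ennreal measure" +
  assumes sets_nu [measurable_cong]: "sets \<nu> = sets borel"
    and nonnull: "\<nu> \<noteq> null_measure borel"
begin

section \<open>The function Psi, its kernel and its lower bounds\<close>

definition kap :: "real \<Rightarrow> ennreal \<Rightarrow> real" where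
  "kap p l = (if l = \<infinity> then 1 else (1 + (enn2real l)\<^sup>2) / (p\<^sup>2 + (enn2real l)\<^sup>2))"

lemma space_nu [simp]: "space \<nu> = UNIV"
  using sets_eq_imp_space_eq[OF sets_nu] by simp

lemma kap_measurable [measurable]:
  assumes [measurable]: "f \<in> borel_measurable M" "g \<in> borel_measurable M"
  shows "(\<lambda>x. kap (f x) (g x)) \<in> borel_measurable M"
  unfolding kap_def by measurable

lemma kap_nonneg: "kap p l \<ge> 0"
  by (simp add: kap_def)

lemma kap_even: "kap (- p) l = kap p l"
  by (simp add: kap_def)

text \<open>After cancelling 1 + t the claim is x^2 + t \<le> max 1 (x^2 / p^2) (p^2 + t).
  Integrated over \<open>\<nu>\<close>, it says that ln Psi has Lipschitz constant 2 in ln |p|, so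
  the logarithm of the square root has constant 1, as \<open>log_weight\<close> demands.\<close>

lemma kap_ratio:
  assumes "p \<noteq> 0" "x \<noteq> 0"
  shows "kap p l \<le> max 1 (x\<^sup>2 / p\<^sup>2) * kap x l"
proof (cases "l = \<infinity>")
  case False
  define t where "t = (enn2real l)\<^sup>2"
  have t: "t \<ge> 0" by (simp add: t_def)
  have p: "p\<^sup>2 > 0" "x\<^sup>2 > 0" using assms by simp_all
  have "x\<^sup>2 + t \<le> max 1 (x\<^sup>2 / p\<^sup>2) * (p\<^sup>2 + t)"
  proof -
    have "x\<^sup>2 = x\<^sup>2 / p\<^sup>2 * p\<^sup>2" using p by simp
    also have "\<dots> \<le> max 1 (x\<^sup>2 / p\<^sup>2) * p\<^sup>2" by (intro mult_right_mono) auto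
    finally have "x\<^sup>2 \<le> max 1 (x\<^sup>2 / p\<^sup>2) * p\<^sup>2" .
    moreover have "1 * t \<le> max 1 (x\<^sup>2 / p\<^sup>2) * t" using t by (intro mult_right_mono) auto
    ultimately show ?thesis by (simp add: distrib_left)
  qed
  moreover have pos: "p\<^sup>2 + t > 0" "x\<^sup>2 + t > 0" using p t by (simp_all add: add_pos_nonneg)
  ultimately have "1 / (p\<^sup>2 + t) \<le> max 1 (x\<^sup>2 / p\<^sup>2) * (1 / (x\<^sup>2 + t))"
    by (simp add: pos_divide_le_eq pos_le_divide_eq mult.commute)
  then have "(1 + t) * (1 / (p\<^sup>2 + t)) \<le> (1 + t) * (max 1 (x\<^sup>2 / p\<^sup>2) * (1 / (x\<^sup>2 + t)))"
    using t by (intro mult_left_mono) auto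
  then show ?thesis using False by (simp add: kap_def t_def mult_ac)
qed (simp add: kap_def)

lemma kap_integrable:
  assumes p: "p \<noteq> 0"
  shows "integrable \<nu> (kap p)"
proof (rule integrable_const_bound[where B = "1 + 1 / p\<^sup>2"])
  have "kap p l \<le> 1 + 1 / p\<^sup>2" for l
  proof -
    have "kap p l \<le> max 1 (1\<^sup>2 / p\<^sup>2) * kap 1 l" by (rule kap_ratio) (use p in auto)
    also have "kap 1 l = 1" by (simp add: kap_def add_pos_nonneg)
    also have "max 1 (1\<^sup>2 / p\<^sup>2) * 1 \<le> 1 + 1 / p\<^sup>2" by simp
    finally show ?thesis .
  qed
  then show "AE l in \<nu>. norm (kap p l) \<le> 1 + 1 / p\<^sup>2" using kap_nonneg by simp
qed measurable

lemma Psi_eq: "Psi \<nu> p = 1 / pi * (LINT l|\<nu>. kap p l)"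
  by (simp add: Psi_def kap_def)

lemma measure_nu_pos: "measure \<nu> UNIV > 0"
proof (rule ccontr)
  assume "\<not> measure \<nu> UNIV > 0"
  then have 0: "emeasure \<nu> UNIV = 0" by (simp add: emeasure_eq_measure not_less measure_le_0_iff)
  have "\<nu> = null_measure borel"
  proof (rule measure_eqI)
    show "emeasure \<nu> A = emeasure (null_measure borel) A" if "A \<in> sets \<nu>" for A
      using emeasure_mono[of A UNIV \<nu>] 0 sets.top[of \<nu>] by simp
  qed (simp add: sets_nu)
  then show False using nonnull by contradiction
qed

text \<open>Any nonnegative minorant of the kernel can be integrated. One minorant uses all of
  \<open>\<nu>\<close>; the other two use only the atom at an end point.\<close>

lemma Psi_lower:
  assumes p: "p \<noteq> 0" and m: "m \<in> borel_measurable borel" "\<And>l. 0 \<le> m l" "\<And>l. m l \<le> kap p l"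
  shows "(LINT l|\<nu>. m l) / pi \<le> Psi \<nu> p"
proof -
  have "(LINT l|\<nu>. m l) \<le> (LINT l|\<nu>. kap p l)"
  proof (rule integral_mono)
    show "integrable \<nu> m"
    proof (rule Bochner_Integration.integrable_bound[OF kap_integrable[OF p]])
      show "AE l in \<nu>. norm (m l) \<le> norm (kap p l)" using m kap_nonneg by simp
    qed (use m(1) in measurable)
  qed (use kap_integrable[OF p] m in auto)
  then show ?thesis by (simp add: Psi_eq divide_right_mono)
qed

text \<open>The estimate min(1, r^2) (p^2 + t) \<le> p^2 + r^2 t \<le> (1 + t) (p^2 + r^2) holds for
  every t, so the entire mass of \<open>\<nu>\<close> counts wherever it sits. The constant
  degenerates as r tends to 0, which is why the end point 0 needs its own bound.\<close>

lemma Psi_lower_interior: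
  assumes p: "p \<noteq> 0" and r: "r > 0"
  shows "min 1 (r\<^sup>2) * measure \<nu> UNIV / pi / (p\<^sup>2 + r\<^sup>2) \<le> Psi \<nu> p"
proof -
  have pos: "p\<^sup>2 + r\<^sup>2 > 0" using p by (simp add: add_pos_nonneg)
  have "min 1 (r\<^sup>2) / (p\<^sup>2 + r\<^sup>2) \<le> kap p l" for l
  proof (cases "l = \<infinity>")
    case True
    have "min 1 (r\<^sup>2) \<le> p\<^sup>2 + r\<^sup>2" by (simp add: min.coboundedI2)
    then show ?thesis using True pos by (simp add: kap_def)
  next
    case False
    define t where "t = (enn2real l)\<^sup>2"
    have t: "t \<ge> 0" "p\<^sup>2 + t > 0" using p by (simp_all add: t_def add_pos_nonneg)
    have "min 1 (r\<^sup>2) * (p\<^sup>2 + t) \<le> (1 + t) * (p\<^sup>2 + r\<^sup>2)"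
    proof -
      have "min 1 (r\<^sup>2) * p\<^sup>2 \<le> 1 * p\<^sup>2" by (intro mult_right_mono) auto
      moreover have "min 1 (r\<^sup>2) * t \<le> r\<^sup>2 * t" using t by (intro mult_right_mono) auto
      ultimately have "min 1 (r\<^sup>2) * (p\<^sup>2 + t) \<le> p\<^sup>2 + r\<^sup>2 * t" by (simp add: distrib_left)
      also have "\<dots> \<le> (1 + t) * (p\<^sup>2 + r\<^sup>2)" using t by (simp add: algebra_simps)
      finally show ?thesis .
    qed
    then have "min 1 (r\<^sup>2) / (p\<^sup>2 + r\<^sup>2) \<le> (1 + t) / (p\<^sup>2 + t)"
      using t pos by (simp add: pos_divide_le_eq pos_le_divide_eq)
    then show ?thesis using False by (simp add: kap_def t_def)
  qed
  then have "(LINT l|\<nu>. min 1 (r\<^sup>2) / (p\<^sup>2 + r\<^sup>2)) / pi \<le> Psi \<nu> p"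
    by (intro Psi_lower p) (use pos in \<open>auto intro: divide_nonneg_nonneg\<close>)
  then show ?thesis by (simp add: mult_ac)
qed

text \<open>Only the atom is kept. The summand \<open>0\<^sup>2\<close> gives the bound the shape c
  / (p^2 + r^2) with r = 0, as \<open>hardy_pair_inv_F_shift\<close> expects it.\<close>

lemma Psi_lower_zero:
  assumes p: "p \<noteq> 0"
  shows "measure \<nu> {0} / pi / (p\<^sup>2 + 0\<^sup>2) \<le> Psi \<nu> p"
proof -
  have "(LINT l|\<nu>. indicator {0} l * (1 / p\<^sup>2)) / pi \<le> Psi \<nu> p"
    by (rule Psi_lower[OF p]) (use kap_nonneg in \<open>auto simp: kap_def split: split_indicator\<close>)
  then show ?thesis by (simp add: mult_ac)
qed

lemma Psi_lower_infinity:
  assumes p: "p \<noteq> 0"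
  shows "measure \<nu> {\<infinity>} / pi \<le> Psi \<nu> p"
proof -
  have "(LINT l|\<nu>. indicator {\<infinity>} l) / pi \<le> Psi \<nu> p"
    by (rule Psi_lower[OF p]) (use kap_nonneg in \<open>auto simp: kap_def split: split_indicator\<close>)
  then show ?thesis by simp
qed

lemma Psi_pos:
  assumes p: "p \<noteq> 0"
  shows "Psi \<nu> p > 0"
proof -
  have "0 < min 1 (1\<^sup>2) * measure \<nu> UNIV / pi / (p\<^sup>2 + 1\<^sup>2)"
    using measure_nu_pos by (simp add: add_nonneg_pos)
  also have "\<dots> \<le> Psi \<nu> p" by (rule Psi_lower_interior[OF p]) simp
  finally show ?thesis .
qed

lemma Psi_even: "Psi \<nu> (- p) = Psi \<nu> p"
  by (simp add: Psi_eq kap_even)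

lemma Psi_ratio:
  assumes p: "p \<noteq> 0" and x: "x \<noteq> 0"
  shows "Psi \<nu> p \<le> max 1 (x\<^sup>2 / p\<^sup>2) * Psi \<nu> x"
proof -
  have "(LINT l|\<nu>. kap p l) \<le> (LINT l|\<nu>. max 1 (x\<^sup>2 / p\<^sup>2) * kap x l)"
    by (intro integral_mono kap_integrable p integrable_mult_right x kap_ratio)
  also have "\<dots> = max 1 (x\<^sup>2 / p\<^sup>2) * (LINT l|\<nu>. kap x l)" by (rule integral_mult_right_zero)
  finally show ?thesis by (simp add: Psi_eq divide_right_mono)
qed

lemma ln_Psi_diff:
  assumes p: "p \<noteq> 0" and x: "x \<noteq> 0"
  shows "ln (sqrt (Psi \<nu> p)) - ln (sqrt (Psi \<nu> x)) \<le> \<bar>ln \<bar>p\<bar> - ln \<bar>x\<bar>\<bar>"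
proof -
  have pos: "Psi \<nu> p > 0" "Psi \<nu> x > 0" using Psi_pos p x by auto
  have "ln (Psi \<nu> p) \<le> ln (max 1 (x\<^sup>2 / p\<^sup>2) * Psi \<nu> x)"
    using pos Psi_ratio[OF p x] by (subst ln_le_cancel_iff) auto
  also have "\<dots> = ln (max 1 (x\<^sup>2 / p\<^sup>2)) + ln (Psi \<nu> x)" using pos by (intro ln_mult_pos) auto
  also have "ln (max 1 (x\<^sup>2 / p\<^sup>2)) \<le> 2 * \<bar>ln \<bar>p\<bar> - ln \<bar>x\<bar>\<bar>"
  proof -
    have "ln (x\<^sup>2 / p\<^sup>2) = 2 * (ln \<bar>x\<bar> - ln \<bar>p\<bar>)"
    proof -
      have "x\<^sup>2 / p\<^sup>2 = (\<bar>x\<bar> / \<bar>p\<bar>) ^ 2" by (simp add: power_divide)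
      then show ?thesis using p x by (simp add: ln_realpow ln_div del: power_abs)
    qed
    then show ?thesis by (auto simp: max_def abs_if)
  qed
  finally show ?thesis using pos by (simp add: ln_sqrt)
qed

sublocale log_weight "\<lambda>p. ln (sqrt (Psi \<nu> p))"
proof
  have "(\<lambda>p. Psi \<nu> p) \<in> borel_measurable borel" unfolding Psi_eq by measurable
  then show "(\<lambda>p. ln (sqrt (Psi \<nu> p))) \<in> borel_measurable borel" by measurable
  show "ln (sqrt (Psi \<nu> (- p))) = ln (sqrt (Psi \<nu> p))" for p by (simp add: Psi_even)
  show "\<bar>ln (sqrt (Psi \<nu> p)) - ln (sqrt (Psi \<nu> x))\<bar> \<le> \<bar>ln \<bar>p\<bar> - ln \<bar>x\<bar>\<bar>" if "p \<noteq> 0" "x \<noteq> 0" for p x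
    using ln_Psi_diff[OF that] ln_Psi_diff[OF that(2,1)] by linarith
qed

lemma F_outer_eq: "F_outer \<nu> = F"
  by (simp add: fun_eq_iff F_outer_def F_def G_def ker_def)

lemma F_boundary_eq: "x \<noteq> 0 \<Longrightarrow> F_boundary \<nu> x = Fb x"
  unfolding F_boundary_def F_outer_eq by (intro tendsto_Lim trivial_limit_at_right_real F_tendsto)

lemma Fb_nonzero [simp]: "Fb x \<noteq> 0"
  by (simp add: Fb_def)

lemma cmod_Fb_sq: "x \<noteq> 0 \<Longrightarrow> (cmod (Fb x))\<^sup>2 = Psi \<nu> x"
  using Psi_pos[of x] by (simp add: cmod_Fb)

lemma h_fun_eq:
  assumes x: "x \<noteq> 0"
  shows "h_fun \<nu> x = of_real (Psi \<nu> x) / (Fb (- x))\<^sup>2"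
proof -
  have "of_real (Psi \<nu> x) = Fb x * Fb (- x)"
    unfolding Fb_reflect[OF x] using complex_norm_square[of "Fb x"] by (simp add: cmod_Fb_sq[OF x] flip: of_real_power)
  then show ?thesis using x by (simp add: h_fun_def F_boundary_eq power2_eq_square)
qed

lemma h_fun_cmod: "x \<noteq> 0 \<Longrightarrow> cmod (h_fun \<nu> x) = 1"
  by (simp add: h_fun_def F_boundary_eq Fb_reflect norm_divide)

lemma h_fun_measurable [measurable]: "h_fun \<nu> \<in> borel_measurable borel"
proof -
  have "(\<lambda>x. if x = 0 then h_fun \<nu> 0 else Fb x / Fb (- x)) \<in> borel_measurable borel" by measurable
  also have "(\<lambda>x. if x = 0 then h_fun \<nu> 0 else Fb x / Fb (- x)) = h_fun \<nu>"
    by (auto simp: fun_eq_iff h_fun_def F_boundary_eq)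
  finally show ?thesis .
qed

text \<open>The imaginary axis is fixed by the reflection z to -cnj z, so \<open>F\<close> is real
  there. The residue carries 1 / F^2, whereas the weight of \<open>T_measure\<close> carries 1 /
  |F|^2.\<close>

lemma F_imaginary:
  assumes "r > 0"
  shows "(F (\<i> * of_real r))\<^sup>2 = of_real ((cmod (F (\<i> * of_real r)))\<^sup>2)"
proof -
  have "- cnj (\<i> * of_real r) = \<i> * of_real r" by (simp add: complex_eq_iff)
  then have "cnj (F (\<i> * of_real r)) = F (\<i> * of_real r)" using F_reflect[of "\<i> * of_real r"] assms by simp
  then show ?thesis using complex_norm_square[of "F (\<i> * of_real r)"] by (simp add: power2_eq_square)
qed

end

section \<open>The reflected form as an integral over the imaginary axis\<close>

text \<open>This makes the sesquilinear problem bilinear: the conjugate of g(-x) is again the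
  boundary value of a Hardy function, whose restriction to the imaginary axis is the conjugate of
  that of \<open>f\<close>. Cauchy's theorem for products then applies.\<close>

lemma hardy_pair_reflect:
  assumes p: "hardy_pair f g"
  shows "hardy_pair (\<lambda>z. cnj (f (- cnj z))) (\<lambda>x. cnj (g (- x)))"
  unfolding hardy_pair_def
proof (intro conjI)
  have "(\<lambda>z. f (- z)) holomorphic_on cnj ` UHP"
  proof -
    have "(f \<circ> (\<lambda>z. - z)) holomorphic_on cnj ` UHP"
      by (rule holomorphic_on_compose_gen[OF holomorphic_on_minus[OF holomorphic_on_ident] hardy_pairD(1)[OF p]]) auto
    then show ?thesis by (simp add: o_def)
  qed
  then have "(cnj \<circ> (\<lambda>z. f (- z)) \<circ> cnj) holomorphic_on UHP"
    by (intro holomorphic_on_compose_cnj_cnj) (auto simp: open_UHP)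
  then show "(\<lambda>z. cnj (f (- cnj z))) holomorphic_on UHP" by (simp add: o_def)
  have flip: "(\<lambda>x. cnj (q (- x))) \<in> vcarrier (SQ lborel)" 
    "(LINT x|lborel. (cmod (q (- x)))\<^sup>2) = (LINT x|lborel. (cmod (q x))\<^sup>2)" if q: "q \<in> vcarrier (SQ lborel)" for q :: "real \<Rightarrow> complex"
  proof -
    have [measurable]: "q \<in> borel_measurable borel" using q by (simp add: SQ_simps)
    have "integrable lborel (\<lambda>x. (cmod (q (0 + -1 * x)))\<^sup>2)"
      by (rule lborel_integrable_real_affine) (use q in \<open>auto simp: SQ_simps\<close>)
    then show "(\<lambda>x. cnj (q (- x))) \<in> vcarrier (SQ lborel)" by (simp add: SQ_simps)
    show "(LINT x|lborel. (cmod (q (- x)))\<^sup>2) = (LINT x|lborel. (cmod (q x))\<^sup>2)"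
      using lborel_integral_real_affine[of "-1" "\<lambda>x. (cmod (q x))\<^sup>2" 0] by simp
  qed
  have line: "- cnj (Complex x y) = Complex (- x) y" for x y by (simp add: complex_eq_iff)
  obtain M where M: "\<And>y. y > 0 \<Longrightarrow> (LINT x|lborel. (cmod (f (Complex x y)))\<^sup>2) \<le> M" using hardy_pair_bound[OF p] by blast
  show "\<exists>M. \<forall>y>0. (\<lambda>x. cnj (f (- cnj (Complex x y)))) \<in> vcarrier (SQ lborel) \<and>
      (LINT x|lborel. (cmod (cnj (f (- cnj (Complex x y)))))\<^sup>2) \<le> M"
    unfolding line complex_mod_cnj
    by (intro exI[of _ M] allI impI conjI flip(1)[OF hardy_pairD(3)[OF p]])
      (simp_all add: flip(2)[OF hardy_pairD(3)[OF p]] M)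
  show "(\<lambda>x. cnj (g (- x))) \<in> vcarrier (SQ lborel)" by (rule flip(1)[OF hardy_pairD(2)[OF p]])
  have "AE x in lborel. ((\<lambda>\<epsilon>. f (Complex (- x) \<epsilon>)) \<longlongrightarrow> g (- x)) (at_right 0)"
  proof -
    have "AE x in distr lborel borel uminus. ((\<lambda>\<epsilon>. f (Complex x \<epsilon>)) \<longlongrightarrow> g x) (at_right 0)"
      unfolding lborel_distr_uminus by (rule hardy_pairD(4)[OF p])
    then show ?thesis by (rule AE_distrD[rotated]) simp
  qed
  then show "AE x in lborel. ((\<lambda>\<epsilon>. cnj (f (- cnj (Complex x \<epsilon>)))) \<longlongrightarrow> cnj (g (- x))) (at_right 0)"
    unfolding line by eventually_elim (rule tendsto_cnj)
qed

context nu_data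
begin

lemma phi_lower:
  assumes "c > 0" "q > 0" "p \<noteq> 0" "c / q \<le> Psi \<nu> p"
  shows "ln c / 2 - ln q / 2 \<le> ln (sqrt (Psi \<nu> p))"
proof -
  have "ln (c / q) \<le> ln (Psi \<nu> p)" using assms Psi_pos[of p] by (subst ln_le_cancel_iff) auto
  then show ?thesis using assms Psi_pos[of p] by (simp add: ln_sqrt ln_div)
qed

text \<open>The lower bound on \<open>Psi\<close> is a hypothesis so that one statement serves
  interior points, with the constant from the total mass, and the end point r = 0, with the constant
  from its atom.\<close>

lemma hardy_pair_inv_F_shift:
  assumes p: "hardy_pair f g" and r: "r \<ge> 0" and c: "c > 0" "\<And>p. p \<noteq> 0 \<Longrightarrow> c / (p\<^sup>2 + r\<^sup>2) \<le> Psi \<nu> p"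
  shows "hardy_pair (\<lambda>z. f z * (1 / (F z)\<^sup>2 / (z + \<i> * of_real r)\<^sup>2))
    (\<lambda>x. g x * (1 / (Fb x)\<^sup>2 / (of_real x + \<i> * of_real r)\<^sup>2))"
proof (rule hardy_pair_mult_bounded[OF p])
  show "(\<lambda>z. 1 / (F z)\<^sup>2 / (z + \<i> * of_real r)\<^sup>2) holomorphic_on UHP"
  proof (intro holomorphic_intros F_holomorphic)
    show "(z + \<i> * of_real r)\<^sup>2 \<noteq> 0" if "z \<in> UHP" for z
    proof -
      have "Im (z + \<i> * of_real r) > 0" using that r by simp
      then have "z + \<i> * of_real r \<noteq> 0" by (metis less_irrefl zero_complex.simps(2))
      then show ?thesis by simp
    qed
  qed simp
  show "cmod (1 / (F z)\<^sup>2 / (z + \<i> * of_real r)\<^sup>2) \<le> exp (4 * (1 + sqrt_const) - 2 * (ln c / 2))" if "Im z > 0" for z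
    by (rule inverse_F_bound_log[OF r _ that]) (intro phi_lower c, simp_all add: add_pos_nonneg)
  show "(\<lambda>x. 1 / (Fb x)\<^sup>2 / (of_real x + \<i> * of_real r)\<^sup>2) \<in> borel_measurable borel" by measurable
  have "AE x in lborel. x \<noteq> (0::real)" by (rule AE_lborel_singleton)
  then show "AE x in lborel. ((\<lambda>\<epsilon>. 1 / (F (Complex x \<epsilon>))\<^sup>2 / (Complex x \<epsilon> + \<i> * of_real r)\<^sup>2) \<longlongrightarrow>
    1 / (Fb x)\<^sup>2 / (of_real x + \<i> * of_real r)\<^sup>2) (at_right 0)"
  proof eventually_elim
    fix x :: real assume x: "x \<noteq> 0"
    then have ne: "of_real x + \<i> * complex_of_real r \<noteq> 0" by (auto simp: complex_eq_iff)
    have "((\<lambda>\<epsilon>. 1 / (F (Complex x \<epsilon>))\<^sup>2 / (of_real x + \<i> * of_real \<epsilon> + \<i> * of_real r)\<^sup>2) \<longlongrightarrow>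
      1 / (Fb x)\<^sup>2 / (of_real x + \<i> * of_real 0 + \<i> * of_real r)\<^sup>2) (at_right 0)"
      using x by (intro tendsto_intros F_tendsto) (use ne in simp_all)
    then show "((\<lambda>\<epsilon>. 1 / (F (Complex x \<epsilon>))\<^sup>2 / (Complex x \<epsilon> + \<i> * of_real r)\<^sup>2) \<longlongrightarrow>
      1 / (Fb x)\<^sup>2 / (of_real x + \<i> * of_real r)\<^sup>2) (at_right 0)"
      by (simp add: Complex_eq)
  qed
qed

lemma hardy_pair_inv_F:
  assumes p: "hardy_pair f g" and c: "c > 0" "\<And>p. p \<noteq> 0 \<Longrightarrow> c \<le> Psi \<nu> p"
  shows "hardy_pair (\<lambda>z. f z * (1 / (F z)\<^sup>2)) (\<lambda>x. g x * (1 / (Fb x)\<^sup>2))"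
proof (rule hardy_pair_mult_bounded[OF p])
  show "(\<lambda>z. 1 / (F z)\<^sup>2) holomorphic_on UHP" by (intro holomorphic_intros F_holomorphic) simp
  show "cmod (1 / (F z)\<^sup>2) \<le> exp (- 2 * (ln c / 2))" if "Im z > 0" for z
    by (rule inverse_F_bound_const[OF _ that]) (use phi_lower[of c 1] c in auto)
  show "(\<lambda>x. 1 / (Fb x)\<^sup>2) \<in> borel_measurable borel" by measurable
  have "AE x in lborel. x \<noteq> (0::real)" by (rule AE_lborel_singleton)
  then show "AE x in lborel. ((\<lambda>\<epsilon>. 1 / (F (Complex x \<epsilon>))\<^sup>2) \<longlongrightarrow> 1 / (Fb x)\<^sup>2) (at_right 0)"
  proof eventually_elim
    fix x :: real assume x: "x \<noteq> 0"
    then show "((\<lambda>\<epsilon>. 1 / (F (Complex x \<epsilon>))\<^sup>2) \<longlongrightarrow> 1 / (Fb x)\<^sup>2) (at_right 0)"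
      by (intro tendsto_intros F_tendsto) auto
  qed
qed

text \<open>The inner integral for a fixed \<open>l\<close> is a residue in the interior; at the two end points an atom of
  \<open>\<nu>\<close> makes \<open>1 / F\<^sup>2\<close> (divided by \<open>z\<^sup>2\<close> at \<open>l = 0\<close>) bounded, so that the integral vanishes.\<close>

lemma kap_integral_interior:
  assumes p1: "hardy_pair f1 g1" and p2: "hardy_pair f2 g2" and r: "r > 0"
  shows "(LINT x|lborel. g1 x * g2 x / (Fb x)\<^sup>2 * of_real (kap x (ennreal r))) =
    of_real (pi * ((1 + r\<^sup>2) / r)) * (f1 (\<i> * of_real r) * f2 (\<i> * of_real r)) / (F (\<i> * of_real r))\<^sup>2"
proof -
  define c where "c = min 1 (r\<^sup>2) * measure \<nu> UNIV / pi"
  have c: "c > 0" using measure_nu_pos r by (simp add: c_def)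
  define B where "B z = 1 / (F z)\<^sup>2 / (z + \<i> * of_real r)\<^sup>2" for z
  define b where "b x = 1 / (Fb x)\<^sup>2 / (of_real x + \<i> * of_real r)\<^sup>2" for x
  have q: "hardy_pair (\<lambda>z. f2 z * B z) (\<lambda>x. g2 x * b x)"
    unfolding B_def b_def by (rule hardy_pair_inv_F_shift[OF p2 _ c]) (use r Psi_lower_interior in \<open>auto simp: c_def\<close>)
  have i: "integrable lborel (\<lambda>x. g1 x * (g2 x * b x))"
    by (rule SQ_mult_integrable[OF hardy_pairD(2)[OF p1] hardy_pairD(2)[OF q]])
  have i': "integrable lborel (\<lambda>x. g1 x * (g2 x * b x) / (of_real x - \<i> * of_real r))"
  proof -
    have "(\<lambda>x. g2 x * b x * (1 / (of_real x - \<i> * of_real r))) \<in> vcarrier (SQ lborel)"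
    proof (rule SQ_mult_bounded[OF hardy_pairD(2)[OF q]])
      show "AE x in lborel. cmod (1 / (of_real x - \<i> * of_real r)) \<le> 1 / r"
      proof (rule AE_I2)
        fix x
        have "r \<le> cmod (of_real x - \<i> * of_real r)" using abs_Im_le_cmod[of "of_real x - \<i> * of_real r"] r by simp
        then show "cmod (1 / (of_real x - \<i> * of_real r)) \<le> 1 / r" using r by (simp add: norm_divide frac_le)
      qed
    qed measurable
    from SQ_mult_integrable[OF hardy_pairD(2)[OF p1] this] show ?thesis by (simp add: mult.assoc)
  qed
  \<comment> \<open>With u = x + i r and v = x - i r, the identity 1 / (u v) = (1 + 2 i r / v) / u^2
    moves the pole at -i r into the bounded Hardy factor. The first summand integrates to 0, and the
    second is Cauchy's formula at i r.\<close>
  have eq: "g1 x * g2 x / (Fb x)\<^sup>2 * of_real (kap x (ennreal r)) =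
    of_real (1 + r\<^sup>2) * (g1 x * (g2 x * b x) + 2 * \<i> * of_real r * (g1 x * (g2 x * b x) / (of_real x - \<i> * of_real r)))" for x
  proof -
    define u where "u = of_real x + \<i> * complex_of_real r"
    define v where "v = of_real x - \<i> * complex_of_real r"
    have uv: "u \<noteq> 0" "v \<noteq> 0" using r by (auto simp: u_def v_def complex_eq_iff)
    have k: "complex_of_real (kap x (ennreal r)) = of_real (1 + r\<^sup>2) / (u * v)"
    proof -
      have "u * v = of_real (x\<^sup>2 + r\<^sup>2)" by (simp add: u_def v_def complex_eq_iff power2_eq_square)
      then show ?thesis using r by (simp add: kap_def)
    qed
    have "u / v = 1 + 2 * \<i> * of_real r / v" using uv by (simp add: field_simps) (simp add: u_def v_def)
    then have "1 / (u * v) = (1 + 2 * \<i> * of_real r / v) / u\<^sup>2"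
      using uv by (simp add: power2_eq_square divide_simps)
    then have k': "complex_of_real (kap x (ennreal r)) = of_real (1 + r\<^sup>2) * ((1 + 2 * \<i> * of_real r / v) / u\<^sup>2)"
      unfolding k by (metis mult.right_neutral times_divide_eq_right)
    show ?thesis unfolding k' b_def u_def[symmetric] v_def[symmetric]
      by (simp add: add_divide_distrib distrib_left distrib_right mult_ac)
  qed
  have "(LINT x|lborel. g1 x * g2 x / (Fb x)\<^sup>2 * of_real (kap x (ennreal r))) =
    of_real (1 + r\<^sup>2) * ((LINT x|lborel. g1 x * (g2 x * b x)) +
      2 * \<i> * of_real r * (LINT x|lborel. g1 x * (g2 x * b x) / (of_real x - \<i> * of_real r)))"
    unfolding eq integral_mult_right_zero
    using Bochner_Integration.integral_add[OF i integrable_mult_right[OF i', of "2 * \<i> * of_real r"]]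
    by (simp only: integral_mult_right_zero)
  also have "(LINT x|lborel. g1 x * (g2 x * b x)) = 0" by (rule hardy_pair_integral_zero[OF p1 q])
  also have "(LINT x|lborel. g1 x * (g2 x * b x) / (of_real x - \<i> * of_real r)) =
    2 * pi * \<i> * f1 (\<i> * of_real r) * (f2 (\<i> * of_real r) * B (\<i> * of_real r))"
    by (rule hardy_pair_Cauchy_formula[OF p1 q]) (use r in simp)
  also have "of_real (1 + r\<^sup>2) * (0 + 2 * \<i> * of_real r * (2 * pi * \<i> * f1 (\<i> * of_real r) * (f2 (\<i> * of_real r) * B (\<i> * of_real r)))) =
    of_real (pi * ((1 + r\<^sup>2) / r)) * (f1 (\<i> * of_real r) * f2 (\<i> * of_real r)) / (F (\<i> * of_real r))\<^sup>2"
  proof -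
    define R where "R = complex_of_real r"
    have R: "R \<noteq> 0" using r by (simp add: R_def)
    have "(\<i> * R + \<i> * R)\<^sup>2 = 4 * (\<i> * \<i>) * R\<^sup>2" by algebra
    then have Beq: "B (\<i> * R) = 1 / (F (\<i> * R))\<^sup>2 * (- 1 / (4 * R\<^sup>2))"
      unfolding B_def R_def[symmetric] by simp
    have alg: "K * (0 + 2 * \<i> * R * (P * \<i> * a * (b * (Q * (- 1 / (4 * R\<^sup>2)))))) = K * (P / 2 / R) * (a * b) * Q"
      for K P a b Q :: complex
    proof -
      have "K * (0 + 2 * \<i> * R * (P * \<i> * a * (b * (Q * (- 1 / (4 * R\<^sup>2)))))) =
        (\<i> * \<i>) * 2 * K * P * a * b * Q * (R * (- 1 / (4 * R\<^sup>2)))" by (simp only: add_0_left mult_ac)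
      also have "R * (- 1 / (4 * R\<^sup>2)) = - 1 / (4 * R)" using R by (simp add: power2_eq_square)
      finally show ?thesis by simp
    qed
    show ?thesis unfolding R_def[symmetric] Beq alg by (simp add: R_def)
  qed
  finally show ?thesis .
qed

lemma kap_integral_zero:
  assumes p1: "hardy_pair f1 g1" and p2: "hardy_pair f2 g2" and nu: "emeasure \<nu> {0} \<noteq> 0"
  shows "(LINT x|lborel. g1 x * g2 x / (Fb x)\<^sup>2 * of_real (kap x 0)) = 0"
proof -
  have c: "measure \<nu> {0} / pi > 0" using nu by (simp add: emeasure_eq_measure zero_less_measure_iff)
  have "hardy_pair (\<lambda>z. f2 z * (1 / (F z)\<^sup>2 / (z + \<i> * of_real 0)\<^sup>2)) (\<lambda>x. g2 x * (1 / (Fb x)\<^sup>2 / (of_real x + \<i> * of_real 0)\<^sup>2))"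
    by (rule hardy_pair_inv_F_shift[OF p2 order_refl c Psi_lower_zero])
  from hardy_pair_integral_zero[OF p1 this] show ?thesis by (simp add: kap_def mult_ac)
qed

lemma kap_integral_infinity:
  assumes p1: "hardy_pair f1 g1" and p2: "hardy_pair f2 g2" and nu: "emeasure \<nu> {\<infinity>} \<noteq> 0"
  shows "(LINT x|lborel. g1 x * g2 x / (Fb x)\<^sup>2 * of_real (kap x \<infinity>)) = 0"
proof -
  have c: "measure \<nu> {\<infinity>} / pi > 0" using nu by (simp add: emeasure_eq_measure zero_less_measure_iff)
  have "hardy_pair (\<lambda>z. f2 z * (1 / (F z)\<^sup>2)) (\<lambda>x. g2 x * (1 / (Fb x)\<^sup>2))"
    by (rule hardy_pair_inv_F[OF p2 c Psi_lower_infinity])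
  from hardy_pair_integral_zero[OF p1 this] show ?thesis by (simp add: kap_def mult_ac)
qed

end

section \<open>Transport of the reflected form to the measure on the imaginary axis\<close>

context nu_data
begin

definition T_weight :: "real \<Rightarrow> real" where
  "T_weight l = 1 / (cmod (F (\<i> * of_real l)))\<^sup>2 * ((1 + l\<^sup>2) / l)"

lemma vertical_measurable:
  assumes "f holomorphic_on UHP"
  shows "(\<lambda>l. f (\<i> * of_real l)) \<in> borel_measurable (restrict_space borel {0<..})"
proof (rule borel_measurable_continuous_on_restrict)
  show "continuous_on {0<..} (\<lambda>l. f (\<i> * of_real l))"
    by (rule continuous_on_compose2[OF holomorphic_on_imp_continuous_on[OF assms]]) (auto intro!: continuous_intros)
qed

lemma T_weight_measurable: "T_weight \<in> borel_measurable (restrict_space borel {0<..})"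
proof -
  have [measurable]: "(\<lambda>l. F (\<i> * of_real l)) \<in> borel_measurable (restrict_space borel {0<..})"
    by (rule vertical_measurable[OF F_holomorphic])
  have [measurable]: "(\<lambda>l. l) \<in> borel_measurable (restrict_space borel {0<..})"
    by (rule measurable_restrict_space1) simp
  show ?thesis unfolding T_weight_def by measurable
qed

lemma T_weight_nonneg: "l > 0 \<Longrightarrow> T_weight l \<ge> 0"
  by (simp add: T_weight_def)

lemma T_measure_eq: "T_measure \<nu> = density
    (distr (restrict_space \<nu> {0<..<\<infinity>}) (restrict_space borel {0<..}) enn2real) T_weight"
  by (simp add: T_measure_def F_outer_eq T_weight_def)

lemma enn2real_restrict_measurable:
  "enn2real \<in> measurable (restrict_space \<nu> {0<..<\<infinity>}) (restrict_space borel {0<..})"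
proof (rule measurable_restrict_space3)
  show "enn2real \<in> borel_measurable \<nu>" by measurable
  show "enn2real \<in> {0<..<\<infinity>} \<rightarrow> {0<..}" by (auto simp: enn2real_positive_iff)
qed

lemma interior_sets: "{0<..<\<infinity>} \<inter> space \<nu> \<in> sets \<nu>"
  using sets_nu by simp

lemma sets_T [measurable_cong]: "sets (T_measure \<nu>) = sets (restrict_space borel {0<..})"
  by (simp add: T_measure_eq)

lemma space_T: "space (T_measure \<nu>) = {0<..}"
  by (simp add: T_measure_eq space_restrict_space)

text \<open>Integrals over the weighted image measure are pulled back to \<open>\<nu>\<close> with
  an indicator of the interior, so that Fubini and almost-everywhere identities can be used on all
  of [0,\<infinity>], end points included.\<close>

lemma
  fixes q :: "real \<Rightarrow> 'b :: {banach, second_countable_topology}"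
  assumes q: "q \<in> borel_measurable (restrict_space borel {0<..})"
  shows integrable_T_iff: "integrable (T_measure \<nu>) q \<longleftrightarrow>
      integrable \<nu> (\<lambda>l. indicator {0<..<\<infinity>} l *\<^sub>R (T_weight (enn2real l) *\<^sub>R q (enn2real l)))"
    and integral_T: "integral\<^sup>L (T_measure \<nu>) q =
      (LINT l|\<nu>. indicator {0<..<\<infinity>} l *\<^sub>R (T_weight (enn2real l) *\<^sub>R q (enn2real l)))"
proof -
  let ?D = "distr (restrict_space \<nu> {0<..<\<infinity>}) (restrict_space borel {0<..}) enn2real"
  have qD: "q \<in> borel_measurable ?D" "T_weight \<in> borel_measurable ?D"
    using q T_weight_measurable by simp_all
  have nn: "AE l in ?D. 0 \<le> T_weight l"
    by (rule AE_I2) (simp add: space_restrict_space T_weight_nonneg)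
  have wq: "(\<lambda>l. T_weight l *\<^sub>R q l) \<in> borel_measurable (restrict_space borel {0<..})"
    using q T_weight_measurable by measurable
  show "integrable (T_measure \<nu>) q \<longleftrightarrow>
      integrable \<nu> (\<lambda>l. indicator {0<..<\<infinity>} l *\<^sub>R (T_weight (enn2real l) *\<^sub>R q (enn2real l)))"
    unfolding T_measure_eq integrable_density[OF qD nn] integrable_distr_eq[OF enn2real_restrict_measurable wq]
      integrable_restrict_space[OF interior_sets] ..
  show "integral\<^sup>L (T_measure \<nu>) q =
      (LINT l|\<nu>. indicator {0<..<\<infinity>} l *\<^sub>R (T_weight (enn2real l) *\<^sub>R q (enn2real l)))"
    unfolding T_measure_eq integral_density[OF qD nn] integral_distr[OF enn2real_restrict_measurable wq]
      integral_restrict_space[OF interior_sets] ..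
qed

lemma nu_AE_atom: "emeasure \<nu> {a} = 0 \<Longrightarrow> AE l in \<nu>. l \<noteq> a"
  by (rule AE_I[of _ _ "{a}"]) (auto simp: sets_nu)

text \<open>The inner integral \<open>J\<close> is, almost everywhere in \<open>\<nu>\<close>, pi
  times the weighted product of the two restrictions. As a partial integral of an integrable
  function \<open>J\<close> is integrable, so integrability on the imaginary axis is a by-product of
  Fubini rather than a condition to be checked first.\<close>

lemma reflected_form_aux:
  assumes p1: "hardy_pair f1 g1" and p2: "hardy_pair f2 g2"
  shows "integrable (T_measure \<nu>) (\<lambda>l. f1 (\<i> * of_real l) * f2 (\<i> * of_real l))"
    and "(LINT x|lborel. g1 x * g2 x / (Fb x)\<^sup>2 * of_real (Psi \<nu> x)) =
      (LINT l|T_measure \<nu>. f1 (\<i> * of_real l) * f2 (\<i> * of_real l))"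
proof -
  interpret pair_sigma_finite "lborel :: real measure" \<nu> ..
  define v where "v x = g1 x * g2 x / (Fb x)\<^sup>2" for x
  define J where "J l = (LINT x|lborel. v x * of_real (kap x l))" for l
  define q where "q l = f1 (\<i> * of_real l) * f2 (\<i> * of_real l)" for l
  have [measurable]: "g1 \<in> borel_measurable borel" "g2 \<in> borel_measurable borel"
    using hardy_pairD(2)[OF p1] hardy_pairD(2)[OF p2] by (simp_all add: SQ_simps)
  have [measurable]: "v \<in> borel_measurable borel" unfolding v_def by measurable
  have ne: "AE x in lborel. x \<noteq> (0::real)" by (rule AE_lborel_singleton)
  \<comment> \<open>The modulus |Fb|^2 in the denominator cancels \<open>Psi\<close> exactly, so
    absolute integrability reduces to that of a product of two square-integrable functions.\<close>
  have vabs: "norm (v x) * (LINT l|\<nu>. kap x l) = pi * norm (g1 x * g2 x)" if x: "x \<noteq> 0" for x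
  proof -
    have "(LINT l|\<nu>. kap x l) = pi * Psi \<nu> x" by (simp add: Psi_eq)
    also have "Psi \<nu> x = (cmod (Fb x))\<^sup>2" using cmod_Fb_sq[OF x] by simp
    finally show ?thesis by (simp add: v_def norm_divide norm_mult norm_power)
  qed
  have int: "integrable (lborel \<Otimes>\<^sub>M \<nu>) (\<lambda>(x, l). v x * of_real (kap x l))"
  proof (rule Fubini_integrable)
    show "(\<lambda>(x, l). v x * complex_of_real (kap x l)) \<in> borel_measurable (lborel \<Otimes>\<^sub>M \<nu>)" by measurable
    have "integrable lborel (\<lambda>x. pi * norm (g1 x * g2 x))"
      by (intro integrable_mult_right integrable_norm SQ_mult_integrable hardy_pairD(2)[OF p1] hardy_pairD(2)[OF p2])
    then show "integrable lborel (\<lambda>x. LINT l|\<nu>. norm (case (x, l) of (x, l) \<Rightarrow> v x * complex_of_real (kap x l)))"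
    proof (rule integrable_cong_AE_imp)
      show "(\<lambda>x. LINT l|\<nu>. norm (case (x, l) of (x, l) \<Rightarrow> v x * complex_of_real (kap x l))) \<in> borel_measurable lborel"
        by measurable
      show "AE x in lborel. pi * norm (g1 x * g2 x) = (LINT l|\<nu>. norm (case (x, l) of (x, l) \<Rightarrow> v x * complex_of_real (kap x l)))"
        using ne
      proof eventually_elim
        fix x :: real assume x: "x \<noteq> 0"
        have "(LINT l|\<nu>. norm (case (x, l) of (x, l) \<Rightarrow> v x * complex_of_real (kap x l))) = (LINT l|\<nu>. norm (v x) * kap x l)"
          using kap_nonneg by (simp add: norm_mult)
        also have "\<dots> = norm (v x) * (LINT l|\<nu>. kap x l)" by (rule integral_mult_right_zero)
        also have "\<dots> = pi * norm (g1 x * g2 x)" by (rule vabs[OF x])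
        finally show "pi * norm (g1 x * g2 x) = (LINT l|\<nu>. norm (case (x, l) of (x, l) \<Rightarrow> v x * complex_of_real (kap x l)))" by (rule sym)
      qed
    qed
    show "AE x in lborel. integrable \<nu> (\<lambda>l. case (x, l) of (x, l) \<Rightarrow> v x * complex_of_real (kap x l))"
      using ne
    proof eventually_elim
      fix x :: real assume "x \<noteq> 0"
      then have "integrable \<nu> (\<lambda>l. v x * complex_of_real (kap x l))"
        by (intro integrable_mult_right integrable_of_real kap_integrable)
      then show "integrable \<nu> (\<lambda>l. case (x, l) of (x, l) \<Rightarrow> v x * complex_of_real (kap x l))" by simp
    qed
  qed
  have qm: "q \<in> borel_measurable (restrict_space borel {0<..})"
    unfolding q_def by (intro borel_measurable_times vertical_measurable hardy_pairD(1)[OF p1] hardy_pairD(1)[OF p2])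
  have AEJ: "AE l in \<nu>. J l = of_real pi * (indicator {0<..<\<infinity>} l *\<^sub>R (T_weight (enn2real l) *\<^sub>R q (enn2real l)))"
  proof -
    \<comment> \<open>An end point either carries no mass and may be ignored, or carries an atom,
      which is just the hypothesis under which its integral vanishes.\<close>
    have "AE l in \<nu>. (l = 0 \<longrightarrow> J l = 0) \<and> (l = \<infinity> \<longrightarrow> J l = 0)"
    proof (rule AE_conjI)
      show "AE l in \<nu>. l = 0 \<longrightarrow> J l = 0"
      proof (cases "emeasure \<nu> {0} = 0")
        case True
        from nu_AE_atom[OF this] show ?thesis by eventually_elim simp
      qed (use kap_integral_zero[OF p1 p2] in \<open>simp add: J_def v_def\<close>)
      show "AE l in \<nu>. l = \<infinity> \<longrightarrow> J l = 0"
      proof (cases "emeasure \<nu> {\<infinity>} = 0")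
        case True
        from nu_AE_atom[OF this] show ?thesis by eventually_elim simp
      qed (use kap_integral_infinity[OF p1 p2] in \<open>simp add: J_def v_def\<close>)
    qed
    then show ?thesis
    proof eventually_elim
      fix l assume l: "(l = 0 \<longrightarrow> J l = 0) \<and> (l = \<infinity> \<longrightarrow> J l = 0)"
      show "J l = of_real pi * (indicator {0<..<\<infinity>} l *\<^sub>R (T_weight (enn2real l) *\<^sub>R q (enn2real l)))"
      proof (cases "l \<in> {0<..<\<infinity>}")
        case False
        then have "l = 0 \<or> l = \<infinity>" by (auto simp: not_less top_unique)
        then show ?thesis using l False by auto
      next
        case True
        define r where "r = enn2real l"
        have r: "r > 0" "l = ennreal r" using True by (auto simp: r_def enn2real_positive_iff)
        have "J l = of_real (pi * ((1 + r\<^sup>2) / r)) * (f1 (\<i> * of_real r) * f2 (\<i> * of_real r)) / (F (\<i> * of_real r))\<^sup>2"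
          unfolding J_def v_def r(2) by (rule kap_integral_interior[OF p1 p2 r(1)])
        also have "\<dots> = of_real pi * (T_weight r *\<^sub>R q r)"
          unfolding F_imaginary[OF r(1)] by (simp add: T_weight_def q_def scaleR_conv_of_real mult_ac)
        finally show ?thesis using True by (simp add: r_def)
      qed
    qed
  qed
  have meas: "(\<lambda>l. indicator {0<..<\<infinity>} l *\<^sub>R (T_weight (enn2real l) *\<^sub>R q (enn2real l))) \<in> borel_measurable \<nu>"
  proof -
    have "(\<lambda>l. T_weight (enn2real l) *\<^sub>R q (enn2real l)) \<in> borel_measurable (restrict_space \<nu> {0<..<\<infinity>})"
      using measurable_compose[OF enn2real_restrict_measurable T_weight_measurable]
        measurable_compose[OF enn2real_restrict_measurable qm] by (intro borel_measurable_scaleR)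
    then show ?thesis by (simp only: borel_measurable_restrict_space_iff[OF interior_sets])
  qed
  have iJ: "integrable \<nu> J" unfolding J_def by (rule integrable_snd[OF int])
  have "integrable \<nu> (\<lambda>l. of_real pi * (indicator {0<..<\<infinity>} l *\<^sub>R (T_weight (enn2real l) *\<^sub>R q (enn2real l))))"
    by (rule integrable_cong_AE_imp[OF iJ _ AEJ]) (use meas in measurable)
  then have iq: "integrable \<nu> (\<lambda>l. indicator {0<..<\<infinity>} l *\<^sub>R (T_weight (enn2real l) *\<^sub>R q (enn2real l)))"
    using integrable_mult_right[of "1 / of_real pi"] by fastforce
  then have "integrable (T_measure \<nu>) q" using integrable_T_iff[OF qm] by blast
  then show "integrable (T_measure \<nu>) (\<lambda>l. f1 (\<i> * of_real l) * f2 (\<i> * of_real l))" unfolding q_def .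
  have "(LINT x|lborel. v x * of_real (Psi \<nu> x)) = (LINT x|lborel. 1 / of_real pi * (LINT l|\<nu>. v x * of_real (kap x l)))"
  proof (rule Bochner_Integration.integral_cong[OF refl])
    fix x :: real
    have "(LINT l|\<nu>. v x * complex_of_real (kap x l)) = v x * of_real (LINT l|\<nu>. kap x l)"
      by (simp only: integral_mult_right_zero integral_complex_of_real)
    then show "v x * of_real (Psi \<nu> x) = 1 / of_real pi * (LINT l|\<nu>. v x * of_real (kap x l))"
      by (simp add: Psi_eq)
  qed
  also have "\<dots> = 1 / of_real pi * (LINT x|lborel. (LINT l|\<nu>. v x * of_real (kap x l)))" by (rule integral_mult_right_zero)
  also have "(LINT x|lborel. (LINT l|\<nu>. v x * of_real (kap x l))) = integral\<^sup>L \<nu> J"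
    unfolding J_def by (rule Fubini_integral[OF int, symmetric])
  also have "\<dots> = (LINT l|\<nu>. of_real pi * (indicator {0<..<\<infinity>} l *\<^sub>R (T_weight (enn2real l) *\<^sub>R q (enn2real l))))"
    by (rule integral_cong_AE[OF _ _ AEJ]) (use iJ meas in measurable)
  also have "\<dots> = of_real pi * (LINT l|\<nu>. indicator {0<..<\<infinity>} l *\<^sub>R (T_weight (enn2real l) *\<^sub>R q (enn2real l)))"
    by (rule integral_mult_right_zero)
  also have "(LINT l|\<nu>. indicator {0<..<\<infinity>} l *\<^sub>R (T_weight (enn2real l) *\<^sub>R q (enn2real l))) = integral\<^sup>L (T_measure \<nu>) q"
    by (rule integral_T[OF qm, symmetric])
  finally show "(LINT x|lborel. g1 x * g2 x / (Fb x)\<^sup>2 * of_real (Psi \<nu> x)) =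
      (LINT l|T_measure \<nu>. f1 (\<i> * of_real l) * f2 (\<i> * of_real l))"
    unfolding v_def q_def[abs_def] by simp
qed

text \<open>The bilinear statement is applied to \<open>f\<close> and its reflection; on the
  imaginary axis their product is |f|^2.\<close>

lemma vertical_SQ:
  assumes p: "hardy_pair f g"
  shows "(\<lambda>l. f (\<i> * of_real l)) \<in> vcarrier (SQ (T_measure \<nu>))"
proof -
  have line: "- cnj (\<i> * complex_of_real l) = \<i> * of_real l" for l by (simp add: complex_eq_iff)
  have "integrable (T_measure \<nu>) (\<lambda>l. cnj (f (\<i> * of_real l)) * f (\<i> * of_real l))"
    using reflected_form_aux(1)[OF hardy_pair_reflect[OF p] p] by (simp only: line)
  then have "integrable (T_measure \<nu>) (\<lambda>l. Re (cnj (f (\<i> * of_real l)) * f (\<i> * of_real l)))" by (rule integrable_Re)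
  also have "(\<lambda>l. Re (cnj (f (\<i> * of_real l)) * f (\<i> * of_real l))) = (\<lambda>l. (cmod (f (\<i> * of_real l)))\<^sup>2)"
    unfolding cmod_power2 by (simp add: power2_eq_square)
  finally show ?thesis
    using vertical_measurable[OF hardy_pairD(1)[OF p]] by (simp add: SQ_simps measurable_cong_sets[OF sets_T refl])
qed

text \<open>Substituting -x for x moves the reflection from the second function to the first, where
  \<open>hardy_pair_reflect\<close> absorbs it together with the conjugation.\<close>

lemma reflected_form:
  assumes p1: "hardy_pair f1 g1" and p2: "hardy_pair f2 g2"
  shows "(LINT x|lborel. cnj (g1 x) * (h_fun \<nu> x * g2 (- x))) =
    (LINT l|T_measure \<nu>. cnj (f1 (\<i> * of_real l)) * f2 (\<i> * of_real l))"
proof -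
  have line: "- cnj (\<i> * complex_of_real l) = \<i> * of_real l" for l by (simp add: complex_eq_iff)
  have [measurable]: "g1 \<in> borel_measurable borel" "g2 \<in> borel_measurable borel"
    using hardy_pairD(2)[OF p1] hardy_pairD(2)[OF p2] by (simp_all add: SQ_simps)
  have [measurable]: "Psi \<nu> \<in> borel_measurable borel" unfolding Psi_eq[abs_def] by measurable
  have "(LINT x|lborel. cnj (g1 x) * (h_fun \<nu> x * g2 (- x))) = (LINT x|lborel. cnj (g1 (- x)) * (h_fun \<nu> (- x) * g2 x))"
    using lborel_integral_real_affine[of "-1" "\<lambda>x. cnj (g1 x) * (h_fun \<nu> x * g2 (- x))" 0] by simp
  also have "\<dots> = (LINT x|lborel. cnj (g1 (- x)) * g2 x / (Fb x)\<^sup>2 * of_real (Psi \<nu> x))"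
  proof (rule integral_cong_AE)
    have "AE x in lborel. x \<noteq> (0::real)" by (rule AE_lborel_singleton)
    then show "AE x in lborel. cnj (g1 (- x)) * (h_fun \<nu> (- x) * g2 x) = cnj (g1 (- x)) * g2 x / (Fb x)\<^sup>2 * of_real (Psi \<nu> x)"
      by eventually_elim (simp add: h_fun_eq Psi_even)
  qed measurable
  also have "\<dots> = (LINT l|T_measure \<nu>. cnj (f1 (\<i> * of_real l)) * f2 (\<i> * of_real l))"
    using reflected_form_aux(2)[OF hardy_pair_reflect[OF p1] p2] by (simp only: line)
  finally show ?thesis .
qed

end

section \<open>Completeness of the space of square-integrable functions\<close>

text \<open>A rapidly Cauchy subsequence converges almost everywhere because
  \<open>\<Sum>k. 2 ^ k * \<bar>s (r (k + 1)) - s (r k)\<bar>\<^sup>2\<close> has a finite integral; Fatou's lemma then gives norm convergence.\<close>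

lemma SQ_nn_integral:
  assumes "f \<in> vcarrier (SQ M)"
  shows "(\<integral>\<^sup>+x. ennreal ((cmod (f x))\<^sup>2) \<partial>M) = ennreal ((vnorm (SQ M) f)\<^sup>2)"
proof -
  have "integrable M (\<lambda>x. (cmod (f x))\<^sup>2)" using assms by (simp add: SQ_simps)
  then have "(\<integral>\<^sup>+x. ennreal ((cmod (f x))\<^sup>2) \<partial>M) = ennreal (LINT x|M. (cmod (f x))\<^sup>2)"
    by (rule nn_integral_eq_integral) simp
  then show ?thesis using assms by (simp add: SQ_norm)
qed

lemma geometric_step_convergent:
  fixes a :: "nat \<Rightarrow> complex"
  assumes "(\<Sum>k. ennreal (2 ^ k * (cmod (a (Suc k) - a k))\<^sup>2)) \<noteq> \<infinity>"
  shows "convergent a"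
proof -
  obtain C where C: "(\<Sum>k. ennreal (2 ^ k * (cmod (a (Suc k) - a k))\<^sup>2)) = ennreal C" "C \<ge> 0"
  proof -
    define Q where "Q = (\<Sum>k. ennreal (2 ^ k * (cmod (a (Suc k) - a k))\<^sup>2))"
    have "Q \<noteq> \<infinity>" unfolding Q_def by (rule assms)
    then obtain C where "Q = ennreal C" "C \<ge> 0" by (cases Q) auto
    then show ?thesis using that unfolding Q_def by blast
  qed
  have le: "2 ^ k * (cmod (a (Suc k) - a k))\<^sup>2 \<le> C" for k
  proof -
    have "(\<Sum>k\<in>{k}. ennreal (2 ^ k * (cmod (a (Suc k) - a k))\<^sup>2)) \<le> ennreal C"
      unfolding C(1)[symmetric] by (intro sum_le_suminf summableI) auto
    then show ?thesis using C(2) by (simp add: ennreal_le_iff)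
  qed
  \<comment> \<open>Each term of the series is at most its sum \<open>C\<close>, so the steps decay
    geometrically with ratio 1 / sqrt 2.\<close>
  have b: "norm (a (Suc k) - a k) \<le> sqrt C * (1 / sqrt 2) ^ k" for k
  proof -
    have "(cmod (a (Suc k) - a k))\<^sup>2 \<le> C / 2 ^ k" using le[of k] by (simp add: pos_le_divide_eq mult.commute)
    then have "sqrt ((cmod (a (Suc k) - a k))\<^sup>2) \<le> sqrt (C / 2 ^ k)" by (rule real_sqrt_le_mono)
    then show ?thesis by (simp add: real_sqrt_divide real_sqrt_power power_one_over)
  qed
  have "summable (\<lambda>k. sqrt C * (1 / sqrt 2) ^ k)"
    by (intro summable_mult summable_geometric) simp
  then have "summable (\<lambda>k. a (Suc k) - a k)"
    by (rule summable_comparison_test') (rule b)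
  then have "convergent (\<lambda>n. \<Sum>k<n. a (Suc k) - a k)" by (simp add: summable_iff_convergent)
  then have "convergent (\<lambda>n. a n - a 0)" by (simp add: sum_lessThan_telescope)
  then have "convergent (\<lambda>n. (a n - a 0) + a 0)" by (intro convergent_add convergent_const)
  then show ?thesis by simp
qed

lemma SQ_complete: "vcomplete (SQ M)"
  unfolding vcomplete_def
proof (intro allI impI)
  fix s assume s: "vCauchy (SQ M) s"
  interpret S: semi_ip "SQ M" by (rule semi_ip_SQ)
  have sc: "s n \<in> vcarrier (SQ M)" for n using S.vCauchy_closed[OF s] .
  have [measurable]: "s n \<in> borel_measurable M" for n using sc by (simp add: SQ_simps)
  have "\<forall>k::nat. \<exists>N. \<forall>m\<ge>N. \<forall>n\<ge>N. vnorm (SQ M) (vdiff (SQ M) (s m) (s n)) < (1/2) ^ k"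
    using S.vCauchyD[OF s] by simp
  then obtain N where N: "\<And>k m n. m \<ge> N k \<Longrightarrow> n \<ge> N k \<Longrightarrow> vnorm (SQ M) (vdiff (SQ M) (s m) (s n)) < (1/2) ^ k"
    by metis
  \<comment> \<open>The partial sum dominates N j for every j \<le> k; this replaces a monotone
    choice of thresholds.\<close>
  define r where "r k = (\<Sum>j\<le>k. N j)" for k
  have rN: "N j \<le> r k" if "j \<le> k" for j k
    unfolding r_def using that by (intro member_le_sum) auto
  \<comment> \<open>Where the subsequence diverges \<open>lim\<close> has a default value;
    \<open>u\<close> is measurable all the same, and those points form a null set.\<close>
  define u where "u x = lim (\<lambda>k. s (r k) x)" for x
  have [measurable]: "u \<in> borel_measurable M" unfolding u_def by measurable
  have small: "(\<integral>\<^sup>+x. ennreal ((cmod (s m x - s n x))\<^sup>2) \<partial>M) \<le> ennreal ((1/4) ^ k)" if "m \<ge> N k" "n \<ge> N k" for m n k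
  proof -
    have "(\<integral>\<^sup>+x. ennreal ((cmod (s m x - s n x))\<^sup>2) \<partial>M) = ennreal ((vnorm (SQ M) (vdiff (SQ M) (s m) (s n)))\<^sup>2)"
      using SQ_nn_integral[OF SQ_diff[OF sc sc]] by (simp add: SQ_simps(5))
    also have "\<dots> \<le> ennreal (((1/2) ^ k)\<^sup>2)"
      using N[OF that] by (intro ennreal_leI power_mono S.norm_nonneg S.diff_closed sc) auto
    also have "((1/2) ^ k)\<^sup>2 = ((1/4) ^ k :: real)"
      by (simp add: power2_eq_square flip: power_mult_distrib)
    finally show ?thesis .
  qed
  have "AE x in M. (\<Sum>k. ennreal (2 ^ k * (cmod (s (r (Suc k)) x - s (r k) x))\<^sup>2)) \<noteq> \<infinity>"
  proof (rule nn_integral_noteq_infinite)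
    have "(\<integral>\<^sup>+x. (\<Sum>k. ennreal (2 ^ k * (cmod (s (r (Suc k)) x - s (r k) x))\<^sup>2)) \<partial>M) =
      (\<Sum>k. \<integral>\<^sup>+x. ennreal (2 ^ k * (cmod (s (r (Suc k)) x - s (r k) x))\<^sup>2) \<partial>M)"
      by (rule nn_integral_suminf) measurable
    \<comment> \<open>Squared distances are at most (1/4)^k, so the weight 2^k still leaves a
      convergent geometric series.\<close>
    also have "\<dots> \<le> (\<Sum>k. ennreal ((1/2) ^ k))"
    proof (intro suminf_le summableI)
      fix k
      have "(\<integral>\<^sup>+x. ennreal (2 ^ k * (cmod (s (r (Suc k)) x - s (r k) x))\<^sup>2) \<partial>M) =
        ennreal (2 ^ k) * (\<integral>\<^sup>+x. ennreal ((cmod (s (r (Suc k)) x - s (r k) x))\<^sup>2) \<partial>M)"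
        by (subst nn_integral_cmult[symmetric]) (auto simp: ennreal_mult)
      also have "\<dots> \<le> ennreal (2 ^ k) * ennreal ((1/4) ^ k)"
        by (intro mult_left_mono small rN) auto
      also have "\<dots> = ennreal ((1/2) ^ k)"
        by (simp add: flip: ennreal_mult power_mult_distrib)
      finally show "(\<integral>\<^sup>+x. ennreal (2 ^ k * (cmod (s (r (Suc k)) x - s (r k) x))\<^sup>2) \<partial>M) \<le> ennreal ((1/2) ^ k)" .
    qed
    also have "\<dots> = ennreal (\<Sum>k. (1/2) ^ k)"
      by (rule suminf_ennreal2) (auto intro: summable_geometric)
    finally show "(\<integral>\<^sup>+x. (\<Sum>k. ennreal (2 ^ k * (cmod (s (r (Suc k)) x - s (r k) x))\<^sup>2)) \<partial>M) \<noteq> \<infinity>"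
      by (auto simp: top_unique)
  qed measurable
  then have lim: "AE x in M. (\<lambda>k. s (r k) x) \<longlonglongrightarrow> u x"
    by eventually_elim (unfold u_def, rule convergent_LIMSEQ_iff[THEN iffD1], rule geometric_step_convergent)
  have bound: "(\<integral>\<^sup>+x. ennreal ((cmod (s n x - u x))\<^sup>2) \<partial>M) \<le> ennreal ((1/4) ^ j)" if n: "n \<ge> N j" for n j
  proof -
    have "(\<integral>\<^sup>+x. ennreal ((cmod (s n x - u x))\<^sup>2) \<partial>M) = (\<integral>\<^sup>+x. liminf (\<lambda>k. ennreal ((cmod (s n x - s (r k) x))\<^sup>2)) \<partial>M)"
    proof (rule nn_integral_cong_AE, use lim in eventually_elim)
      fix x assume "(\<lambda>k. s (r k) x) \<longlonglongrightarrow> u x"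
      then have "(\<lambda>k. ennreal ((cmod (s n x - s (r k) x))\<^sup>2)) \<longlonglongrightarrow> ennreal ((cmod (s n x - u x))\<^sup>2)"
        by (intro tendsto_intros tendsto_ennrealI)
      then show "ennreal ((cmod (s n x - u x))\<^sup>2) = liminf (\<lambda>k. ennreal ((cmod (s n x - s (r k) x))\<^sup>2))"
        by (intro lim_imp_Liminf[symmetric]) simp_all
    qed
    also have "\<dots> \<le> liminf (\<lambda>k. \<integral>\<^sup>+x. ennreal ((cmod (s n x - s (r k) x))\<^sup>2) \<partial>M)"
      by (rule nn_integral_liminf) measurable
    also have "\<dots> \<le> limsup (\<lambda>k. \<integral>\<^sup>+x. ennreal ((cmod (s n x - s (r k) x))\<^sup>2) \<partial>M)"
      by (rule Liminf_le_Limsup) simp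
    also have "\<dots> \<le> ennreal ((1/4) ^ j)"
      by (rule Limsup_bounded) (auto intro!: eventually_sequentiallyI[of j] small n rN)
    finally show ?thesis .
  qed
  have du: "(\<lambda>x. s n x - u x) \<in> vcarrier (SQ M)" if n: "n \<ge> N j" for n j
  proof -
    have "integrable M (\<lambda>x. (cmod (s n x - u x))\<^sup>2)"
      by (rule integrableI_bounded) (auto intro: order_le_less_trans[OF bound[OF n]])
    then show ?thesis by (simp add: SQ_simps)
  qed
  have "(\<lambda>x. s (N 0) x - (s (N 0) x - u x)) \<in> vcarrier (SQ M)" by (intro SQ_diff sc du[of 0]) simp
  then have u: "u \<in> vcarrier (SQ M)" by simp
  have le: "vnorm (SQ M) (vdiff (SQ M) (s n) u) \<le> (1/2) ^ j" if n: "n \<ge> N j" for n j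
  proof -
    have "ennreal ((vnorm (SQ M) (vdiff (SQ M) (s n) u))\<^sup>2) \<le> ennreal ((1/4) ^ j)"
      using bound[OF n] SQ_nn_integral[OF du[OF n]] by (simp add: SQ_simps(5))
    then have "(vnorm (SQ M) (vdiff (SQ M) (s n) u))\<^sup>2 \<le> (1/4) ^ j" by (simp add: ennreal_le_iff)
    also have "(1/4) ^ j = ((1/2) ^ j :: real)\<^sup>2" by (simp add: power2_eq_square flip: power_mult_distrib)
    finally show ?thesis by (rule power2_le_imp_le) simp
  qed
  have "(\<lambda>n. vnorm (SQ M) (vdiff (SQ M) (s n) u)) \<longlonglongrightarrow> 0"
  proof (rule LIMSEQ_I)
    fix e :: real assume "e > 0"
    then obtain j where j: "(1/2) ^ j < e" using real_arch_pow_inv[of e "1/2"] by auto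
    have "norm (vnorm (SQ M) (vdiff (SQ M) (s n) u) - 0) < e" if "n \<ge> N j" for n
      using le[OF that] j S.norm_nonneg[OF S.diff_closed[OF sc u], of n] by simp
    then show "\<exists>n0. \<forall>n\<ge>n0. norm (vnorm (SQ M) (vdiff (SQ M) (s n) u) - 0) < e" by blast
  qed
  with u show "\<exists>u\<in>vcarrier (SQ M). (\<lambda>n. vnorm (SQ M) (vdiff (SQ M) (s n) u)) \<longlonglongrightarrow> 0" by blast
qed

lemma (in semi_ip) quotient_complete:
  assumes "vcomplete V"
  shows "vcomplete (vquotient V (vnull V))"
  unfolding vcomplete_def
proof (intro allI impI)
  fix S assume S: "vCauchy (vquotient V (vnull V)) S"
  then have "\<forall>n. \<exists>x\<in>vcarrier V. S n = vcoset V (vnull V) x"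
    unfolding vCauchy_def quotient_carrier image_iff by blast
  then obtain s where s: "\<And>n. s n \<in> vcarrier V" "\<And>n. S n = vcoset V (vnull V) (s n)" by metis
  have "vCauchy V s"
    using S s(1) unfolding vCauchy_def s(2) by (simp add: quotient_norm_diff)
  then obtain u where u: "u \<in> vcarrier V" "(\<lambda>n. vnorm V (vdiff V (s n) u)) \<longlonglongrightarrow> 0"
    using assms by (auto simp: vcomplete_def)
  then show "\<exists>u\<in>vcarrier (vquotient V (vnull V)).
    (\<lambda>n. vnorm (vquotient V (vnull V)) (vdiff (vquotient V (vnull V)) (S n) u)) \<longlonglongrightarrow> 0"
    using s by (intro bexI[of _ "vcoset V (vnull V) u"]) (simp_all add: quotient_norm_diff quotient_carrier)
qed

section \<open>Density of the restrictions to the imaginary axis\<close>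

locale SQ_subspace =
  fixes M :: "'a measure" and S :: "('a \<Rightarrow> complex) set"
  assumes S_sub: "S \<subseteq> vcarrier (SQ M)"
    and S_add: "u \<in> S \<Longrightarrow> v \<in> S \<Longrightarrow> (\<lambda>x. u x + v x) \<in> S"
    and S_scale: "u \<in> S \<Longrightarrow> (\<lambda>x. c * u x) \<in> S"
begin

text \<open>Closure in the seminorm on the level of functions, not of classes, so that pointwise
  limits remain available; \<open>cl_AE_cong\<close> handles changes on null sets.\<close>

definition cl :: "('a \<Rightarrow> complex) set" where
  "cl = {w \<in> vcarrier (SQ M). \<forall>e>0. \<exists>u\<in>S. vnorm (SQ M) (vdiff (SQ M) u w) < e}"

lemma cl_closed: "w \<in> cl \<Longrightarrow> w \<in> vcarrier (SQ M)"
  by (simp add: cl_def)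

lemma clD: "w \<in> cl \<Longrightarrow> e > 0 \<Longrightarrow> \<exists>u\<in>S. vnorm (SQ M) (vdiff (SQ M) u w) < e"
  by (simp add: cl_def)

lemma S_cl: "u \<in> S \<Longrightarrow> u \<in> cl"
  using S_sub semi_ip.norm_diff_self[OF semi_ip_SQ, of u M] by (force simp: cl_def)

lemma cl_add:
  assumes u: "u \<in> cl" and v: "v \<in> cl"
  shows "(\<lambda>x. u x + v x) \<in> cl"
  unfolding cl_def
proof (intro CollectI conjI allI impI)
  interpret Q: semi_ip "SQ M" by (rule semi_ip_SQ)
  show "(\<lambda>x. u x + v x) \<in> vcarrier (SQ M)" by (rule SQ_add[OF cl_closed[OF u] cl_closed[OF v]])
  fix e :: real assume "e > 0"
  then have e: "e / 2 > 0" by simp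
  obtain a where a: "a \<in> S" "vnorm (SQ M) (vdiff (SQ M) a u) < e / 2" using clD[OF u e] by blast
  obtain b where b: "b \<in> S" "vnorm (SQ M) (vdiff (SQ M) b v) < e / 2" using clD[OF v e] by blast
  have ac: "a \<in> vcarrier (SQ M)" and bc: "b \<in> vcarrier (SQ M)" using a(1) b(1) S_sub by auto
  have "vnorm (SQ M) (vdiff (SQ M) (vadd (SQ M) a b) (vadd (SQ M) u v)) < e"
    using Q.norm_diff_add[OF ac bc cl_closed[OF u] cl_closed[OF v]] a(2) b(2) by linarith
  then show "\<exists>w\<in>S. vnorm (SQ M) (vdiff (SQ M) w (\<lambda>x. u x + v x)) < e"
    unfolding SQ_simps
    by (intro bexI[where x = "\<lambda>x. a x + b x"]) (use S_add[OF a(1) b(1)] in simp_all)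
qed

lemma cl_scale:
  assumes u: "u \<in> cl"
  shows "(\<lambda>x. c * u x) \<in> cl"
  unfolding cl_def
proof (intro CollectI conjI allI impI)
  interpret Q: semi_ip "SQ M" by (rule semi_ip_SQ)
  show "(\<lambda>x. c * u x) \<in> vcarrier (SQ M)" by (rule SQ_scale[OF cl_closed[OF u]])
  fix e :: real assume e: "e > 0"
  then have e': "e / (cmod c + 1) > 0" by (simp add: add_nonneg_pos)
  obtain a where a: "a \<in> S" "vnorm (SQ M) (vdiff (SQ M) a u) < e / (cmod c + 1)" using clD[OF u e'] by blast
  have ac: "a \<in> vcarrier (SQ M)" using a(1) S_sub by auto
  have "vnorm (SQ M) (vdiff (SQ M) (vscale (SQ M) c a) (vscale (SQ M) c u)) = cmod c * vnorm (SQ M) (vdiff (SQ M) a u)"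
    by (rule Q.norm_diff_scale[OF ac cl_closed[OF u]])
  also have "\<dots> \<le> cmod c * (e / (cmod c + 1))" using a(2) by (intro mult_left_mono) auto
  also have "\<dots> < e"
  proof -
    have "cmod c * e < e * (cmod c + 1)" using e by (simp add: algebra_simps)
    then show ?thesis by (simp add: pos_divide_less_eq add_nonneg_pos)
  qed
  finally show "\<exists>w\<in>S. vnorm (SQ M) (vdiff (SQ M) w (\<lambda>x. c * u x)) < e"
    unfolding SQ_simps
    by (intro bexI[where x = "\<lambda>x. c * a x"]) (use S_scale[OF a(1)] in simp_all)
qed

lemma cl_limit:
  assumes w: "w \<in> vcarrier (SQ M)" and s: "\<And>n. s n \<in> cl"
    and lim: "(\<lambda>n. vnorm (SQ M) (vdiff (SQ M) (s n) w)) \<longlonglongrightarrow> 0"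
  shows "w \<in> cl"
  unfolding cl_def
proof (intro CollectI conjI allI impI w)
  interpret Q: semi_ip "SQ M" by (rule semi_ip_SQ)
  fix e :: real assume "e > 0"
  then have e: "e / 2 > 0" by simp
  have "\<forall>\<^sub>F n in sequentially. vnorm (SQ M) (vdiff (SQ M) (s n) w) < e / 2" by (rule order_tendstoD(2)[OF lim e])
  then obtain n where n: "vnorm (SQ M) (vdiff (SQ M) (s n) w) < e / 2" using eventually_happens'[OF sequentially_bot] by blast
  obtain a where a: "a \<in> S" "vnorm (SQ M) (vdiff (SQ M) a (s n)) < e / 2" using clD[OF s e] by blast
  have ac: "a \<in> vcarrier (SQ M)" using a(1) S_sub by auto
  have "vnorm (SQ M) (vdiff (SQ M) a w) < e"
    using Q.norm_diff_triangle[OF ac cl_closed[OF s] w, of n] n a(2) by linarith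
  with a(1) show "\<exists>u\<in>S. vnorm (SQ M) (vdiff (SQ M) u w) < e" by blast
qed

text \<open>A square-integrable majorant \<open>b\<close> turns convergence almost everywhere into
  convergence in norm, as the squared distance is dominated by 4 b^2.\<close>

lemma cl_dominated:
  assumes s: "\<And>n. s n \<in> cl" and w [measurable]: "w \<in> borel_measurable M"
    and lim: "AE x in M. (\<lambda>n. s n x) \<longlonglongrightarrow> w x"
    and b: "integrable M (\<lambda>x. (b x)\<^sup>2)" "\<And>n. AE x in M. cmod (s n x) \<le> b x"
  shows "w \<in> cl"
proof -
  have [measurable]: "s n \<in> borel_measurable M" for n using cl_closed[OF s] by (simp add: SQ_simps)
  have all: "AE x in M. \<forall>n. cmod (s n x) \<le> b x" using b(2) by (simp add: AE_all_countable)
  have wb: "AE x in M. cmod (w x) \<le> b x"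
    using lim all by eventually_elim (rule LIMSEQ_le_const2[OF tendsto_norm], auto)
  have wc: "w \<in> vcarrier (SQ M)"
  proof -
    have "integrable M (\<lambda>x. (cmod (w x))\<^sup>2)"
    proof (rule Bochner_Integration.integrable_bound[OF b(1)])
      show "AE x in M. norm ((cmod (w x))\<^sup>2) \<le> norm ((b x)\<^sup>2)"
        using wb by eventually_elim (simp add: power_mono)
    qed measurable
    then show ?thesis by (simp add: SQ_simps)
  qed
  have "(\<lambda>n. LINT x|M. (cmod (s n x - w x))\<^sup>2) \<longlonglongrightarrow> (LINT x|M. 0)"
  proof (rule integral_dominated_convergence[where w = "\<lambda>x. 4 * (b x)\<^sup>2"])
    show "integrable M (\<lambda>x. 4 * (b x)\<^sup>2)" using b(1) by simp
    show "AE x in M. (\<lambda>n. (cmod (s n x - w x))\<^sup>2) \<longlonglongrightarrow> 0"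
      using lim
    proof eventually_elim
      fix x assume l: "(\<lambda>n. s n x) \<longlonglongrightarrow> w x"
      have "(\<lambda>n. (cmod (s n x - w x))\<^sup>2) \<longlonglongrightarrow> (cmod (w x - w x))\<^sup>2" by (intro tendsto_intros l)
      then show "(\<lambda>n. (cmod (s n x - w x))\<^sup>2) \<longlonglongrightarrow> 0" by simp
    qed
    show "AE x in M. norm ((cmod (s n x - w x))\<^sup>2) \<le> 4 * (b x)\<^sup>2" for n
      using all wb
    proof eventually_elim
      fix x assume *: "\<forall>n. cmod (s n x) \<le> b x" "cmod (w x) \<le> b x"
      then have "cmod (s n x - w x) \<le> 2 * b x" using norm_triangle_ineq4[of "s n x" "w x"] by (smt (verit))
      then have "(cmod (s n x - w x))\<^sup>2 \<le> (2 * b x)\<^sup>2" by (rule power_mono) simp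
      then show "norm ((cmod (s n x - w x))\<^sup>2) \<le> 4 * (b x)\<^sup>2" by (simp add: power_mult_distrib)
    qed
  qed measurable
  then have "(\<lambda>n. LINT x|M. (cmod (s n x - w x))\<^sup>2) \<longlonglongrightarrow> 0" by simp
  then have "(\<lambda>n. sqrt (LINT x|M. (cmod (s n x - w x))\<^sup>2)) \<longlonglongrightarrow> sqrt 0" by (rule tendsto_real_sqrt)
  then have "(\<lambda>n. vnorm (SQ M) (vdiff (SQ M) (s n) w)) \<longlonglongrightarrow> 0"
    using SQ_norm[OF SQ_diff[OF cl_closed[OF s] wc]] by (simp add: SQ_simps(5))
  from cl_limit[OF wc s this] show ?thesis .
qed

lemma cl_AE_cong:
  assumes u: "u \<in> cl" and w: "w \<in> borel_measurable M" and eq: "AE x in M. u x = w x"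
  shows "w \<in> cl"
proof (rule cl_dominated[where s = "\<lambda>n. u" and b = "\<lambda>x. cmod (u x)", OF u w])
  show "AE x in M. (\<lambda>n. u x) \<longlonglongrightarrow> w x" using eq by eventually_elim simp
  show "integrable M (\<lambda>x. (cmod (u x))\<^sup>2)" using cl_closed[OF u] by (simp add: SQ_simps)
qed simp

lemma cl_sum: "finite I \<Longrightarrow> I \<noteq> {} \<Longrightarrow> (\<And>i. i \<in> I \<Longrightarrow> u i \<in> cl) \<Longrightarrow> (\<lambda>x. \<Sum>i\<in>I. u i x) \<in> cl"
proof (induction I rule: finite_ne_induct)
  case (singleton i)
  then have "u i \<in> cl" by simp
  then show ?case by simp
next
  case (insert i I)
  then have "(\<lambda>x. u i x + (\<Sum>i\<in>I. u i x)) \<in> cl" by (intro cl_add) auto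
  then show ?case using insert by simp
qed

text \<open>The quotient w / t is the pointwise limit of simple functions of modulus at most 2 |w /
  t|. Multiplied by \<open>t\<close> they become finite combinations of the given functions,
  dominated by 2 |w|. The positive weight stands in for finiteness of the measure: indicators alone
  need not be square-integrable.\<close>

lemma cl_all:
  fixes t :: "'a \<Rightarrow> real"
  assumes t: "t \<in> borel_measurable M" "\<And>x. x \<in> space M \<Longrightarrow> t x > 0"
    and ind: "\<And>A. A \<in> sets M \<Longrightarrow> (\<lambda>x. of_real (t x) * indicator A x) \<in> cl"
    and w: "w \<in> vcarrier (SQ M)"
  shows "w \<in> cl"
proof -
  have [measurable]: "t \<in> borel_measurable M" "w \<in> borel_measurable M" using t w by (simp_all add: SQ_simps)
  define v where "v x = w x / of_real (t x)" for x
  have "v \<in> borel_measurable M" unfolding v_def by measurable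
  then obtain F where F: "\<And>i. simple_function M (F i)" "\<And>x. x \<in> space M \<Longrightarrow> (\<lambda>i. F i x) \<longlonglongrightarrow> v x"
    "\<And>i x. x \<in> space M \<Longrightarrow> dist (F i x) 0 \<le> 2 * dist (v x) 0"
    using borel_measurable_implies_sequence_metric[of v M 0] by blast
  have tF: "(\<lambda>x. of_real (t x) * F i x) \<in> cl" for i
  \<comment> \<open>\<open>cl_sum\<close> asks for a nonempty index set, but a simple function on an
    empty space takes no value. In that case all functions agree almost everywhere.\<close>
  proof (cases "space M = {}")
    case False
    have fin: "finite (F i ` space M)" using F(1) by (simp add: simple_function_def)
    have set: "F i -` {y} \<inter> space M \<in> sets M" if "y \<in> F i ` space M" for y
      using F(1)[of i] that unfolding simple_function_def by blast
    have "(\<lambda>x. \<Sum>y\<in>F i ` space M. y * (of_real (t x) * indicator (F i -` {y} \<inter> space M) x)) \<in> cl"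
      by (intro cl_sum cl_scale ind set fin) (use False in auto)
    then show ?thesis
    proof (rule cl_AE_cong)
      have [measurable]: "F i \<in> borel_measurable M" using F(1) by (rule borel_measurable_simple_function)
      show "(\<lambda>x. of_real (t x) * F i x) \<in> borel_measurable M" by measurable
      show "AE x in M. (\<Sum>y\<in>F i ` space M. y * (of_real (t x) * indicator (F i -` {y} \<inter> space M) x)) = of_real (t x) * F i x"
      proof (rule AE_I2)
        fix x assume x: "x \<in> space M"
        have "(\<Sum>y\<in>F i ` space M. y * (of_real (t x) * indicator (F i -` {y} \<inter> space M) x)) =
          (\<Sum>y\<in>F i ` space M. if F i x = y then of_real (t x) * F i x else 0)"
          using x by (intro sum.cong) (auto split: split_indicator)
        also have "\<dots> = of_real (t x) * F i x" using x fin by (simp add: sum.delta)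
        finally show "(\<Sum>y\<in>F i ` space M. y * (of_real (t x) * indicator (F i -` {y} \<inter> space M) x)) = of_real (t x) * F i x" .
      qed
    qed
  next
    case True
    have "(\<lambda>x. of_real (t x) * indicator {} x :: complex) \<in> cl" by (rule ind) simp
    then show ?thesis
    proof (rule cl_AE_cong)
      show "(\<lambda>x. of_real (t x) * F i x) \<in> borel_measurable M"
        using borel_measurable_simple_function[OF F(1)] by measurable
      show "AE x in M. of_real (t x) * indicator {} x = of_real (t x) * F i x"
        by (rule AE_I2) (use True in simp)
    qed
  qed
  show ?thesis
  proof (rule cl_dominated[where s = "\<lambda>i x. of_real (t x) * F i x" and b = "\<lambda>x. 2 * cmod (w x)", OF tF])
    show "AE x in M. (\<lambda>i. of_real (t x) * F i x) \<longlonglongrightarrow> w x"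
    proof (rule AE_I2)
      fix x assume x: "x \<in> space M"
      have "(\<lambda>i. of_real (t x) * F i x) \<longlonglongrightarrow> of_real (t x) * v x" by (intro tendsto_intros F x)
      then show "(\<lambda>i. of_real (t x) * F i x) \<longlonglongrightarrow> w x" using t(2)[OF x] by (simp add: v_def)
    qed
    show "integrable M (\<lambda>x. (2 * cmod (w x))\<^sup>2)" using w by (simp add: SQ_simps power_mult_distrib)
    show "AE x in M. cmod (of_real (t x) * F i x) \<le> 2 * cmod (w x)" for i
    proof (rule AE_I2)
      fix x assume x: "x \<in> space M"
      have "t x * cmod (F i x) \<le> t x * (2 * cmod (v x))"
        using F(3)[OF x, of i] t(2)[OF x] by (intro mult_left_mono) (auto simp: less_imp_le)
      then show "cmod (of_real (t x) * F i x) \<le> 2 * cmod (w x)"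
        using t(2)[OF x] by (simp add: norm_mult v_def norm_divide)
    qed
  qed measurable
qed

end

section \<open>Linear operations and powers of a resolvent in the Hardy space\<close>

lemma hardy_pair_add:
  assumes p: "hardy_pair f1 g1" and q: "hardy_pair f2 g2"
  shows "hardy_pair (\<lambda>z. f1 z + f2 z) (\<lambda>x. g1 x + g2 x)"
  unfolding hardy_pair_def
proof (intro conjI)
  show "(\<lambda>z. f1 z + f2 z) holomorphic_on UHP" by (intro holomorphic_intros hardy_pairD(1)[OF p] hardy_pairD(1)[OF q])
  show "(\<lambda>x. g1 x + g2 x) \<in> vcarrier (SQ lborel)" by (intro SQ_add hardy_pairD(2)[OF p] hardy_pairD(2)[OF q])
  show "AE x in lborel. ((\<lambda>\<epsilon>. f1 (Complex x \<epsilon>) + f2 (Complex x \<epsilon>)) \<longlongrightarrow> g1 x + g2 x) (at_right 0)"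
    using hardy_pairD(4)[OF p] hardy_pairD(4)[OF q] by eventually_elim (rule tendsto_add)
  obtain A where A: "\<And>y. y > 0 \<Longrightarrow> (LINT x|lborel. (cmod (f1 (Complex x y)))\<^sup>2) \<le> A" using hardy_pair_bound[OF p] by blast
  obtain B where B: "\<And>y. y > 0 \<Longrightarrow> (LINT x|lborel. (cmod (f2 (Complex x y)))\<^sup>2) \<le> B" using hardy_pair_bound[OF q] by blast
  have "(\<lambda>x. f1 (Complex x y) + f2 (Complex x y)) \<in> vcarrier (SQ lborel) \<and>
    (LINT x|lborel. (cmod (f1 (Complex x y) + f2 (Complex x y)))\<^sup>2) \<le> 2 * A + 2 * B" if y: "y > 0" for y
  proof -
    have c: "(\<lambda>x. f1 (Complex x y) + f2 (Complex x y)) \<in> vcarrier (SQ lborel)"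
      by (intro SQ_add hardy_pairD(3)[OF p y] hardy_pairD(3)[OF q y])
    have i: "integrable lborel (\<lambda>x. 2 * (cmod (f1 (Complex x y)))\<^sup>2)" "integrable lborel (\<lambda>x. 2 * (cmod (f2 (Complex x y)))\<^sup>2)"
      using hardy_pairD(3)[OF p y] hardy_pairD(3)[OF q y] by (simp_all add: SQ_simps)
    have "(LINT x|lborel. (cmod (f1 (Complex x y) + f2 (Complex x y)))\<^sup>2) \<le>
      (LINT x|lborel. 2 * (cmod (f1 (Complex x y)))\<^sup>2 + 2 * (cmod (f2 (Complex x y)))\<^sup>2)"
      by (intro integral_mono Bochner_Integration.integrable_add i norm_add_sq_le) (use c in \<open>simp add: SQ_simps\<close>)
    also have "\<dots> = 2 * (LINT x|lborel. (cmod (f1 (Complex x y)))\<^sup>2) + 2 * (LINT x|lborel. (cmod (f2 (Complex x y)))\<^sup>2)"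
      using Bochner_Integration.integral_add[OF i] by simp
    also have "\<dots> \<le> 2 * A + 2 * B" using A[OF y] B[OF y] by linarith
    finally show ?thesis using c by blast
  qed
  then show "\<exists>M. \<forall>y>0. (\<lambda>x. f1 (Complex x y) + f2 (Complex x y)) \<in> vcarrier (SQ lborel) \<and>
    (LINT x|lborel. (cmod (f1 (Complex x y) + f2 (Complex x y)))\<^sup>2) \<le> M" by blast
qed

lemma hardy_pair_scale:
  assumes p: "hardy_pair f g"
  shows "hardy_pair (\<lambda>z. c * f z) (\<lambda>x. c * g x)"
  using hardy_pair_mult_bounded[OF p, of "\<lambda>z. c" "cmod c" "\<lambda>x. c"] by (simp add: mult.commute)

lemma hardy_pair_resolvent: "hardy_pair (\<lambda>z. 1 / (z + \<i>)) (\<lambda>x. 1 / (of_real x + \<i>))"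
  unfolding hardy_pair_def
proof (intro conjI)
  have ne: "z + \<i> \<noteq> 0" if "Im z \<ge> 0" for z using that by (auto simp: complex_eq_iff)
  show "(\<lambda>z. 1 / (z + \<i>)) holomorphic_on UHP" using ne by (intro holomorphic_intros) auto
  show "\<exists>M. \<forall>y>0. (\<lambda>x. 1 / (Complex x y + \<i>)) \<in> vcarrier (SQ lborel) \<and>
      (LINT x|lborel. (cmod (1 / (Complex x y + \<i>)))\<^sup>2) \<le> M"
    using Cauchy_kernel_line_bound[of "- \<i>"] by (intro exI[of _ pi]) simp
  show "(\<lambda>x. 1 / (of_real x + \<i>)) \<in> vcarrier (SQ lborel)" using SQ_Cauchy_kernel[of "- \<i>"] by simp
  show "AE x in lborel. ((\<lambda>\<epsilon>. 1 / (Complex x \<epsilon> + \<i>)) \<longlongrightarrow> 1 / (of_real x + \<i>)) (at_right 0)"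
  proof (rule AE_I2)
    fix x :: real
    have "((\<lambda>\<epsilon>. 1 / (of_real x + \<i> * of_real \<epsilon> + \<i>)) \<longlongrightarrow> 1 / (of_real x + \<i> * of_real 0 + \<i>)) (at_right 0)"
      by (intro tendsto_intros) (use ne[of "of_real x"] in simp)
    then show "((\<lambda>\<epsilon>. 1 / (Complex x \<epsilon> + \<i>)) \<longlongrightarrow> 1 / (of_real x + \<i>)) (at_right 0)" by (simp add: Complex_eq)
  qed
qed

lemma hardy_pair_resolvent_power:
  "hardy_pair (\<lambda>z. (\<i> / (z + \<i>)) ^ Suc n) (\<lambda>x. (\<i> / (of_real x + \<i>)) ^ Suc n)"
proof -
  have ne: "z + \<i> \<noteq> 0" if "Im z \<ge> 0" for z using that by (auto simp: complex_eq_iff)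
  have "hardy_pair (\<lambda>z. \<i> * (1 / (z + \<i>)) * (\<i> / (z + \<i>)) ^ n) (\<lambda>x. \<i> * (1 / (of_real x + \<i>)) * (\<i> / (of_real x + \<i>)) ^ n)"
  proof (rule hardy_pair_mult_bounded[OF hardy_pair_scale[OF hardy_pair_resolvent]])
    show "(\<lambda>z. (\<i> / (z + \<i>)) ^ n) holomorphic_on UHP" using ne by (intro holomorphic_intros) auto
    show "cmod ((\<i> / (z + \<i>)) ^ n) \<le> 1" if z: "Im z > 0" for z
    proof -
      have "1 \<le> cmod (z + \<i>)" using abs_Im_le_cmod[of "z + \<i>"] z by simp
      then have "cmod (\<i> / (z + \<i>)) \<le> 1" by (simp add: norm_divide divide_le_eq_1)
      then show ?thesis unfolding norm_power by (intro power_le_one) auto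
    qed
    show "(\<lambda>x. (\<i> / (of_real x + \<i>)) ^ n) \<in> borel_measurable borel" by measurable
    show "AE x in lborel. ((\<lambda>\<epsilon>. (\<i> / (Complex x \<epsilon> + \<i>)) ^ n) \<longlongrightarrow> (\<i> / (of_real x + \<i>)) ^ n) (at_right 0)"
    proof (rule AE_I2)
      fix x :: real
      have "((\<lambda>\<epsilon>. (\<i> / (of_real x + \<i> * of_real \<epsilon> + \<i>)) ^ n) \<longlongrightarrow> (\<i> / (of_real x + \<i> * of_real 0 + \<i>)) ^ n) (at_right 0)"
        by (intro tendsto_intros) (use ne[of "of_real x"] in simp)
      then show "((\<lambda>\<epsilon>. (\<i> / (Complex x \<epsilon> + \<i>)) ^ n) \<longlongrightarrow> (\<i> / (of_real x + \<i>)) ^ n) (at_right 0)" by (simp add: Complex_eq)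
    qed
  qed
  then show ?thesis by simp
qed

context nu_data
begin

definition verticals :: "(real \<Rightarrow> complex) set" where
  "verticals = {(\<lambda>l. f (\<i> * of_real l)) | f. \<exists>g. hardy_pair f g}"

lemma verticalsI: "hardy_pair f g \<Longrightarrow> (\<lambda>l. f (\<i> * of_real l)) \<in> verticals"
  unfolding verticals_def by blast

sublocale V: SQ_subspace "T_measure \<nu>" verticals
proof
  show "verticals \<subseteq> vcarrier (SQ (T_measure \<nu>))" using vertical_SQ by (auto simp: verticals_def)
  show "(\<lambda>x. u x + v x) \<in> verticals" if uv: "u \<in> verticals" "v \<in> verticals" for u v
  proof -
    obtain f1 g1 f2 g2 where *: "u = (\<lambda>l. f1 (\<i> * of_real l))" "hardy_pair f1 g1"
      "v = (\<lambda>l. f2 (\<i> * of_real l))" "hardy_pair f2 g2" using uv unfolding verticals_def by blast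
    show ?thesis unfolding *(1,3) by (rule verticalsI[OF hardy_pair_add[OF *(2,4)]])
  qed
  show "(\<lambda>x. c * u x) \<in> verticals" if u: "u \<in> verticals" for u c
  proof -
    obtain f g where *: "u = (\<lambda>l. f (\<i> * of_real l))" "hardy_pair f g" using u unfolding verticals_def by blast
    show ?thesis unfolding *(1) by (rule verticalsI[OF hardy_pair_scale[OF *(2)]])
  qed
qed

text \<open>With \<open>t = 1 / (1 + l)\<close> the functions \<open>(i / (z + i)) ^ (n + 1)\<close> restrict to \<open>t ^ (n + 1)\<close> on the imaginary axis.
  The Weierstrass theorem on \<open>[0, 1]\<close> and a Dynkin argument then put \<open>t * indicator A\<close> in the closure for
  every Borel set \<open>A\<close>.\<close>

definition tw :: "real \<Rightarrow> real" where
  "tw l = 1 / (1 + l)"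

lemma id_T_measurable [measurable]: "(\<lambda>l. l) \<in> borel_measurable (T_measure \<nu>)"
  unfolding measurable_cong_sets[OF sets_T refl] by (rule measurable_restrict_space1) simp

lemma tw_measurable [measurable]: "tw \<in> borel_measurable (T_measure \<nu>)"
  unfolding tw_def by measurable

lemma tw_indicator_measurable:
  assumes "A \<in> sets borel"
  shows "(\<lambda>l. complex_of_real (tw l) * indicator A l) \<in> borel_measurable (T_measure \<nu>)"
proof (rule borel_measurable_times)
  show "(\<lambda>l. complex_of_real (tw l)) \<in> borel_measurable (T_measure \<nu>)" by measurable
  have "indicator A \<in> borel_measurable borel" using assms by (rule borel_measurable_indicator)
  from measurable_compose[OF id_T_measurable this]
  show "(\<lambda>l. indicator A l :: complex) \<in> borel_measurable (T_measure \<nu>)" .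
qed

lemma T_pos: "l \<in> space (T_measure \<nu>) \<Longrightarrow> l > 0"
  by (simp add: space_T)

lemma tw_bounds: "l > 0 \<Longrightarrow> tw l > 0 \<and> tw l \<le> 1"
  by (simp add: tw_def)

lemma resolvent_vertical:
  assumes "l > 0"
  shows "(\<i> / (\<i> * of_real l + \<i>)) ^ n = of_real (tw l) ^ n"
proof -
  have "\<i> * of_real l + \<i> = \<i> * of_real (1 + l)" by (simp add: algebra_simps)
  then have "\<i> / (\<i> * of_real l + \<i>) = of_real (tw l)" using assms by (simp add: tw_def)
  then show ?thesis by simp
qed

lemma tw_power_cl: "(\<lambda>l. of_real (tw l ^ Suc n)) \<in> V.cl"
proof (rule V.cl_AE_cong[OF V.S_cl[OF verticalsI[OF hardy_pair_resolvent_power[of n]]]])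
  show "(\<lambda>l. complex_of_real (tw l ^ Suc n)) \<in> borel_measurable (T_measure \<nu>)" by measurable
  show "AE l in T_measure \<nu>. (\<i> / (\<i> * of_real l + \<i>)) ^ Suc n = of_real (tw l ^ Suc n)"
    by (rule AE_I2) (use resolvent_vertical[OF T_pos, of _ "Suc n"] in simp)
qed

text \<open>\<open>tw\<close> is the restriction of i / (z + i) to the imaginary axis. Its multiples
  are the majorants in the dominated limits that follow.\<close>

lemma tw_sq_integrable: "integrable (T_measure \<nu>) (\<lambda>l. (c * tw l)\<^sup>2)"
proof -
  have "(\<lambda>l. complex_of_real (tw l ^ Suc 0)) \<in> vcarrier (SQ (T_measure \<nu>))" by (rule V.cl_closed[OF tw_power_cl])
  then show ?thesis by (simp add: SQ_simps power_mult_distrib)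
qed

text \<open>The powers in \<open>tw_power_cl\<close> start at exponent 1, so polynomials appear only
  with a factor \<open>tw\<close>. This factor turns a uniform bound B + 1 on the approximating
  polynomials into a square-integrable majorant.\<close>

lemma tw_continuous_cl:
  assumes c: "continuous_on {0..1} c"
  shows "(\<lambda>l. of_real (tw l * c (tw l))) \<in> V.cl"
proof -
  have "\<forall>n. \<exists>g. real_polynomial_function g \<and> (\<forall>x\<in>{0..1}. \<bar>c x - g x\<bar> < 1 / real (Suc n))"
  proof
    fix n
    show "\<exists>g. real_polynomial_function g \<and> (\<forall>x\<in>{0..1}. \<bar>c x - g x\<bar> < 1 / real (Suc n))"
    proof -
      have pos: "0 < 1 / real (Suc n)" by simp
      obtain g where "real_polynomial_function g" "\<And>x. x \<in> {0..1} \<Longrightarrow> \<bar>c x - g x\<bar> < 1 / real (Suc n)"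
        by (rule Stone_Weierstrass_real_polynomial_function[OF compact_Icc c pos]) blast
      then show ?thesis by (intro exI[of _ g]) (simp del: of_nat_Suc)
    qed
  qed
  then obtain g where g: "\<And>n. real_polynomial_function (g n)" "\<And>n x. x \<in> {0..1} \<Longrightarrow> \<bar>c x - g n x\<bar> < 1 / real (Suc n)"
    by metis
  have gcl: "(\<lambda>l. of_real (tw l * g n (tw l))) \<in> V.cl" for n
  proof -
    obtain a m where am: "g n = (\<lambda>x. \<Sum>i\<le>m. a i * x ^ i)" using g(1) real_polynomial_function_iff_sum by blast
    have "(\<lambda>l. \<Sum>i\<le>m. of_real (a i) * of_real (tw l ^ Suc i)) \<in> V.cl"
      by (intro V.cl_sum V.cl_scale tw_power_cl) auto
    also have "(\<lambda>l. \<Sum>i\<le>m. of_real (a i) * of_real (tw l ^ Suc i)) = (\<lambda>l. complex_of_real (tw l * g n (tw l)))"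
      by (simp add: am sum_distrib_left mult_ac)
    finally show ?thesis .
  qed
  obtain B where B: "\<And>x. x \<in> {0..1} \<Longrightarrow> \<bar>c x\<bar> \<le> B"
  proof -
    have "\<exists>B. \<forall>x\<in>{0..1}. \<bar>c x\<bar> \<le> B"
      using compact_imp_bounded[OF compact_continuous_image[OF c compact_Icc]] by (simp add: bounded_iff)
    then show ?thesis using that by blast
  qed
  show ?thesis
  proof (rule V.cl_dominated[OF gcl, where b = "\<lambda>l. (B + 1) * tw l"])
    have lim: "(\<lambda>n. g n x) \<longlonglongrightarrow> c x" if x: "x \<in> {0..1}" for x
    proof (rule LIM_zero_cancel, rule Lim_null_comparison)
      show "\<forall>\<^sub>F n in sequentially. norm (g n x - c x) \<le> 1 / real (Suc n)"
        using g(2)[OF x] by (intro always_eventually allI) (simp add: abs_minus_commute less_imp_le)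
      show "(\<lambda>n. 1 / real (Suc n)) \<longlonglongrightarrow> 0" by (rule LIMSEQ_Suc[OF lim_1_over_n])
    qed
    have lim': "(\<lambda>n. complex_of_real (tw l * g n (tw l))) \<longlonglongrightarrow> of_real (tw l * c (tw l))" if "l > 0" for l
      using tw_bounds[OF that] by (intro tendsto_of_real tendsto_mult tendsto_const lim) auto
    show "AE l in T_measure \<nu>. (\<lambda>n. complex_of_real (tw l * g n (tw l))) \<longlonglongrightarrow> of_real (tw l * c (tw l))"
      by (rule AE_I2) (rule lim'[OF T_pos])
    show "(\<lambda>l. complex_of_real (tw l * c (tw l))) \<in> borel_measurable (T_measure \<nu>)"
    proof (rule borel_measurable_LIMSEQ_metric)
      show "(\<lambda>l. complex_of_real (tw l * g n (tw l))) \<in> borel_measurable (T_measure \<nu>)" for n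
        using V.cl_closed[OF gcl] by (simp add: SQ_simps)
    qed (rule lim'[OF T_pos])
    show "AE l in T_measure \<nu>. cmod (complex_of_real (tw l * g n (tw l))) \<le> (B + 1) * tw l" for n
    proof (rule AE_I2)
      fix l assume l: "l \<in> space (T_measure \<nu>)"
      have t: "tw l > 0" "tw l \<in> {0..1}" using tw_bounds[OF T_pos[OF l]] by auto
      have "1 / real (Suc n) \<le> 1" by simp
      then have "\<bar>g n (tw l)\<bar> \<le> B + 1" using g(2)[OF t(2), of n] B[OF t(2)] by linarith
      then have "tw l * \<bar>g n (tw l)\<bar> \<le> tw l * (B + 1)" using t by (intro mult_left_mono) auto
      then show "cmod (complex_of_real (tw l * g n (tw l))) \<le> (B + 1) * tw l"
        unfolding norm_of_real abs_mult using t by (simp add: mult.commute)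
    qed
  qed (rule tw_sq_integrable)
qed

text \<open>As \<open>tw\<close> is decreasing, a < l means tw l < tw a, so the half-line is cut out
  by continuous ramps in \<open>tw\<close>. For a \<le> 0 the half-line contains the whole
  space.\<close>

lemma tw_greaterThan_cl: "(\<lambda>l. of_real (tw l) * indicator {a<..} l) \<in> V.cl"
proof (cases "a > 0")
  case False
  have "(\<lambda>l. complex_of_real (tw l ^ Suc 0)) \<in> V.cl" by (rule tw_power_cl)
  then show ?thesis
  proof (rule V.cl_AE_cong)
    show "AE l in T_measure \<nu>. complex_of_real (tw l ^ Suc 0) = of_real (tw l) * indicator {a<..} l"
      by (rule AE_I2) (use T_pos False in \<open>force split: split_indicator\<close>)
    show "(\<lambda>l. complex_of_real (tw l) * indicator {a<..} l) \<in> borel_measurable (T_measure \<nu>)"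
      by (rule tw_indicator_measurable) simp
  qed
next
  case True
  define b where "b = tw a"
  \<comment> \<open>A ramp of slope n that vanishes for s \<ge> b and reaches 1 at s = b - 1 / n; it
    tends to the indicator of s < b.\<close>
  define c where "c n s = min 1 (max 0 (real n * (b - s)))" for n s
  have "(\<lambda>l. of_real (tw l * c n (tw l))) \<in> V.cl" for n
    by (rule tw_continuous_cl) (unfold c_def, intro continuous_intros)
  then show ?thesis
  proof (rule V.cl_dominated[where b = "\<lambda>l. 1 * tw l"])
    show "AE l in T_measure \<nu>. (\<lambda>n. complex_of_real (tw l * c n (tw l))) \<longlonglongrightarrow> of_real (tw l) * indicator {a<..} l"
    proof (rule AE_I2)
      fix l assume "l \<in> space (T_measure \<nu>)"
      then have l: "l > 0" by (rule T_pos)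
      have iff: "a < l \<longleftrightarrow> tw l < b" using l True by (simp add: b_def tw_def frac_less2 divide_less_cancel) (auto simp: field_simps)
      have "(\<lambda>n. c n (tw l)) \<longlonglongrightarrow> indicator {a<..} l"
      proof (cases "a < l")
        case True
        then have d: "b - tw l > 0" using iff by simp
        obtain N :: nat where N: "1 / (b - tw l) \<le> real N" using real_arch_simple by blast
        have "\<forall>\<^sub>F n in sequentially. c n (tw l) = indicator {a<..} l"
        proof (rule eventually_sequentiallyI[of N])
          fix n assume "n \<ge> N"
          then have "1 / (b - tw l) \<le> real n" using N by linarith
          then have "1 \<le> real n * (b - tw l)" using d by (simp add: pos_divide_le_eq)
          then show "c n (tw l) = indicator {a<..} l" using True by (simp add: c_def)
        qed
        then show ?thesis by (rule tendsto_eventually)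
      next
        case False
        then have "b - tw l \<le> 0" using iff by simp
        then have "real n * (b - tw l) \<le> 0" for n by (simp add: mult_nonneg_nonpos)
        then have "c n (tw l) = indicator {a<..} l" for n using False by (simp add: c_def max_absorb1)
        then show ?thesis by simp
      qed
      then have "(\<lambda>n. complex_of_real (tw l * c n (tw l))) \<longlonglongrightarrow> of_real (tw l * indicator {a<..} l)"
        by (intro tendsto_of_real tendsto_mult tendsto_const)
      moreover have "complex_of_real (tw l * indicator {a<..} l) = of_real (tw l) * indicator {a<..} l"
        by (simp split: split_indicator)
      ultimately show "(\<lambda>n. complex_of_real (tw l * c n (tw l))) \<longlonglongrightarrow> of_real (tw l) * indicator {a<..} l"
        by (simp only:)
    qed
    show "AE l in T_measure \<nu>. cmod (complex_of_real (tw l * c n (tw l))) \<le> 1 * tw l" for n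
    proof (rule AE_I2)
      fix l assume l: "l \<in> space (T_measure \<nu>)"
      have t: "tw l > 0" using tw_bounds[OF T_pos[OF l]] by auto
      have "\<bar>c n (tw l)\<bar> \<le> 1" by (simp add: c_def)
      then have "tw l * \<bar>c n (tw l)\<bar> \<le> tw l * 1" using t by (intro mult_left_mono) auto
      then show "cmod (complex_of_real (tw l * c n (tw l))) \<le> 1 * tw l"
        unfolding norm_of_real abs_mult using t by simp
    qed
    show "(\<lambda>l. complex_of_real (tw l) * indicator {a<..} l) \<in> borel_measurable (T_measure \<nu>)"
      by (rule tw_indicator_measurable) simp
  qed (rule tw_sq_integrable)
qed

lemma tw_borel_cl:
  assumes A: "A \<in> sets borel"
  shows "(\<lambda>l. of_real (tw l) * indicator A l) \<in> V.cl"
proof -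
  have G: "Int_stable (range (greaterThan :: real \<Rightarrow> real set))"
  proof (rule Int_stableI)
    fix a b :: "real set" assume "a \<in> range greaterThan" "b \<in> range greaterThan"
    then obtain x y where "a = {x<..}" "b = {y<..}" by auto
    then have "a \<inter> b = {max x y<..}" by auto
    then show "a \<inter> b \<in> range greaterThan" by blast
  qed
  have "sets (borel :: real measure) = sigma_sets UNIV (range greaterThan)"
    unfolding borel_Ioi by (rule sets_measure_of) simp
  then have A': "A \<in> sigma_sets UNIV (range greaterThan)" using A by simp
  have G': "range (greaterThan :: real \<Rightarrow> real set) \<subseteq> Pow UNIV" by simp
  from G G' A' show ?thesis
  proof (induction rule: sigma_sets_induct_disjoint)
    case (basic A)
    then show ?case using tw_greaterThan_cl by auto
  next
    case empty
    show ?case using V.cl_scale[OF tw_greaterThan_cl[of 0], of 0] by simp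
  next
    case (compl A)
    have "(\<lambda>l. of_real (tw l ^ Suc 0) + (-1) * (of_real (tw l) * indicator A l)) \<in> V.cl"
      by (intro V.cl_add V.cl_scale tw_power_cl compl)
    also have "(\<lambda>l. of_real (tw l ^ Suc 0) + (-1) * (of_real (tw l) * indicator A l)) =
      (\<lambda>l. complex_of_real (tw l) * indicator (UNIV - A) l)"
      by (auto simp: fun_eq_iff split: split_indicator)
    finally show ?case .
  next
    case (union A)
    have sA [measurable]: "A i \<in> sets borel" for i
      using union(2) unfolding borel_Ioi by (auto simp: sets_measure_of)
    have scl: "(\<lambda>l. \<Sum>i\<le>n. of_real (tw l) * indicator (A i) l) \<in> V.cl" for n
      by (intro V.cl_sum union) auto
    show ?case
    proof (rule V.cl_dominated[OF scl, where b = "\<lambda>l. 1 * tw l"])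
      have eq: "(\<Sum>i\<le>n. complex_of_real (tw l) * indicator (A i) l) = of_real (tw l) * indicator (\<Union>i\<le>n. A i) l" for l n
      proof -
        have "(\<Sum>i\<le>n. indicator (A i) l :: complex) = indicator (\<Union>i\<le>n. A i) l"
          by (rule indicator_UN_disjoint[symmetric]) (use union(1) in \<open>auto intro: disjoint_family_on_mono\<close>)
        then show ?thesis by (simp add: sum_distrib_left[symmetric])
      qed
      show "AE l in T_measure \<nu>. (\<lambda>n. \<Sum>i\<le>n. complex_of_real (tw l) * indicator (A i) l) \<longlonglongrightarrow>
        of_real (tw l) * indicator (\<Union>i. A i) l"
      proof (rule AE_I2, rule tendsto_eventually)
        fix l
        show "\<forall>\<^sub>F n in sequentially. (\<Sum>i\<le>n. complex_of_real (tw l) * indicator (A i) l) = of_real (tw l) * indicator (\<Union>i. A i) l"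
        proof (cases "l \<in> (\<Union>i. A i)")
          case True
          then obtain i where i: "l \<in> A i" by blast
          show ?thesis unfolding eq
            by (rule eventually_sequentiallyI[of i]) (use i in \<open>auto split: split_indicator\<close>)
        next
          case False
          then show ?thesis by simp
        qed
      qed
      show "AE l in T_measure \<nu>. cmod (\<Sum>i\<le>n. complex_of_real (tw l) * indicator (A i) l) \<le> 1 * tw l" for n
        unfolding eq by (rule AE_I2) (use tw_bounds[OF T_pos] in \<open>force simp: norm_mult split: split_indicator\<close>)
      have "(\<Union>i. A i) \<in> sets borel" using sA by blast
      then show "(\<lambda>l. complex_of_real (tw l) * indicator (\<Union>i. A i) l) \<in> borel_measurable (T_measure \<nu>)"
        by (rule tw_indicator_measurable)
    qed (rule tw_sq_integrable)
  qed
qed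

lemma vertical_dense:
  assumes w: "w \<in> vcarrier (SQ (T_measure \<nu>))" and e: "e > 0"
  obtains f g where "hardy_pair f g"
    "vnorm (SQ (T_measure \<nu>)) (vdiff (SQ (T_measure \<nu>)) (\<lambda>l. f (\<i> * of_real l)) w) < e"
proof -
  have "w \<in> V.cl"
  proof (rule V.cl_all[OF tw_measurable _ _ w])
    show "tw l > 0" if "l \<in> space (T_measure \<nu>)" for l using tw_bounds[OF T_pos[OF that]] by simp
    show "(\<lambda>l. of_real (tw l) * indicator A l) \<in> V.cl" if "A \<in> sets (T_measure \<nu>)" for A
    proof (rule tw_borel_cl)
      have "A \<in> sets (restrict_space borel {0<..})" using that by (simp add: sets_T)
      then show "A \<in> sets borel" by (subst (asm) sets_restrict_space_iff) auto
    qed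
  qed
  from V.clD[OF this e] show ?thesis using that unfolding verticals_def by blast
qed

end

section \<open>The Osterwalder--Schrader transform\<close>

text \<open>The Poisson formula sees only the class of the boundary function. The map from boundary
  classes to values on the imaginary axis is well defined for this reason.\<close>

lemma hardy_pair_unique:
  assumes p: "hardy_pair f g" and p': "hardy_pair f' g'" and eq: "AE x in lborel. g x = g' x" and z: "Im z > 0"
  shows "f z = f' z"
proof -
  have [measurable]: "g \<in> borel_measurable borel" "g' \<in> borel_measurable borel"
    using hardy_pairD(2)[OF p] hardy_pairD(2)[OF p'] by (simp_all add: SQ_simps)
  have "(LINT x|lborel. of_real (Im z / ((x - Re z)\<^sup>2 + (Im z)\<^sup>2)) * g x) =
    (LINT x|lborel. of_real (Im z / ((x - Re z)\<^sup>2 + (Im z)\<^sup>2)) * g' x)"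
  proof (rule integral_cong_AE)
    show "AE x in lborel. of_real (Im z / ((x - Re z)\<^sup>2 + (Im z)\<^sup>2)) * g x = of_real (Im z / ((x - Re z)\<^sup>2 + (Im z)\<^sup>2)) * g' x"
      using eq by eventually_elim simp
  qed measurable
  then show ?thesis unfolding hardy_pair_Poisson[OF p z] hardy_pair_Poisson[OF p' z] by simp
qed

lemma SQ_coset_eq_iff:
  assumes "g \<in> vcarrier (SQ M)" "g' \<in> vcarrier (SQ M)"
  shows "vcoset (SQ M) (vnull (SQ M)) g = vcoset (SQ M) (vnull (SQ M)) g' \<longleftrightarrow> (AE x in M. g x = g' x)"
proof -
  interpret Q: semi_ip "SQ M" by (rule semi_ip_SQ)
  show ?thesis
    unfolding Q.coset_eq_iff[OF assms] SQ_simps(5) SQ_norm_zero_iff[OF SQ_diff[OF assms]] by simp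
qed

lemma hardy2_L2_eq: "hardy2_L2 = {L2_class lborel g | f g. hardy_pair f g}"
  unfolding hardy2_L2_def hardy_pair_iff ..

section \<open>The reflected form on boundary classes\<close>

context nu_data
begin

abbreviation E :: "(real \<Rightarrow> complex) set ip_space" where
  "E \<equiv> L2 lborel"

abbreviation \<theta> :: "(real \<Rightarrow> complex) set \<Rightarrow> (real \<Rightarrow> complex) set" where
  "\<theta> \<equiv> reflect (h_fun \<nu>)"

abbreviation OS :: "(real \<Rightarrow> complex) set ip_space" where
  "OS \<equiv> os_form E hardy2_L2 \<theta>"

lemma reflected_SQ:
  assumes g: "g \<in> vcarrier (SQ lborel)"
  shows "(\<lambda>x. h_fun \<nu> x * g (- x)) \<in> vcarrier (SQ lborel)"
proof -
  have [measurable]: "g \<in> borel_measurable borel" using g by (simp add: SQ_simps)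
  have "integrable lborel (\<lambda>x. (cmod (g (0 + -1 * x)))\<^sup>2)"
    by (rule lborel_integrable_real_affine) (use g in \<open>auto simp: SQ_simps\<close>)
  then have "(\<lambda>x. g (- x)) \<in> vcarrier (SQ lborel)" by (simp add: SQ_simps)
  then have "(\<lambda>x. g (- x) * h_fun \<nu> x) \<in> vcarrier (SQ lborel)"
  proof (rule SQ_mult_bounded)
    have "AE x in lborel. x \<noteq> (0::real)" by (rule AE_lborel_singleton)
    then show "AE x in lborel. cmod (h_fun \<nu> x) \<le> 1" by eventually_elim (simp add: h_fun_cmod)
    show "h_fun \<nu> \<in> borel_measurable lborel" using h_fun_measurable by simp
  qed
  then show ?thesis by (simp only: mult.commute)
qed

text \<open>The reflection x to -x preserves Lebesgue null sets, so all representatives yield the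
  same class and the union in \<open>reflect\<close> ranges over one set.\<close>

lemma reflect_L2_class:
  assumes g: "g \<in> vcarrier (SQ lborel)"
  shows "\<theta> (L2_class lborel g) = L2_class lborel (\<lambda>x. h_fun \<nu> x * g (- x))"
proof -
  interpret Q: semi_ip "SQ lborel :: (real \<Rightarrow> complex) ip_space" by (rule semi_ip_SQ)
  have const: "L2_class lborel (\<lambda>x. h_fun \<nu> x * f (- x)) = L2_class lborel (\<lambda>x. h_fun \<nu> x * g (- x))"
    if f: "f \<in> L2_class lborel g" for f
  proof -
    note fm = Q.coset_memD[OF f[unfolded L2_class_eq] g]
    have ae: "AE x in lborel. f x = g x" using fm(3) SQ_coset_eq_iff[OF fm(1) g] by simp
    then have "AE x in distr lborel borel uminus. f x = g x" unfolding lborel_distr_uminus .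
    then have "AE x in lborel. f (- x) = g (- x)" by (rule AE_distrD[rotated]) simp
    then have "AE x in lborel. h_fun \<nu> x * f (- x) = h_fun \<nu> x * g (- x)" by eventually_elim simp
    then show ?thesis
      unfolding L2_class_eq SQ_coset_eq_iff[OF reflected_SQ[OF fm(1)] reflected_SQ[OF g]] .
  qed
  have "g \<in> L2_class lborel g" unfolding L2_class_eq by (rule Q.coset_self[OF g])
  then show ?thesis unfolding reflect_def by (rule UN_constant_eq) (intro ballI const)
qed

lemma OS_simps:
  "vcarrier OS = hardy2_L2" "vadd OS = vadd E" "vscale OS = vscale E"
  "vinner OS \<eta> \<xi> = vinner E \<eta> (\<theta> \<xi>)"
  by (simp_all add: os_form_def)

lemma OS_carrierE:
  assumes "\<eta> \<in> vcarrier OS"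
  obtains f g where "hardy_pair f g" "\<eta> = L2_class lborel g"
proof -
  have "\<eta> \<in> hardy2_L2" using assms by (simp only: OS_simps(1))
  then show ?thesis using that unfolding hardy2_L2_eq by blast
qed

lemma OS_carrierI: "hardy_pair f g \<Longrightarrow> L2_class lborel g \<in> vcarrier OS"
proof -
  assume "hardy_pair f g"
  then have "L2_class lborel g \<in> hardy2_L2" unfolding hardy2_L2_eq by blast
  then show ?thesis by (simp only: OS_simps(1))
qed

lemma OS_add:
  assumes "hardy_pair f1 g1" "hardy_pair f2 g2"
  shows "vadd OS (L2_class lborel g1) (L2_class lborel g2) = L2_class lborel (\<lambda>x. g1 x + g2 x)"
  using semi_ip.quotient_add[OF semi_ip_SQ hardy_pairD(2)[OF assms(1)] hardy_pairD(2)[OF assms(2)]]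
  unfolding OS_simps(2) unfolding L2_eq L2_class_eq SQ_simps(2) .

lemma OS_scale:
  assumes "hardy_pair f g"
  shows "vscale OS c (L2_class lborel g) = L2_class lborel (\<lambda>x. c * g x)"
  using semi_ip.quotient_scale[OF semi_ip_SQ hardy_pairD(2)[OF assms]]
  unfolding OS_simps(3) unfolding L2_eq L2_class_eq SQ_simps(3) .

lemma OS_inner:
  assumes p: "hardy_pair f1 g1" "hardy_pair f2 g2"
  shows "vinner OS (L2_class lborel g1) (L2_class lborel g2) =
    vinner (SQ (T_measure \<nu>)) (\<lambda>l. f1 (\<i> * of_real l)) (\<lambda>l. f2 (\<i> * of_real l))"
proof -
  note g = hardy_pairD(2)[OF p(1)] hardy_pairD(2)[OF p(2)]
  have "vinner OS (L2_class lborel g1) (L2_class lborel g2) =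
    vinner E (L2_class lborel g1) (L2_class lborel (\<lambda>x. h_fun \<nu> x * g2 (- x)))"
    unfolding OS_simps reflect_L2_class[OF g(2)] ..
  also have "\<dots> = vinner (SQ lborel) g1 (\<lambda>x. h_fun \<nu> x * g2 (- x))"
    unfolding L2_eq L2_class_eq by (rule semi_ip.quotient_inner[OF semi_ip_SQ g(1) reflected_SQ[OF g(2)]])
  also have "\<dots> = vinner (SQ (T_measure \<nu>)) (\<lambda>l. f1 (\<i> * of_real l)) (\<lambda>l. f2 (\<i> * of_real l))"
    unfolding SQ_simps(4) by (rule reflected_form[OF p])
  finally show ?thesis .
qed

text \<open>The vector space laws are inherited from L2. Symmetry and positivity are not evident for
  a form twisted by a reflection; \<open>OS_inner\<close> transfers them from the weighted scalar
  product on the imaginary axis.\<close>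

lemma semi_ip_OS: "semi_ip OS"
proof -
  interpret T: semi_ip "SQ (T_measure \<nu>)" by (rule semi_ip_SQ)
  have EE: "semi_ip E" unfolding L2_eq by (rule semi_ip.semi_ip_quotient[OF semi_ip_SQ])
  then interpret EE: semi_ip E .
  have sub: "x \<in> vcarrier E" if "x \<in> vcarrier OS" for x
  proof -
    obtain f g where p: "hardy_pair f g" "x = L2_class lborel g" using OS_carrierE[OF \<open>x \<in> vcarrier OS\<close>] .
    show ?thesis unfolding p(2) L2_eq L2_class_eq semi_ip.quotient_carrier[OF semi_ip_SQ]
      using hardy_pairD(2)[OF p(1)] by (rule imageI)
  qed
  show ?thesis
  proof (unfold_locales, goal_cases)
    case (1 x y)
    obtain f1 g1 where p: "hardy_pair f1 g1" "x = L2_class lborel g1" using OS_carrierE[OF 1(1)] .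
    obtain f2 g2 where q: "hardy_pair f2 g2" "y = L2_class lborel g2" using OS_carrierE[OF 1(2)] .
    show ?case unfolding p(2) q(2) OS_add[OF p(1) q(1)] by (rule OS_carrierI[OF hardy_pair_add[OF p(1) q(1)]])
  next
    case (2 x c)
    obtain f g where p: "hardy_pair f g" "x = L2_class lborel g" using OS_carrierE[OF 2] .
    show ?case unfolding p(2) OS_scale[OF p(1)] by (rule OS_carrierI[OF hardy_pair_scale[OF p(1)]])
  next
    case 3
    show ?case using OS_carrierI[OF hardy_pair_resolvent] by blast
  next
    case (4 x y z)
    then show ?case unfolding OS_simps(2) by (intro EE.add_assoc sub)
  next
    case (5 x y)
    then show ?case unfolding OS_simps(2) by (intro EE.add_comm sub)
  next
    case (6 x y c)
    then show ?case unfolding OS_simps(2,3) by (intro EE.scale_add_right sub)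
  next
    case (7 x c d)
    then show ?case unfolding OS_simps(2,3) by (intro EE.scale_add_left sub)
  next
    case (8 x c d)
    then show ?case unfolding OS_simps(3) by (intro EE.scale_scale sub)
  next
    case (9 x)
    then show ?case unfolding OS_simps(3) by (intro EE.scale_one sub)
  next
    case (10 x y)
    then show ?case unfolding OS_simps(2,3) by (intro EE.add_zero sub)
  next
    case (11 x y z)
    obtain f1 g1 where p: "hardy_pair f1 g1" "x = L2_class lborel g1" using OS_carrierE[OF 11(1)] .
    obtain f2 g2 where q: "hardy_pair f2 g2" "y = L2_class lborel g2" using OS_carrierE[OF 11(2)] .
    obtain f3 g3 where r: "hardy_pair f3 g3" "z = L2_class lborel g3" using OS_carrierE[OF 11(3)] .
    show ?case
      unfolding p(2) q(2) r(2) OS_add[OF q(1) r(1)] OS_inner[OF p(1) hardy_pair_add[OF q(1) r(1)]]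
        OS_inner[OF p(1) q(1)] OS_inner[OF p(1) r(1)]
      using T.inner_add[OF vertical_SQ[OF p(1)] vertical_SQ[OF q(1)] vertical_SQ[OF r(1)]] unfolding SQ_simps(2) .
  next
    case (12 x y c)
    obtain f1 g1 where p: "hardy_pair f1 g1" "x = L2_class lborel g1" using OS_carrierE[OF 12(1)] .
    obtain f2 g2 where q: "hardy_pair f2 g2" "y = L2_class lborel g2" using OS_carrierE[OF 12(2)] .
    show ?case
      unfolding p(2) q(2) OS_scale[OF q(1)] OS_inner[OF p(1) hardy_pair_scale[OF q(1)]] OS_inner[OF p(1) q(1)]
      using T.inner_scale[OF vertical_SQ[OF p(1)] vertical_SQ[OF q(1)]] unfolding SQ_simps(3) .
  next
    case (13 x y)
    obtain f1 g1 where p: "hardy_pair f1 g1" "x = L2_class lborel g1" using OS_carrierE[OF 13(1)] .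
    obtain f2 g2 where q: "hardy_pair f2 g2" "y = L2_class lborel g2" using OS_carrierE[OF 13(2)] .
    show ?case
      unfolding p(2) q(2) OS_inner[OF p(1) q(1)] OS_inner[OF q(1) p(1)]
      by (rule T.inner_cnj[OF vertical_SQ[OF p(1)] vertical_SQ[OF q(1)]])
  next
    case (14 x)
    obtain f g where p: "hardy_pair f g" "x = L2_class lborel g" using OS_carrierE[OF 14] .
    show ?case unfolding p(2) OS_inner[OF p(1) p(1)] by (rule T.inner_pos[OF vertical_SQ[OF p(1)]])
  qed
qed

text \<open>A class of boundary functions determines the Hardy function on the half-plane but not
  its values elsewhere, so \<open>SOME\<close> picks a representative; the class of its restriction
  to the imaginary axis does not depend on the choice.\<close>

lemma OS_isometry:
  obtains J where "linear_isometry OS (L2 (T_measure \<nu>)) J"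
    "\<And>f g. hardy_pair f g \<Longrightarrow> J (L2_class lborel g) = L2_class (T_measure \<nu>) (\<lambda>l. f (\<i> * of_real l))"
proof
  define V where "V f = L2_class (T_measure \<nu>) (\<lambda>l. f (\<i> * of_real l))" for f :: "complex \<Rightarrow> complex"
  define J where "J \<eta> = V (SOME f. \<exists>g. hardy_pair f g \<and> \<eta> = L2_class lborel g)" for \<eta>
  interpret T: semi_ip "SQ (T_measure \<nu>)" by (rule semi_ip_SQ)
  have JV: "J (L2_class lborel g) = V f" if p: "hardy_pair f g" for f g
  proof -
    define f' where "f' = (SOME f'. \<exists>g'. hardy_pair f' g' \<and> L2_class lborel g = L2_class lborel g')"
    have "\<exists>f' g'. hardy_pair f' g' \<and> L2_class lborel g = L2_class lborel g'" using p by blast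
    from someI_ex[OF this] have "\<exists>g'. hardy_pair f' g' \<and> L2_class lborel g = L2_class lborel g'"
      unfolding f'_def .
    then obtain g' where p': "hardy_pair f' g'" "L2_class lborel g = L2_class lborel g'" by blast
    have ae: "AE x in lborel. g' x = g x"
      using p'(2)[symmetric] unfolding L2_class_eq SQ_coset_eq_iff[OF hardy_pairD(2)[OF p'(1)] hardy_pairD(2)[OF p]] .
    have "AE l in T_measure \<nu>. f' (\<i> * of_real l) = f (\<i> * of_real l)"
      by (rule AE_I2, rule hardy_pair_unique[OF p'(1) p ae]) (simp add: T_pos)
    then have "V f' = V f"
      unfolding V_def L2_class_eq SQ_coset_eq_iff[OF vertical_SQ[OF p'(1)] vertical_SQ[OF p]] .
    then show ?thesis unfolding J_def f'_def .
  qed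
  then show "J (L2_class lborel g) = L2_class (T_measure \<nu>) (\<lambda>l. f (\<i> * of_real l))" if "hardy_pair f g" for f g
    using that unfolding V_def by blast
  note V_eq = V_def[unfolded L2_class_eq]
  show "linear_isometry OS (L2 (T_measure \<nu>)) J"
    unfolding linear_isometry_def
  proof (intro conjI ballI allI)
    fix x assume "x \<in> vcarrier OS"
    then obtain f g where p: "hardy_pair f g" "x = L2_class lborel g" by (rule OS_carrierE)
    note fv = vertical_SQ[OF p(1)]
    show "J x \<in> vcarrier (L2 (T_measure \<nu>))"
      unfolding p(2) JV[OF p(1)] V_eq L2_eq T.quotient_carrier by (rule imageI[OF fv])
    show "J (vscale OS c x) = vscale (L2 (T_measure \<nu>)) c (J x)" for c
      unfolding p(2) OS_scale[OF p(1)] JV[OF p(1)] JV[OF hardy_pair_scale[OF p(1)]]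
      using T.quotient_scale[OF fv, of c] unfolding V_eq L2_eq SQ_simps(3) by (rule sym)
    fix y assume "y \<in> vcarrier OS"
    then obtain f' g' where q: "hardy_pair f' g'" "y = L2_class lborel g'" by (rule OS_carrierE)
    note fv' = vertical_SQ[OF q(1)]
    show "J (vadd OS x y) = vadd (L2 (T_measure \<nu>)) (J x) (J y)"
      unfolding p(2) q(2) OS_add[OF p(1) q(1)] JV[OF p(1)] JV[OF q(1)] JV[OF hardy_pair_add[OF p(1) q(1)]]
      using T.quotient_add[OF fv fv'] unfolding V_eq L2_eq SQ_simps(2) by (rule sym)
    show "vinner (L2 (T_measure \<nu>)) (J x) (J y) = vinner OS x y"
      unfolding p(2) q(2) OS_inner[OF p(1) q(1)] JV[OF p(1)] JV[OF q(1)]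
      unfolding V_eq L2_eq by (rule T.quotient_inner[OF fv fv'])
  qed
qed

lemma os_quotient_eq: "os_quotient E hardy2_L2 \<theta> = vquotient OS (vnull OS)"
  and os_null_eq: "os_null E hardy2_L2 \<theta> = vnull OS"
proof -
  show "os_null E hardy2_L2 \<theta> = vnull OS" by (simp add: os_null_def vnull_def OS_simps)
  then show "os_quotient E hardy2_L2 \<theta> = vquotient OS (vnull OS)" by (simp add: os_quotient_def)
qed

text \<open>The isometry of \<open>OS\<close> annihilates null vectors and descends to the quotient,
  where \<open>vertical_dense\<close> gives dense range. The rest is the extension theorem for
  completions.\<close>

theorem os_transform_iso:
  "\<exists>!U. U \<in> extensional (vcarrier (os_transform E hardy2_L2 \<theta>)) \<and>
    isometric_isomorphism (os_transform E hardy2_L2 \<theta>) (L2 (T_measure \<nu>)) U \<and>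
    (\<forall>f\<in>hardy2. \<forall>g. boundary_function f g \<longrightarrow>
       U (os_class E hardy2_L2 \<theta> (L2_class lborel g)) =
       L2_class (T_measure \<nu>) (\<lambda>l. f (\<i> * of_real l)))"
proof -
  interpret O: semi_ip OS by (rule semi_ip_OS)
  interpret T: semi_ip "SQ (T_measure \<nu>)" by (rule semi_ip_SQ)
  let ?Q = "vquotient OS (vnull OS)"
  let ?W = "L2 (T_measure \<nu>)"
  obtain J0 where J0: "linear_isometry OS ?W J0"
    "\<And>f g. hardy_pair f g \<Longrightarrow> J0 (L2_class lborel g) = L2_class (T_measure \<nu>) (\<lambda>l. f (\<i> * of_real l))"
    by (rule OS_isometry) blast
  have W: "semi_ip ?W" "vdefinite ?W" "vcomplete ?W"
    unfolding L2_eq by (rule T.semi_ip_quotient T.quotient_definite T.quotient_complete[OF SQ_complete])+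
  obtain J where J: "linear_isometry ?Q ?W J" "\<And>x. x \<in> vcarrier OS \<Longrightarrow> J (vcoset OS (vnull OS) x) = J0 x"
    by (rule O.linear_isometry_quotient[OF J0(1) W(2)]) blast
  have dense: "\<exists>x\<in>vcarrier ?Q. vnorm ?W (vdiff ?W (J x) w) < e" if w: "w \<in> vcarrier ?W" and e: "e > 0" for w e
  proof -
    obtain w' where w': "w' \<in> vcarrier (SQ (T_measure \<nu>))" "w = vcoset (SQ (T_measure \<nu>)) (vnull (SQ (T_measure \<nu>))) w'"
      using w unfolding L2_eq T.quotient_carrier by blast
    obtain f g where p: "hardy_pair f g"
      "vnorm (SQ (T_measure \<nu>)) (vdiff (SQ (T_measure \<nu>)) (\<lambda>l. f (\<i> * of_real l)) w') < e"
      using vertical_dense[OF w'(1) e] .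
    let ?x = "vcoset OS (vnull OS) (L2_class lborel g)"
    have "vnorm ?W (vdiff ?W (J ?x) w) < e"
      unfolding J(2)[OF OS_carrierI[OF p(1)]] J0(2)[OF p(1)] w'(2)
      unfolding L2_eq L2_class_eq T.quotient_norm_diff[OF vertical_SQ[OF p(1)] w'(1)] by (rule p(2))
    moreover have "?x \<in> vcarrier ?Q" unfolding O.quotient_carrier by (rule imageI[OF OS_carrierI[OF p(1)]])
    ultimately show ?thesis by blast
  qed
  \<comment> \<open>Prescribing \<open>U\<close> for every Hardy function with boundary values is
    the same as prescribing it on the embedded quotient, because each of its elements is the coset
    of some boundary class. This brings the claim into the form of
    \<open>completion_iso\<close>.\<close>
  have U_iff: "(\<forall>f\<in>hardy2. \<forall>g. boundary_function f g \<longrightarrow>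
       U (os_class E hardy2_L2 \<theta> (L2_class lborel g)) = L2_class (T_measure \<nu>) (\<lambda>l. f (\<i> * of_real l))) \<longleftrightarrow>
    (\<forall>x\<in>vcarrier ?Q. U (completion_embed ?Q x) = J x)" for U
  proof -
    have "(\<forall>x\<in>vcarrier ?Q. U (completion_embed ?Q x) = J x) \<longleftrightarrow>
      (\<forall>\<eta>\<in>vcarrier OS. U (completion_embed ?Q (vcoset OS (vnull OS) \<eta>)) = J (vcoset OS (vnull OS) \<eta>))"
      unfolding O.quotient_carrier by blast
    also have "\<dots> \<longleftrightarrow> (\<forall>f g. hardy_pair f g \<longrightarrow>
      U (completion_embed ?Q (vcoset OS (vnull OS) (L2_class lborel g))) = L2_class (T_measure \<nu>) (\<lambda>l. f (\<i> * of_real l)))"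
    proof (intro iffI allI impI ballI)
      fix f g assume *: "\<forall>\<eta>\<in>vcarrier OS. U (completion_embed ?Q (vcoset OS (vnull OS) \<eta>)) = J (vcoset OS (vnull OS) \<eta>)"
        and p: "hardy_pair f g"
      show "U (completion_embed ?Q (vcoset OS (vnull OS) (L2_class lborel g))) = L2_class (T_measure \<nu>) (\<lambda>l. f (\<i> * of_real l))"
        using bspec[OF * OS_carrierI[OF p]] unfolding J(2)[OF OS_carrierI[OF p]] J0(2)[OF p] .
    next
      fix \<eta> assume *: "\<forall>f g. hardy_pair f g \<longrightarrow>
        U (completion_embed ?Q (vcoset OS (vnull OS) (L2_class lborel g))) = L2_class (T_measure \<nu>) (\<lambda>l. f (\<i> * of_real l))"
        and "\<eta> \<in> vcarrier OS"
      then obtain f g where p: "hardy_pair f g" "\<eta> = L2_class lborel g" using OS_carrierE by blast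
      show "U (completion_embed ?Q (vcoset OS (vnull OS) \<eta>)) = J (vcoset OS (vnull OS) \<eta>)"
        unfolding p(2) J(2)[OF OS_carrierI[OF p(1)]] J0(2)[OF p(1)] using * p(1) by blast
    qed
    also have "\<dots> \<longleftrightarrow> (\<forall>f\<in>hardy2. \<forall>g. boundary_function f g \<longrightarrow>
      U (os_class E hardy2_L2 \<theta> (L2_class lborel g)) = L2_class (T_measure \<nu>) (\<lambda>l. f (\<i> * of_real l)))"
      unfolding os_class_def os_quotient_eq os_null_eq hardy_pair_iff[symmetric] by blast
    finally show ?thesis by (rule sym)
  qed
  show ?thesis
    unfolding U_iff os_transform_def os_quotient_eq
    by (rule completion_iso[OF O.semi_ip_quotient W J(1) dense])
qed

end

theorem corollary4p71:
  fixes \<nu> :: "ennreal measure"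
    and E :: "(real \<Rightarrow> complex) set ip_space"
    and Ep :: "(real \<Rightarrow> complex) set set"
    and \<theta> :: "(real \<Rightarrow> complex) set \<Rightarrow> (real \<Rightarrow> complex) set"
  assumes "sets \<nu> = sets borel" and "finite_measure \<nu>" and "\<nu> \<noteq> null_measure borel"
  defines "E \<equiv> L2 lborel" and "Ep \<equiv> hardy2_L2" and "\<theta> \<equiv> reflect (h_fun \<nu>)"
  shows "\<exists>!U. U \<in> extensional (vcarrier (os_transform E Ep \<theta>)) \<and>
    isometric_isomorphism (os_transform E Ep \<theta>) (L2 (T_measure \<nu>)) U \<and>
    (\<forall>f\<in>hardy2. \<forall>g. boundary_function f g \<longrightarrow>
       U (os_class E Ep \<theta> (L2_class lborel g)) =
       L2_class (T_measure \<nu>) (\<lambda>l. f (\<i> * of_real l)))"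
proof -
  interpret nu_data \<nu> by (intro nu_data.intro nu_data_axioms.intro assms(1-3))
  show ?thesis unfolding E_def Ep_def \<theta>_def by (rule os_transform_iso)
qed


end
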